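(* Let $\gamma>3/4$. There is a constant $C_\gamma$ depending only on $\gamma$ such that the following holds. Let $\lambda>0$, and let $V:\mathbb{T}\times\mathbb{R}^+\to\mathbb{R}$ be of the form $V(x,t)=Q_x(x,t)/(t+1)$, where $Q$ is real-valued and for all $t\ge0$ $$\|Q(\cdot,t)\|_{L^\infty(\mathbb{T})}<\lambda(t+1)^{-\gamma},\qquad \|Q_x(\cdot,t)\|_{L^\infty(\mathbb{T})}<\lambda(t+1)^{1-\gamma}.$$ For $T\ge0$ put $V_T(x,t)=V(x,t)\chi_{t>T}$ and, for $k\in\mathbb{R}$, let $u_T(x,t,k)$ be the solution of $$i\partial_tu_T=-\frac{k}{(1+t)^2}\,\partial^2_{xx}u_T+V_Tu_T,\qquad u_T(x,0,k)=1,\qquad x\in\mathbb{T}.$$ Then $$\int_{\mathbb{R}}\sup_{t>T}\|1-u_T(\cdot,t,k)\|^4_{L^2(\mathbb{T})}\,dk\le C_\gamma\,\lambda^4(T+1)^{3-4\gamma}.$$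
   Context: $\mathbb{T}$ is the one-dimensional torus with normalized measure (so $\|1\|_{L^2(\mathbb{T})}=1$). $\chi_{t>T}$ is the indicator function of $\{t>T\}$. Solutions are understood in the sense of Duhamel's formula in $L^2(\mathbb{T})$ (mild solutions). *)

theory Defs
  imports "HOL-Probability.Essential_Supremum"
begin

text \<open>
  The torus is \<open>\<real>/2\<pi>\<int>\<close>.  A function on it is represented by its restriction to the fundamental
  domain \<open>[0, 2\<pi>)\<close>; the values of a representative off this domain are irrelevant, since
  everything below refers to the following normalised measure.
\<close>

definition torus :: "real measure" where
  "torus = uniform_measure lborel {0..<2 * pi}"

definition L2_torus :: "(real \<Rightarrow> complex) set" where
  "L2_torus = {f \<in> borel_measurable torus. integrable torus (\<lambda>x. (cmod (f x))\<^sup>2)}"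

definition L2_norm :: "(real \<Rightarrow> complex) \<Rightarrow> real" where
  "L2_norm f = sqrt (\<integral>x. (cmod (f x))\<^sup>2 \<partial>torus)"

definition L2_inner :: "(real \<Rightarrow> complex) \<Rightarrow> (real \<Rightarrow> complex) \<Rightarrow> complex" where
  "L2_inner f g = (\<integral>x. f x * cnj (g x) \<partial>torus)"

text \<open>An \<open>ereal\<close>, equal to \<open>\<infinity>\<close> if \<open>f\<close> is not measurable or not essentially bounded.\<close>

definition Linf_norm :: "(real \<Rightarrow> real) \<Rightarrow> ereal" where
  "Linf_norm f = esssup torus (\<lambda>x. ereal \<bar>f x\<bar>)"

definition smooth_periodic :: "(real \<Rightarrow> real) \<Rightarrow> bool" where
  "smooth_periodic \<phi> \<longleftrightarrow>
     (\<forall>x. \<phi> (x + 2 * pi) = \<phi> x) \<and> (\<forall>n x. (deriv ^^ n) \<phi> differentiable at x)"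

text \<open>
  The distributional derivative on the torus.  Since the test functions are periodic but need not
  vanish at \<open>0\<close>, this also forces the absolutely continuous representative of \<open>q\<close> to satisfy
  \<open>q(0) = q(2\<pi>)\<close>.
\<close>

definition weak_deriv :: "(real \<Rightarrow> real) \<Rightarrow> (real \<Rightarrow> real) \<Rightarrow> bool" where
  "weak_deriv q q' \<longleftrightarrow> integrable torus q \<and> integrable torus q' \<and>
     (\<forall>\<phi>. smooth_periodic \<phi> \<longrightarrow>
        (\<integral>x. q x * deriv \<phi> x \<partial>torus) = - (\<integral>x. q' x * \<phi> x \<partial>torus))"

definition fourier_coeff :: "(real \<Rightarrow> complex) \<Rightarrow> int \<Rightarrow> complex" where
  "fourier_coeff f n = L2_inner f (\<lambda>x. exp (\<i> * of_real (of_int n * x)))"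

text \<open>
  \<open>g = e\<^bsup>i a \<partial>\<^sub>x\<^sub>x\<^esup> f\<close> in \<open>L\<^sup>2\<close>.  This is a relation because functions stand for their classes modulo
  null sets: for every \<open>f\<close> in \<open>L\<^sup>2\<close> such a \<open>g\<close> exists and is unique almost everywhere.
\<close>

definition schroedinger_group :: "real \<Rightarrow> (real \<Rightarrow> complex) \<Rightarrow> (real \<Rightarrow> complex) \<Rightarrow> bool" where
  "schroedinger_group a f g \<longleftrightarrow> f \<in> L2_torus \<and> g \<in> L2_torus \<and>
     (\<forall>n. fourier_coeff g n = exp (- \<i> * of_real (a * (of_int n)\<^sup>2)) * fourier_coeff f n)"

text \<open>
  \<open>U\<^sub>k(t, s)\<close>, the propagator of \<open>i \<partial>\<^sub>t v = - k (1 + t)\<^sup>-\<^sup>2 \<partial>\<^sub>x\<^sub>x v\<close> from time \<open>s\<close> to time \<open>t\<close>; here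
  \<open>k / (1 + s) - k / (1 + t)\<close> is the integral of \<open>k (1 + r)\<^sup>-\<^sup>2\<close> over \<open>[s, t]\<close>.
\<close>

definition free_propagator ::
    "real \<Rightarrow> real \<Rightarrow> real \<Rightarrow> (real \<Rightarrow> complex) \<Rightarrow> (real \<Rightarrow> complex) \<Rightarrow> bool" where
  "free_propagator k t s = schroedinger_group (k / (1 + s) - k / (1 + t))"

text \<open>
  \<open>J\<close> is the \<open>L\<^sup>2\<close>-valued integral of \<open>F\<close> over \<open>A\<close>.  The space of classes of functions in
  \<open>L2_torus\<close> is not available as a Banach space type, so the Bochner integral is described by
  pairing: as \<open>L\<^sup>2\<close> of the torus is separable, weak measurability together with integrability of the
  norm is Bochner integrability, and \<open>J\<close> is then determined almost everywhere.
\<close>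

definition has_L2_integral ::
    "(real \<Rightarrow> real \<Rightarrow> complex) \<Rightarrow> (real \<Rightarrow> complex) \<Rightarrow> real set \<Rightarrow> bool" where
  "has_L2_integral F J A \<longleftrightarrow> J \<in> L2_torus \<and> (\<forall>s\<in>A. F s \<in> L2_torus) \<and>
     set_integrable lborel A (\<lambda>s. L2_norm (F s)) \<and>
     (\<forall>g\<in>L2_torus. set_integrable lborel A (\<lambda>s. L2_inner (F s) g) \<and>
        L2_inner J g = (LINT s:A|lborel. L2_inner (F s) g))"

text \<open>
  \<open>u \<in> C([0,\<infinity>); L\<^sup>2)\<close> and, for all \<open>t \<ge> 0\<close>, Duhamel's formula
  \<open>u(t) = U\<^sub>k(t, 0) u\<^sub>0 - i \<integral>\<^sub>0\<^sup>t U\<^sub>k(t, s) (W(s) u(s)) ds\<close> in \<open>L\<^sup>2\<close>, the mild form of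
  \<open>i \<partial>\<^sub>t u = - k (1 + t)\<^sup>-\<^sup>2 \<partial>\<^sub>x\<^sub>x u + W u\<close>, \<open>u(0) = u\<^sub>0\<close>.  The time variable comes first:
  \<open>W s x\<close>, \<open>u t x\<close>.
\<close>

definition mild_solution ::
    "real \<Rightarrow> (real \<Rightarrow> real \<Rightarrow> real) \<Rightarrow> (real \<Rightarrow> complex) \<Rightarrow> (real \<Rightarrow> real \<Rightarrow> complex) \<Rightarrow> bool" where
  "mild_solution k W u0 u \<longleftrightarrow>
     (\<forall>t\<ge>0. u t \<in> L2_torus) \<and>
     (\<forall>t\<ge>0. ((\<lambda>s. L2_norm (\<lambda>x. u s x - u t x)) \<longlongrightarrow> 0) (at t within {0..})) \<and>
     (\<forall>t\<ge>0. \<exists>f F J. free_propagator k t 0 u0 f \<and>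
        (\<forall>s\<in>{0..t}. free_propagator k t s (\<lambda>x. of_real (W s x) * u s x) (F s)) \<and>
        has_L2_integral F J {0..t} \<and>
        (AE x in torus. u t x = f x - \<i> * J x))"

end

theory Submission
  imports Defs "HOL-Probability.Probability" "HOL-Real_Asymp.Real_Asymp"
begin

text \<open>
  Let \<open>w = u - 1\<close>.  Since \<open>V\<close> is real, \<open>\<parallel>u\<parallel> = 1\<close> and \<open>\<parallel>w(t)\<parallel>\<^sup>2 = - 2 Im \<integral>\<^sub>T\<^sup>t \<langle>V u, 1\<rangle>\<close>; since \<open>V\<close> has mean
  zero, \<open>\<langle>V u, 1\<rangle> = \<langle>w, V\<rangle>\<close>.  Write \<open>G(r) = \<integral>\<^sub>r\<^sup>N U(r, s) V(s) ds\<close> for a large time horizon \<open>N\<close>.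
  Integrating by parts in \<open>\<integral>\<^sub>T\<^sup>t \<langle>w, V\<rangle>\<close> gives \<open>\<parallel>w(t)\<parallel>\<^sup>2 \<le> 2 M + 2 \<parallel>w(t)\<parallel> \<parallel>G(t)\<parallel>\<close> with
  \<open>M = \<integral>\<^sub>T\<^sup>N \<rho> \<parallel>G\<parallel>\<close> and \<open>\<rho>(r) = \<lambda> (1 + r) powr (- \<gamma>)\<close>, and the same trick applied to \<open>G\<close> itself gives
  \<open>\<parallel>G(t)\<parallel>\<^sup>2 \<le> 2 M\<close>.  Hence \<open>\<parallel>w(t)\<parallel>\<^sup>2 \<le> 12 M\<close> uniformly in \<open>t\<close>, so that no maximal inequality is needed.

  In each Fourier mode \<open>n \<noteq> 0\<close> the function \<open>k \<mapsto> G\<^sub>n(r)\<close> is a Fourier transform in the variable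
  \<open>n\<^sup>2 / (1 + s)\<close>.  As \<open>V = Q\<^sub>x / (1 + s)\<close>, Plancherel's inequality bounds its square integral by
  \<open>2 \<pi> \<integral>\<^sub>r\<^sup>\<infinity> |Q\<^sub>n|\<^sup>2\<close>: the derivative on \<open>Q\<close> and the decay of \<open>V\<close> exactly compensate the Jacobian.
  Summing over \<open>n\<close> and using Minkowski's inequality in \<open>r\<close> bounds the \<open>L\<^sup>2(dk)\<close> norm of \<open>M\<close> by \<open>C \<lambda>\<^sup>2 (T + 1) powr (3/2 - 2 \<gamma>)\<close>,
  where \<open>\<gamma> > 3/4\<close> makes the integral over \<open>r\<close> converge.
\<close>

section \<open>The space \<open>L\<^sup>2\<close> of the torus\<close>

text \<open>The bound \<open>12 * M N k\<close> contains \<open>V\<close> but not \<open>u\<close>.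
  The solutions for different \<open>k\<close> are unrelated, so the supremum over \<open>t\<close>
  need not be measurable in \<open>k\<close>, whereas \<open>M N\<close> is; Fatou's lemma is
  therefore applied to \<open>M N\<close> alone. The exponent 4 is the one that fits: squaring the
  bound on the squared norm of \<open>w\<close> produces the square of \<open>M\<close>, the
  quantity that Plancherel in \<open>k\<close> controls. The single parameter \<open>N\<close> cuts
  off the time horizon and the Fourier modes together. Before the limit all sums over modes are
  finite and commute with every integral. Parseval and dominated convergence restore the full sums
  for fixed \<open>k\<close> and \<open>t\<close>, and the final bounds are uniform in
  \<open>N\<close>. The mode \<open>n = 0\<close> does not oscillate in \<open>k\<close>, so
  Plancherel cannot control it. It is absent from \<open>G\<close> because \<open>V\<close> is a
  derivative in \<open>x\<close>.\<close>

lemma sets_torus [measurable_cong, simp]: "sets torus = sets borel"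
  by (simp add: torus_def)

lemma space_torus [simp]: "space torus = UNIV"
  by (simp add: torus_def)

lemma borel_measurable_torus [simp]: "borel_measurable torus = borel_measurable borel"
  by (simp cong: measurable_cong_sets)

interpretation torus: prob_space torus
  unfolding torus_def by (rule prob_space_uniform_measure) auto

lemma AE_torusI:
  assumes "AE x in lborel. x \<in> {0..<2 * pi} \<longrightarrow> P x"
  shows "AE x in torus. P x"
  unfolding torus_def using assms by (intro AE_uniform_measureI) auto

lemma torus_eq_density: "torus = density lborel (\<lambda>x. ennreal (indicator {0..<2 * pi} x / (2 * pi)))"
proof -
  have "indicator {0..<2 * pi} x / emeasure lborel {0..<2 * pi}
        = ennreal (indicator {0..<2 * pi} x / (2 * pi))" for x :: real
    by (auto simp: indicator_def divide_ennreal ennreal_1[symmetric] simp del: ennreal_1)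
  then show ?thesis
    by (simp add: torus_def uniform_measure_def)
qed

lemma integral_torus:
  fixes f :: "real \<Rightarrow> 'a::{banach, second_countable_topology}"
  assumes "f \<in> borel_measurable borel"
  shows "(\<integral>x. f x \<partial>torus) = (1 / (2 * pi)) *\<^sub>R (LBINT x:{0..<2 * pi}. f x)"
proof -
  have "(\<integral>x. f x \<partial>torus) = (\<integral>x. (indicator {0..<2 * pi} x / (2 * pi)) *\<^sub>R f x \<partial>lborel)"
    unfolding torus_eq_density using assms by (intro integral_density) (auto simp: indicator_def)
  also have "\<dots> = (\<integral>x. (1 / (2 * pi)) *\<^sub>R (indicator {0..<2 * pi} x *\<^sub>R f x) \<partial>lborel)"
    by (intro Bochner_Integration.integral_cong) auto
  also have "\<dots> = (1 / (2 * pi)) *\<^sub>R (LBINT x:{0..<2 * pi}. f x)"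
    unfolding set_lebesgue_integral_def by (rule integral_scaleR_right)
  finally show ?thesis .
qed

lemma borel_measurable_cnj [measurable]: "cnj \<in> borel_measurable borel"
  by (intro borel_measurable_continuous_onI continuous_intros)

lemma L2_torus_iff:
  "f \<in> L2_torus \<longleftrightarrow> f \<in> borel_measurable borel \<and> integrable torus (\<lambda>x. (cmod (f x))\<^sup>2)"
  by (simp add: L2_torus_def)

lemma L2_torus_measurable: "f \<in> L2_torus \<Longrightarrow> f \<in> borel_measurable borel"
  by (simp add: L2_torus_iff)

lemma L2_torus_dominated:
  assumes "f \<in> borel_measurable borel" "integrable torus w" "AE x in torus. (cmod (f x))\<^sup>2 \<le> w x"
  shows "f \<in> L2_torus"
proof -
  have "integrable torus (\<lambda>x. (cmod (f x))\<^sup>2)"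
    by (rule Bochner_Integration.integrable_bound[OF assms(2)]) (use assms in auto)
  then show ?thesis using assms by (simp add: L2_torus_iff)
qed

lemma L2_torus_bounded:
  assumes "f \<in> borel_measurable borel" "AE x in torus. cmod (f x) \<le> B"
  shows "f \<in> L2_torus"
  proof (rule L2_torus_dominated[where w = "\<lambda>_. B\<^sup>2"])
  show "AE x in torus. (cmod (f x))\<^sup>2 \<le> B\<^sup>2"
    using assms(2) by eventually_elim (simp add: power_mono)
qed (use assms in auto)

lemma cmod_add_squared_le: "(cmod (a + b))\<^sup>2 \<le> 2 * (cmod a)\<^sup>2 + 2 * (cmod b)\<^sup>2"
proof -
  have "(cmod (a + b))\<^sup>2 \<le> (cmod a + cmod b)\<^sup>2" by (simp add: norm_triangle_ineq power_mono)
  also have "\<dots> \<le> 2 * (cmod a)\<^sup>2 + 2 * (cmod b)\<^sup>2"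
    using zero_le_power2[of "cmod a - cmod b"] by (simp add: power2_eq_square algebra_simps)
  finally show ?thesis .
qed

lemma L2_torus_add:
  assumes "f \<in> L2_torus" "g \<in> L2_torus"
  shows "(\<lambda>x. f x + g x) \<in> L2_torus"
  by (rule L2_torus_dominated[where w = "\<lambda>x. 2 * (cmod (f x))\<^sup>2 + 2 * (cmod (g x))\<^sup>2"])
     (use assms in \<open>auto simp: L2_torus_iff cmod_add_squared_le\<close>)

lemma L2_torus_cmult: "f \<in> L2_torus \<Longrightarrow> (\<lambda>x. c * f x) \<in> L2_torus"
  by (auto simp: L2_torus_iff norm_mult power_mult_distrib)

lemma L2_torus_diff:
  assumes "f \<in> L2_torus" "g \<in> L2_torus"
  shows "(\<lambda>x. f x - g x) \<in> L2_torus"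
  using L2_torus_add[OF assms(1) L2_torus_cmult[OF assms(2), of "-1"]] by simp

lemma L2_torus_const: "(\<lambda>_. c) \<in> L2_torus"
  by (simp add: L2_torus_iff)

lemma L2_torus_sum:
  assumes "\<And>i. i \<in> I \<Longrightarrow> f i \<in> L2_torus"
  shows "(\<lambda>x. \<Sum>i\<in>I. f i x) \<in> L2_torus"
  using assms
proof (induction I rule: infinite_finite_induct)
  case (insert i I)
  then have "(\<lambda>x. f i x + (\<Sum>i\<in>I. f i x)) \<in> L2_torus" by (intro L2_torus_add) auto
  then show ?case using insert by simp
qed (auto simp: L2_torus_const)

lemma L2_inner_integrable:
  assumes "f \<in> L2_torus" "g \<in> L2_torus"
  shows "integrable torus (\<lambda>x. f x * cnj (g x))"
proof -
  have [measurable]: "f \<in> borel_measurable borel" "g \<in> borel_measurable borel"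
    using assms by (auto simp: L2_torus_iff)
  have "integrable torus (\<lambda>x. (cmod (f x))\<^sup>2 + (cmod (g x))\<^sup>2)"
    using assms by (auto simp: L2_torus_iff)
  then show ?thesis
  proof (rule Bochner_Integration.integrable_bound)
    have "cmod (f x) * cmod (g x) \<le> (cmod (f x))\<^sup>2 + (cmod (g x))\<^sup>2" for x
      using sum_squares_bound[of "cmod (f x)" "cmod (g x)"]
        mult_nonneg_nonneg[OF norm_ge_zero[of "f x"] norm_ge_zero[of "g x"]]
      unfolding mult.assoc by linarith
    then show "AE x in torus. norm (f x * cnj (g x)) \<le> norm ((cmod (f x))\<^sup>2 + (cmod (g x))\<^sup>2)"
      by (auto simp: norm_mult)
  qed simp
qed

lemma L2_inner_add_left:
  "\<lbrakk>f \<in> L2_torus; g \<in> L2_torus; h \<in> L2_torus\<rbrakk> \<Longrightarrow>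
     L2_inner (\<lambda>x. f x + g x) h = L2_inner f h + L2_inner g h"
  by (simp add: L2_inner_def distrib_right L2_inner_integrable)

lemma L2_inner_diff_left:
  "\<lbrakk>f \<in> L2_torus; g \<in> L2_torus; h \<in> L2_torus\<rbrakk> \<Longrightarrow>
     L2_inner (\<lambda>x. f x - g x) h = L2_inner f h - L2_inner g h"
  by (simp add: L2_inner_def left_diff_distrib L2_inner_integrable)

lemma L2_inner_cmult_left:
  "L2_inner (\<lambda>x. c * f x) h = c * L2_inner f h"
  by (simp add: L2_inner_def mult.assoc)

lemma L2_inner_sum_left:
  assumes "\<And>i. i \<in> I \<Longrightarrow> f i \<in> L2_torus" "h \<in> L2_torus"
  shows "L2_inner (\<lambda>x. \<Sum>i\<in>I. f i x) h = (\<Sum>i\<in>I. L2_inner (f i) h)"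
proof -
  have "L2_inner (\<lambda>x. \<Sum>i\<in>I. f i x) h = (\<integral>x. (\<Sum>i\<in>I. f i x * cnj (h x)) \<partial>torus)"
    by (simp add: L2_inner_def sum_distrib_right)
  also have "\<dots> = (\<Sum>i\<in>I. L2_inner (f i) h)"
    unfolding L2_inner_def using assms by (intro Bochner_Integration.integral_sum L2_inner_integrable) auto
  finally show ?thesis .
qed

lemma cnj_L2_inner: "cnj (L2_inner f g) = L2_inner g f"
proof -
  have "cnj (L2_inner f g) = (\<integral>x. cnj (f x * cnj (g x)) \<partial>torus)"
    unfolding L2_inner_def by (intro integral_bounded_linear'[OF bounded_linear_cnj bounded_linear_cnj, symmetric]) simp
  then show ?thesis by (simp add: L2_inner_def mult.commute)
qed

lemma L2_norm_nonneg [simp]: "0 \<le> L2_norm f"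
  by (simp add: L2_norm_def)

lemma L2_norm_squared: "(L2_norm f)\<^sup>2 = (\<integral>x. (cmod (f x))\<^sup>2 \<partial>torus)"
  by (simp add: L2_norm_def)

lemma L2_inner_self: "L2_inner f f = of_real ((L2_norm f)\<^sup>2)"
  by (simp add: L2_inner_def L2_norm_squared complex_norm_square[symmetric] flip: of_real_power)

lemma L2_norm_add_squared:
  assumes "f \<in> L2_torus" "g \<in> L2_torus"
  shows "(L2_norm (\<lambda>x. f x + g x))\<^sup>2 = (L2_norm f)\<^sup>2 + 2 * Re (L2_inner f g) + (L2_norm g)\<^sup>2"
proof -
  note L2 = assms L2_torus_add[OF assms]
  have right: "L2_inner h (\<lambda>x. f x + g x) = L2_inner h f + L2_inner h g" if "h \<in> L2_torus" for h
    using arg_cong[OF L2_inner_add_left[OF L2(1,2) that], of cnj] by (simp add: cnj_L2_inner)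
  have "complex_of_real ((L2_norm (\<lambda>x. f x + g x))\<^sup>2)
      = L2_inner f f + (L2_inner f g + cnj (L2_inner f g)) + L2_inner g g"
    unfolding L2_inner_self[symmetric] using L2 by (simp add: L2_inner_add_left right cnj_L2_inner)
  also have "\<dots> = of_real ((L2_norm f)\<^sup>2 + 2 * Re (L2_inner f g) + (L2_norm g)\<^sup>2)"
    by (simp add: L2_inner_self complex_add_cnj)
  finally show ?thesis using of_real_eq_iff by blast
qed

lemma L2_norm_cmult: "L2_norm (\<lambda>x. c * f x) = cmod c * L2_norm f"
  by (simp add: L2_norm_def norm_mult power_mult_distrib real_sqrt_mult)

lemma L2_inner_cong_AE:
  assumes "f \<in> borel_measurable borel" "g \<in> borel_measurable borel" "h \<in> borel_measurable borel"
    "AE x in torus. f x = g x"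
  shows "L2_inner f h = L2_inner g h"
  unfolding L2_inner_def
proof (intro integral_cong_AE)
  note [measurable] = assms(1-3)
  show "(\<lambda>x. f x * cnj (h x)) \<in> borel_measurable torus" "(\<lambda>x. g x * cnj (h x)) \<in> borel_measurable torus"
    by measurable
qed (use assms(4) in auto)

lemma L2_inner_eq_0:
  assumes "f \<in> L2_torus" "g \<in> L2_torus" "L2_norm g = 0"
  shows "L2_inner f g = 0"
proof -
  have "(\<integral>x. (cmod (g x))\<^sup>2 \<partial>torus) = 0" using assms(3) by (simp add: L2_norm_def)
  then have "AE x in torus. (cmod (g x))\<^sup>2 = 0"
    using assms(2) by (subst (asm) integral_nonneg_eq_0_iff_AE) (auto simp: L2_torus_iff)
  then have "AE x in torus. g x = 0" by auto
  then have "L2_inner g f = L2_inner (\<lambda>_. 0) f"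
    using assms by (intro L2_inner_cong_AE) (auto simp: L2_torus_iff)
  also have "\<dots> = 0" by (simp add: L2_inner_def)
  finally show ?thesis by (metis cnj_L2_inner complex_cnj_zero)
qed

lemma L2_Cauchy_Schwarz:
  assumes "f \<in> L2_torus" "g \<in> L2_torus"
  shows "cmod (L2_inner f g) \<le> L2_norm f * L2_norm g"
proof (cases "L2_norm g = 0")
  case True
  then show ?thesis using L2_inner_eq_0[OF assms] by simp
next
  case False
  define G where "G = (L2_norm g)\<^sup>2"
  have G: "G > 0" using False by (simp add: G_def)
  define z where "z = L2_inner f g"
  \<comment> \<open>This vector is \<open>G\<close> times the component of \<open>f\<close>
    orthogonal to \<open>g\<close>; the factor \<open>G\<close> avoids a division.\<close>
  have "0 \<le> (L2_norm (\<lambda>x. complex_of_real G * f x + (- z) * g x))\<^sup>2" by simp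
  also have "\<dots> = (L2_norm (\<lambda>x. complex_of_real G * f x))\<^sup>2
      + 2 * Re (L2_inner (\<lambda>x. complex_of_real G * f x) (\<lambda>x. (- z) * g x))
      + (L2_norm (\<lambda>x. (- z) * g x))\<^sup>2"
    by (intro L2_norm_add_squared L2_torus_cmult assms)
  also have "\<dots> = G\<^sup>2 * (L2_norm f)\<^sup>2 + 2 * Re (of_real G * L2_inner f (\<lambda>x. (- z) * g x))
                  + (cmod z)\<^sup>2 * G"
    by (simp only: L2_norm_cmult L2_inner_cmult_left power_mult_distrib)
       (simp add: G_def norm_power)
  also have "L2_inner f (\<lambda>x. (- z) * g x) = - cnj z * z"
    using arg_cong[OF L2_inner_cmult_left[of "- z" g f], of cnj] by (simp add: cnj_L2_inner z_def)
  also have "Re (of_real G * (- cnj z * z)) = - G * (cmod z)\<^sup>2"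
    by (simp add: cmod_power2) (simp add: power2_eq_square)
  finally have "G * (cmod z)\<^sup>2 \<le> G * (G * (L2_norm f)\<^sup>2)"
    by (simp add: power2_eq_square algebra_simps)
  then have "(cmod z)\<^sup>2 \<le> (L2_norm f * L2_norm g)\<^sup>2"
    using G by (simp add: G_def power_mult_distrib mult.commute)
  then show ?thesis unfolding z_def by (rule power2_le_imp_le) simp
qed

lemma L2_norm_triangle:
  assumes "f \<in> L2_torus" "g \<in> L2_torus"
  shows "L2_norm (\<lambda>x. f x + g x) \<le> L2_norm f + L2_norm g"
proof (rule power2_le_imp_le)
  have "Re (L2_inner f g) \<le> L2_norm f * L2_norm g"
    using L2_Cauchy_Schwarz[OF assms] complex_Re_le_cmod order_trans by blast
  then show "(L2_norm (\<lambda>x. f x + g x))\<^sup>2 \<le> (L2_norm f + L2_norm g)\<^sup>2"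
    unfolding L2_norm_add_squared[OF assms] by (simp add: power2_sum)
qed simp

lemma L2_norm_minus_commute: "L2_norm (\<lambda>x. f x - g x) = L2_norm (\<lambda>x. g x - f x)"
  by (simp add: L2_norm_def norm_minus_commute)

lemma L2_norm_triangle_diff:
  assumes "f \<in> L2_torus" "g \<in> L2_torus"
  shows "\<bar>L2_norm f - L2_norm g\<bar> \<le> L2_norm (\<lambda>x. f x - g x)"
  using L2_norm_triangle[OF L2_torus_diff[OF assms] assms(2)]
    L2_norm_triangle[OF L2_torus_diff[OF assms(2,1)] assms(1)]
  by (simp add: L2_norm_minus_commute[of g f])

lemma L2_norm_le_dominated:
  assumes "f \<in> borel_measurable borel" "g \<in> L2_torus" "c \<ge> 0"
    "AE x in torus. cmod (f x) \<le> c * cmod (g x)"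
  shows "L2_norm f \<le> c * L2_norm g"
proof -
  have *: "AE x in torus. (cmod (f x))\<^sup>2 \<le> c\<^sup>2 * (cmod (g x))\<^sup>2"
    using assms(4) by eventually_elim (metis norm_ge_zero power_mono power_mult_distrib)
  have "(L2_norm f)\<^sup>2 \<le> (\<integral>x. c\<^sup>2 * (cmod (g x))\<^sup>2 \<partial>torus)"
    unfolding L2_norm_squared using assms *
    by (intro integral_mono_AE L2_torus_dominated[unfolded L2_torus_iff, THEN conjunct2, OF _ _ *])
       (auto simp: L2_torus_iff)
  then have "(L2_norm f)\<^sup>2 \<le> (c * L2_norm g)\<^sup>2"
    by (simp add: L2_norm_squared power_mult_distrib)
  then show ?thesis by (rule power2_le_imp_le) (use assms in simp)
qed

section \<open>Fourier series\<close>

definition expi :: "int \<Rightarrow> real \<Rightarrow> complex" where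
  "expi n x = exp (\<i> * of_real (of_int n * x))"

lemma expi_measurable [measurable]: "expi n \<in> borel_measurable borel"
  unfolding expi_def by measurable

lemma cmod_expi [simp]: "cmod (expi n x) = 1"
  unfolding expi_def by (simp only: norm_exp_i_times)

lemma expi_0 [simp]: "expi 0 = (\<lambda>_. 1)"
  by (simp add: expi_def fun_eq_iff)

lemma expi_add: "expi (m + n) x = expi m x * expi n x"
  by (simp add: expi_def distrib_left distrib_right exp_add)

lemma cnj_expi: "cnj (expi n x) = expi (- n) x"
  by (simp add: expi_def exp_cnj)

lemma expi_L2 [simp]: "expi n \<in> L2_torus"
  by (rule L2_torus_bounded[where B = 1]) auto

lemma fourier_coeff_eq: "fourier_coeff f n = L2_inner f (expi n)"
  by (simp add: fourier_coeff_def expi_def[abs_def])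

lemma integral_expi: "(\<integral>x. expi n x \<partial>torus) = (if n = 0 then 1 else 0)"
proof (cases "n = 0")
  case False
  have "(LBINT x:{0..<2 * pi}. expi n x) = (LBINT x:{0..2 * pi}. expi n x)"
    unfolding set_lebesgue_integral_def
  proof (rule integral_cong_AE)
    show "AE x in lborel. indicat_real {0..<2 * pi} x *\<^sub>R expi n x = indicat_real {0..2 * pi} x *\<^sub>R expi n x"
      using AE_lborel_singleton[of "2 * pi"] by eventually_elim (auto simp: indicator_def)
  qed auto
  also have "\<dots> = expi n (2 * pi) / (\<i> * of_int n) - expi n 0 / (\<i> * of_int n)"
    unfolding set_lebesgue_integral_def
  proof (rule integral_FTC_Icc)
    show "((\<lambda>x. expi n x / (\<i> * of_int n)) has_vector_derivative expi n x) (at x within {0..2 * pi})" for x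
      unfolding expi_def using False
      by (auto intro!: derivative_eq_intros has_vector_derivative_real_field simp: field_simps)
    show "continuous_on {0..2 * pi} (expi n)"
      unfolding expi_def[abs_def] by (intro continuous_intros)
  qed simp
  also have "expi n (2 * pi) = 1"
    unfolding expi_def exp_eq_1 by auto
  finally show ?thesis using False by (simp add: integral_torus expi_def)
qed (simp add: torus.prob_space[simplified])

lemma L2_inner_expi: "L2_inner (expi m) (expi n) = (if m = n then 1 else 0)"
  by (simp add: L2_inner_def cnj_expi integral_expi flip: expi_add)

text \<open>Expanding the square, the cross term completes the square in each \<open>c n\<close>.
  One identity gives both Bessel's inequality (take \<open>c\<close> to be the Fourier coefficients)
  and the minimality of Fourier sums used for Parseval.\<close>

lemma L2_trig_error:
  assumes f: "f \<in> L2_torus" and A: "finite A"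
  shows "(L2_norm (\<lambda>x. f x - (\<Sum>n\<in>A. c n * expi n x)))\<^sup>2
       = (L2_norm f)\<^sup>2 - (\<Sum>n\<in>A. (cmod (fourier_coeff f n))\<^sup>2)
         + (\<Sum>n\<in>A. (cmod (c n - fourier_coeff f n))\<^sup>2)"
proof -
  \<comment> \<open>The sign turns the difference into a sum, the form that
    \<open>L2_norm_add_squared\<close> expands.\<close>
  define d where "d n = - c n" for n
  define g where "g = (\<lambda>x. \<Sum>n\<in>A. d n * expi n x)"
  have gL2: "g \<in> L2_torus" unfolding g_def by (intro L2_torus_sum L2_torus_cmult) simp
  have inner_g: "L2_inner g h = (\<Sum>n\<in>A. d n * cnj (fourier_coeff h n))" if "h \<in> L2_torus" for h
    unfolding g_def using that
    by (subst L2_inner_sum_left) (auto intro: L2_torus_cmult simp: L2_inner_cmult_left cnj_L2_inner fourier_coeff_eq)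
  have gcoeff: "fourier_coeff g m = d m" if "m \<in> A" for m
    unfolding g_def fourier_coeff_eq using that A
    by (subst L2_inner_sum_left)
       (auto intro: L2_torus_cmult simp: L2_inner_cmult_left L2_inner_expi if_distrib cong: if_cong)
  have "of_real ((L2_norm g)\<^sup>2) = (\<Sum>n\<in>A. complex_of_real ((cmod (c n))\<^sup>2))"
    unfolding L2_inner_self[symmetric] inner_g[OF gL2]
    by (intro sum.cong) (simp_all add: gcoeff d_def flip: complex_norm_square)
  then have g2: "(L2_norm g)\<^sup>2 = (\<Sum>n\<in>A. (cmod (c n))\<^sup>2)"
    by (simp only: of_real_sum[symmetric] of_real_eq_iff)
  have "Re (L2_inner f g) = Re (L2_inner g f)" by (simp flip: cnj_L2_inner[of f g])
  then have fg: "2 * Re (L2_inner f g) = (\<Sum>n\<in>A. - 2 * Re (c n * cnj (fourier_coeff f n)))"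
    unfolding inner_g[OF f] sum_distrib_left[symmetric] by (simp add: sum_negf d_def)
  have "(\<lambda>x. f x - (\<Sum>n\<in>A. c n * expi n x)) = (\<lambda>x. f x + g x)"
    by (simp add: g_def sum_negf d_def)
  then have "(L2_norm (\<lambda>x. f x - (\<Sum>n\<in>A. c n * expi n x)))\<^sup>2
      = (L2_norm f)\<^sup>2 + (\<Sum>n\<in>A. - 2 * Re (c n * cnj (fourier_coeff f n)) + (cmod (c n))\<^sup>2)"
    by (simp only: L2_norm_add_squared f gL2 fg g2 sum.distrib add.assoc)
  also have "(\<Sum>n\<in>A. - 2 * Re (c n * cnj (fourier_coeff f n)) + (cmod (c n))\<^sup>2)
      = (\<Sum>n\<in>A. (cmod (c n - fourier_coeff f n))\<^sup>2 - (cmod (fourier_coeff f n))\<^sup>2)"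
    by (intro sum.cong refl, unfold cmod_power2) (simp add: power2_eq_square algebra_simps)
  finally show ?thesis by (simp add: sum_subtractf)
qed

lemma Bessel_inequality:
  assumes "f \<in> L2_torus" "finite A"
  shows "(\<Sum>n\<in>A. (cmod (fourier_coeff f n))\<^sup>2) \<le> (L2_norm f)\<^sup>2"
  using L2_trig_error[OF assms, of "fourier_coeff f"]
    zero_le_power2[of "L2_norm (\<lambda>x. f x - (\<Sum>n\<in>A. fourier_coeff f n * expi n x))"] by simp

lemma cmod_sum_mult_le_L2_set:
  "cmod (\<Sum>n\<in>A. a n * b n) \<le> L2_set (\<lambda>n. cmod (a n)) A * L2_set (\<lambda>n. cmod (b n)) A"
proof -
  have "cmod (\<Sum>n\<in>A. a n * b n) \<le> (\<Sum>n\<in>A. \<bar>cmod (a n)\<bar> * \<bar>cmod (b n)\<bar>)"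
    by (rule order_trans[OF norm_sum]) (simp add: norm_mult)
  also have "\<dots> \<le> L2_set (\<lambda>n. cmod (a n)) A * L2_set (\<lambda>n. cmod (b n)) A"
    by (rule L2_set_mult_ineq)
  finally show ?thesis .
qed

lemma L2_set_fourier_coeff_le:
  assumes "f \<in> L2_torus" "finite A"
  shows "L2_set (\<lambda>n. cmod (fourier_coeff f n)) A \<le> L2_norm f"
  unfolding L2_set_def using Bessel_inequality[OF assms] by (intro real_le_lsqrt) auto

lemma cmod_sum_fourier_coeff_le:
  assumes "f \<in> L2_torus" "g \<in> L2_torus" "finite A"
  shows "cmod (\<Sum>n\<in>A. fourier_coeff f n * cnj (fourier_coeff g n)) \<le> L2_norm f * L2_norm g"
proof -
  have "cmod (\<Sum>n\<in>A. fourier_coeff f n * cnj (fourier_coeff g n))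
      \<le> L2_set (\<lambda>n. cmod (fourier_coeff f n)) A * L2_set (\<lambda>n. cmod (fourier_coeff g n)) A"
    using cmod_sum_mult_le_L2_set[of "fourier_coeff f" "\<lambda>n. cnj (fourier_coeff g n)" A] by simp
  also have "\<dots> \<le> L2_norm f * L2_norm g"
    by (intro mult_mono L2_set_fourier_coeff_le assms L2_set_nonneg L2_norm_nonneg)
  finally show ?thesis .
qed

section \<open>Trigonometric polynomials and their uniform density\<close>

inductive trig_poly :: "(real \<Rightarrow> complex) \<Rightarrow> bool" where
  expi: "trig_poly (\<lambda>x. c * expi n x)"
| add: "trig_poly f \<Longrightarrow> trig_poly g \<Longrightarrow> trig_poly (\<lambda>x. f x + g x)"

lemma trig_poly_L2: "trig_poly p \<Longrightarrow> p \<in> L2_torus"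
  by (induction rule: trig_poly.induct) (auto intro: L2_torus_cmult L2_torus_add)

lemma trig_poly_const: "trig_poly (\<lambda>_. c)"
  using trig_poly.expi[of c 0] by simp

lemma trig_poly_expi_mult: "trig_poly g \<Longrightarrow> trig_poly (\<lambda>x. c * expi n x * g x)"
proof (induction rule: trig_poly.induct)
  case (expi d m)
  then show ?case using trig_poly.expi[of "c * d" "n + m"] by (simp add: expi_add mult.assoc mult.left_commute)
next
  case (add f g)
  then show ?case using trig_poly.add by (simp add: distrib_left)
qed

lemma trig_poly_mult: "trig_poly f \<Longrightarrow> trig_poly g \<Longrightarrow> trig_poly (\<lambda>x. f x * g x)"
proof (induction rule: trig_poly.induct)
  case (expi c n)
  then show ?case by (rule trig_poly_expi_mult)
next
  case (add f h)
  then show ?case using trig_poly.add by (simp add: distrib_right)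
qed

lemma trig_poly_cmult: "trig_poly g \<Longrightarrow> trig_poly (\<lambda>x. c * g x)"
  using trig_poly_mult[OF trig_poly_const] .

text \<open>The inductive form of \<open>trig_poly\<close> makes closure under products a plain
  induction; here the coefficients are recovered. One function \<open>c\<close> serves all large
  symmetric ranges, so that two polynomials can be added over a common range and compared with the
  partial sums in \<open>Parseval\<close>.\<close>

lemma trig_poly_coeffs:
  assumes "trig_poly p"
  shows "\<exists>c. \<exists>K0. \<forall>K\<ge>K0. \<forall>x. p x = (\<Sum>n\<in>{- int K..int K}. c n * expi n x)"
  using assms
proof (induction rule: trig_poly.induct)
  case (expi c m)
  have "c * expi m x = (\<Sum>n\<in>{- int K..int K}. (if n = m then c else 0) * expi n x)"
    if "K \<ge> nat \<bar>m\<bar>" for K x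
  proof -
    have "(\<Sum>n\<in>{- int K..int K}. (if n = m then c else 0) * expi n x)
        = (\<Sum>n\<in>{- int K..int K}. if m = n then c * expi m x else 0)"
      by (intro sum.cong) auto
    also have "\<dots> = c * expi m x"
      using that by (subst sum.delta') auto
    finally show ?thesis by simp
  qed
  then have "\<forall>K\<ge>nat \<bar>m\<bar>. \<forall>x. c * expi m x = (\<Sum>n\<in>{- int K..int K}. (if n = m then c else 0) * expi n x)"
    by simp
  then show ?case by - (rule exI[of _ "\<lambda>n. if n = m then c else 0"], rule exI[of _ "nat \<bar>m\<bar>"])
next
  case (add f g)
  then obtain c d K0 L0 where
    c: "\<forall>K\<ge>K0. \<forall>x. f x = (\<Sum>n\<in>{- int K..int K}. c n * expi n x)" and
    d: "\<forall>K\<ge>L0. \<forall>x. g x = (\<Sum>n\<in>{- int K..int K}. d n * expi n x)" by blast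
  have "f x + g x = (\<Sum>n\<in>{- int K..int K}. (c n + d n) * expi n x)" if "K \<ge> max K0 L0" for K x
    unfolding distrib_right sum.distrib using that
    by (intro arg_cong2[where f = "(+)"] c[rule_format] d[rule_format]) auto
  then have "\<forall>K\<ge>max K0 L0. \<forall>x. f x + g x = (\<Sum>n\<in>{- int K..int K}. (c n + d n) * expi n x)"
    by blast
  then show ?case by - (rule exI[of _ "\<lambda>n. c n + d n"], rule exI[of _ "max K0 L0"])
qed

lemma cis_eq_expi: "cis x = expi 1 x"
  by (simp add: expi_def cis_conv_exp)

lemma trig_poly_cos: "trig_poly (\<lambda>x. of_real (cos x))"
proof -
  have "(\<lambda>x. complex_of_real (cos x)) = (\<lambda>x. 1 / 2 * expi 1 x + 1 / 2 * expi (- 1) x)"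
    by (auto simp: fun_eq_iff complex_eq_iff cis_eq_expi[symmetric] simp flip: cnj_expi)
  then show ?thesis by (simp only: trig_poly.add[OF trig_poly.expi trig_poly.expi])
qed

lemma trig_poly_sin: "trig_poly (\<lambda>x. of_real (sin x))"
proof -
  have "(\<lambda>x. complex_of_real (sin x)) = (\<lambda>x. - \<i> / 2 * expi 1 x + \<i> / 2 * expi (- 1) x)"
    by (auto simp: fun_eq_iff complex_eq_iff cis_eq_expi[symmetric] simp flip: cnj_expi)
  then show ?thesis by (simp only: trig_poly.add[OF trig_poly.expi trig_poly.expi])
qed

text \<open>On the unit circle a linear form is a combination of \<open>cos\<close> and
  \<open>sin\<close>, and sums and products stay trigonometric polynomials. This is the link to the
  Stone--Weierstrass theorem in the plane.\<close>

lemma trig_poly_real_polynomial_function: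
  assumes "real_polynomial_function (p :: complex \<Rightarrow> real)"
  shows "trig_poly (\<lambda>x. of_real (p (cis x)))"
  using assms
proof (induction rule: real_polynomial_function.induct)
  case (linear f)
  interpret bounded_linear f by fact
  have "f (cis x) = cos x * f 1 + sin x * f \<i>" for x
  proof -
    have "cis x = cos x *\<^sub>R 1 + sin x *\<^sub>R \<i>" by (simp add: complex_eq_iff)
    then show ?thesis by (simp only: add scaleR) simp
  qed
  then have "(\<lambda>x. complex_of_real (f (cis x)))
      = (\<lambda>x. of_real (cos x) * of_real (f 1) + of_real (sin x) * of_real (f \<i>))"
    by simp
  then show ?case
    by (simp only: trig_poly.add[OF trig_poly_mult[OF trig_poly_cos trig_poly_const]
          trig_poly_mult[OF trig_poly_sin trig_poly_const]])
next
  case (const c)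
  then show ?case by (rule trig_poly_const)
next
  case (add f g)
  then show ?case using trig_poly.add by simp
next
  case (mult f g)
  then show ?case using trig_poly_mult by simp
qed

text \<open>Monotonicity on \<open>{0..pi}\<close> and the symmetry of \<open>cos\<close> about
  \<open>pi\<close>. It shows that a function supported in \<open>{d..2 * pi - d}\<close> vanishes
  at every angle whose cosine exceeds \<open>cos d\<close>.\<close>

lemma cos_le_cos_outside:
  assumes "0 \<le> d" "d \<le> pi" "d \<le> x" "x \<le> 2 * pi - d"
  shows "cos x \<le> cos d"
proof (cases "x \<le> pi")
  case False
  then have "cos (2 * pi - x) \<le> cos d" using assms by (intro cos_monotone_0_pi_le) auto
  then show ?thesis by (simp add: cos_diff)
qed (use assms in \<open>auto intro: cos_monotone_0_pi_le\<close>)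

text \<open>A function vanishing near both ends of the fundamental domain descends to a continuous
  function \<open>F\<close> on the unit circle, where Stone--Weierstrass applies. The support
  condition excludes a jump of \<open>F\<close> at \<open>1\<close>, where \<open>Arg2pi\<close> is
  discontinuous.\<close>

lemma trig_poly_approx_continuous:
  assumes f: "continuous_on UNIV (f :: real \<Rightarrow> complex)"
    and d: "0 < d" "d < pi" and supp: "\<And>x. f x \<noteq> 0 \<Longrightarrow> d \<le> x \<and> x \<le> 2 * pi - d"
    and e: "e > 0"
  obtains p where "trig_poly p" "\<And>x. x \<in> {0..<2 * pi} \<Longrightarrow> cmod (f x - p x) < e"
proof -
  define F where "F = (\<lambda>z. f (Arg2pi z))"
  \<comment> \<open>On \<open>U\<close> the function \<open>Arg2pi\<close> is continuous; on the
    part of the circle in \<open>V\<close>, a neighbourhood of \<open>1\<close>, \<open>F\<close> is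
    zero. The two open sets cover the circle.\<close>
  define U V where "U = - (\<real>\<^sub>\<ge>\<^sub>0 :: complex set)" and "V = {z. Re z > cos d}"
  have "open U" unfolding U_def by (simp add: open_Compl)
  have "open V" unfolding V_def by (rule open_halfspace_Re_gt)
  have "continuous_on U F" unfolding F_def
  proof (rule continuous_on_compose2[OF f])
    show "continuous_on U Arg2pi"
      unfolding U_def
      by (meson ComplD continuous_at_Arg2pi continuous_at_imp_continuous_on)
  qed auto
  then have cU: "continuous_on (sphere 0 1 \<inter> U) F" by (rule continuous_on_subset) auto
  have "F z = 0" if "z \<in> sphere 0 1 \<inter> V" for z
  proof (rule ccontr)
    assume "F z \<noteq> 0"
    then have "cos (Arg2pi z) \<le> cos d"
      using supp[of "Arg2pi z"] d by (intro cos_le_cos_outside) (auto simp: F_def)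
    moreover have "cos (Arg2pi z) = Re z" using cos_Arg2pi[of z] that by simp
    ultimately show False using that by (auto simp: V_def)
  qed
  then have cV: "continuous_on (sphere 0 1 \<inter> V) F"
    by (subst continuous_on_cong[OF refl, of _ _ "\<lambda>_. 0"]) auto
  have sub: "sphere 0 1 = (sphere 0 1 \<inter> U) \<union> (sphere 0 1 \<inter> V)"
  proof -
    have "z \<in> V" if "cmod z = 1" "z \<in> \<real>\<^sub>\<ge>\<^sub>0" for z
    proof -
      have "z = 1" using that by (auto simp: nonneg_Reals_def)
      moreover have "cos d < cos 0" using d by (intro cos_monotone_0_pi) auto
      ultimately show ?thesis by (auto simp: V_def)
    qed
    then show ?thesis by (auto simp: U_def)
  qed
  have "continuous_on ((sphere 0 1 \<inter> U) \<union> (sphere 0 1 \<inter> V)) F"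
    by (rule continuous_on_Un_local_open[OF _ _ cU cV])
       (use \<open>open U\<close> \<open>open V\<close> sub in \<open>auto simp: openin_open\<close>)
  then have "continuous_on (sphere 0 1) F" by (simp flip: sub)
  then obtain g where g: "polynomial_function g" "\<And>z. z \<in> sphere 0 1 \<Longrightarrow> norm (F z - g z) < e"
    using Stone_Weierstrass_polynomial_function[of "sphere 0 1" F, OF compact_sphere _ e] by metis
  have "real_polynomial_function (\<lambda>z. Re (g z))" "real_polynomial_function (\<lambda>z. Im (g z))"
    using g(1)[unfolded polynomial_function_def, rule_format, OF bounded_linear_Re]
      g(1)[unfolded polynomial_function_def, rule_format, OF bounded_linear_Im] by (simp_all add: o_def)
  then have "trig_poly (\<lambda>x. of_real (Re (g (cis x))) + \<i> * of_real (Im (g (cis x))))"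
    by (intro trig_poly.add trig_poly_cmult trig_poly_real_polynomial_function)
  moreover have "(\<lambda>x. of_real (Re (g (cis x))) + \<i> * of_real (Im (g (cis x)))) = (\<lambda>x. g (cis x))"
    by (simp add: fun_eq_iff complex_eq_iff)
  ultimately have "trig_poly (\<lambda>x. g (cis x))" by simp
  moreover have "cmod (f x - g (cis x)) < e" if "x \<in> {0..<2 * pi}" for x
  proof -
    have "Arg2pi (cis x) = x" using Arg2pi_exp[of "\<i> * of_real x"] that by (simp add: cis_conv_exp)
    then show ?thesis using g(2)[of "cis x"] by (simp add: F_def)
  qed
  ultimately show ?thesis by (rule that)
qed

section \<open>Density of trigonometric polynomials and Parseval's identity\<close>

definition trig_approx :: "(real \<Rightarrow> complex) \<Rightarrow> bool" where
  "trig_approx f \<longleftrightarrow> (\<forall>e>0. \<exists>p. trig_poly p \<and> L2_norm (\<lambda>x. f x - p x) < e)"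

text \<open>Dominated convergence makes \<open>h n\<close> tend to \<open>f\<close> in L2, and the
  triangle inequality passes the approximation on. It is used twice: from continuous to bounded
  functions, and from bounded functions to L2.\<close>

lemma trig_approx_limit:
  assumes h: "\<And>n. h n \<in> L2_torus" "\<And>n. trig_approx (h n)" and f: "f \<in> L2_torus"
    and lim: "AE x in torus. (\<lambda>n. h n x) \<longlonglongrightarrow> f x"
    and dom: "integrable torus w" "\<And>n. AE x in torus. (cmod (f x - h n x))\<^sup>2 \<le> w x"
  shows "trig_approx f"
  unfolding trig_approx_def
proof (intro allI impI)
  fix e :: real assume e: "e > 0"
  have [measurable]: "f \<in> borel_measurable borel" "h n \<in> borel_measurable borel" for n
    using f h(1) by (auto simp: L2_torus_iff)
  have "(\<lambda>n. \<integral>x. (cmod (f x - h n x))\<^sup>2 \<partial>torus) \<longlonglongrightarrow> (\<integral>x. 0 \<partial>torus)"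
  proof (rule integral_dominated_convergence[OF _ _ dom(1)])
    show "AE x in torus. (\<lambda>n. (cmod (f x - h n x))\<^sup>2) \<longlonglongrightarrow> 0"
      using lim
    proof eventually_elim
      case (elim x)
      then have "(\<lambda>n. (cmod (f x - h n x))\<^sup>2) \<longlonglongrightarrow> (cmod (f x - f x))\<^sup>2"
        by (intro tendsto_intros)
      then show ?case by simp
    qed
  qed (use dom(2) in auto)
  then have lim0: "(\<lambda>n. (L2_norm (\<lambda>x. f x - h n x))\<^sup>2) \<longlonglongrightarrow> 0"
    by (simp only: L2_norm_squared integral_zero)
  have "\<forall>\<^sub>F n in sequentially. (L2_norm (\<lambda>x. f x - h n x))\<^sup>2 < (e / 2)\<^sup>2"
    by (rule order_tendstoD(2)[OF lim0]) (use e in simp)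
  then have "\<exists>n. (L2_norm (\<lambda>x. f x - h n x))\<^sup>2 < (e / 2)\<^sup>2"
    by (rule eventually_happens'[OF sequentially_bot])
  then obtain n where "(L2_norm (\<lambda>x. f x - h n x))\<^sup>2 < (e / 2)\<^sup>2" ..
  then have 1: "L2_norm (\<lambda>x. f x - h n x) < e / 2"
    by (rule power2_less_imp_less) (use e in simp)
  obtain p where p: "trig_poly p" "L2_norm (\<lambda>x. h n x - p x) < e / 2"
    using h(2)[of n, unfolded trig_approx_def, rule_format, of "e / 2"] e by auto
  have "L2_norm (\<lambda>x. (f x - h n x) + (h n x - p x))
      \<le> L2_norm (\<lambda>x. f x - h n x) + L2_norm (\<lambda>x. h n x - p x)"
    by (intro L2_norm_triangle L2_torus_diff f h trig_poly_L2 p)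
  also have "\<dots> < e" using 1 p by simp
  finally show "\<exists>p. trig_poly p \<and> L2_norm (\<lambda>x. f x - p x) < e" using p by auto
qed

lemma trig_approx_continuous:
  assumes f: "continuous_on UNIV f"
    and d: "0 < d" "d < pi" and supp: "\<And>x. f x \<noteq> 0 \<Longrightarrow> d \<le> x \<and> x \<le> 2 * pi - d"
  shows "trig_approx f"
  unfolding trig_approx_def
proof (intro allI impI)
  fix e :: real assume e: "e > 0"
  then have e2: "e / 2 > 0" by simp
  obtain p where p: "trig_poly p" "\<And>x. x \<in> {0..<2 * pi} \<Longrightarrow> cmod (f x - p x) < e / 2"
    using trig_poly_approx_continuous[OF f d supp e2] by blast
  have [measurable]: "f \<in> borel_measurable borel" "p \<in> borel_measurable borel"
    using f trig_poly_L2[OF p(1)] by (auto simp: L2_torus_iff borel_measurable_continuous_onI)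
  have "L2_norm (\<lambda>x. f x - p x) \<le> e / 2 * L2_norm (\<lambda>_. 1)"
  proof (rule L2_norm_le_dominated)
    show "AE x in torus. cmod (f x - p x) \<le> e / 2 * cmod 1"
      using p(2) by (intro AE_torusI AE_I2 impI) (simp add: less_imp_le)
  qed (use e in \<open>auto simp: L2_torus_const\<close>)
  also have "L2_norm (\<lambda>_. 1) = 1" by (simp add: L2_norm_def torus.prob_space[simplified])
  finally have "L2_norm (\<lambda>x. f x - p x) < e" using e by simp
  then show "\<exists>p. trig_poly p \<and> L2_norm (\<lambda>x. f x - p x) < e" using p(1) by blast
qed

lemma AE_lborel_limit_continuous:
  fixes f :: "real \<Rightarrow> complex"
  assumes "f \<in> borel_measurable borel"
  obtains g where "\<And>n::nat. continuous_on UNIV (g n)" "AE x in lborel. (\<lambda>n. g n x) \<longlonglongrightarrow> f x"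
proof -
  have "f \<in> borel_measurable lebesgue" using assms by (simp add: measurable_completion)
  then have "f measurable_on UNIV" by (rule lebesgue_measurable_imp_measurable_on) simp
  then obtain N g where N: "negligible N" and g: "\<And>n. continuous_on UNIV (g n)"
    and lim: "\<And>x. x \<notin> N \<Longrightarrow> (\<lambda>n. g n x) \<longlonglongrightarrow> f x"
    by (auto simp: measurable_on_def)
  obtain N' where "N' \<in> null_sets lborel" "N \<subseteq> N'"
    using N by (auto simp: negligible_iff_null_sets null_sets_completion_iff2)
  then have "AE x in lborel. (\<lambda>n. g n x) \<longlonglongrightarrow> f x"
    using lim by (intro AE_I'[of N']) auto
  with g show ?thesis by (rule that)
qed

text \<open>The continuous functions \<open>g n\<close> converging to \<open>f\<close> need neither
  be uniformly bounded nor vanish near the ends of the fundamental domain. A radial truncation and a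
  cutoff repair both defects and leave the limit unchanged inside.\<close>

lemma trig_approx_bounded:
  assumes f: "f \<in> borel_measurable borel" and B: "\<And>x. cmod (f x) \<le> B"
  shows "trig_approx f"
proof -
  \<comment> \<open>Adding 1 keeps the radius positive when \<open>B = 0\<close>, so that the
    quotient in \<open>h\<close> is well behaved.\<close>
  define B' where "B' = B + 1"
  have B': "B' > 0" "\<And>x. cmod (f x) \<le> B'"
    using B norm_ge_zero[of "f 0"] order_trans[OF norm_ge_zero B[of 0]]
    by (auto simp: B'_def intro: order_trans[OF B])
  obtain g where g: "\<And>n. continuous_on UNIV (g n)" "AE x in lborel. (\<lambda>n. g n x) \<longlonglongrightarrow> f x"
    using AE_lborel_limit_continuous[OF f] by blast
  \<comment> \<open>A product of two ramps: it vanishes up to distance \<open>1 / Suc n\<close> from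
    each end and tends to 1 at every interior point. In \<open>h\<close> the quotient retracts the
    values of \<open>g n\<close> onto the disc of radius \<open>B'\<close>.\<close>
  define bump :: "nat \<Rightarrow> real \<Rightarrow> real" where
    "bump n x = max 0 (min 1 (real (Suc n) * x - 1)) * max 0 (min 1 (real (Suc n) * (2 * pi - x) - 1))" for n x
  define h where "h n x = of_real (bump n x * (B' / max B' (cmod (g n x)))) * g n x" for n x
  have bump: "0 \<le> bump n x" "bump n x \<le> 1" for n x
    unfolding bump_def by (auto intro!: mult_le_one)
  have hB: "cmod (h n x) \<le> B'" for n x
  proof -
    have "bump n x * (B' * cmod (g n x) / max B' (cmod (g n x))) \<le> 1 * B'"
    proof (rule mult_mono)
      have "cmod (g n x) \<le> max B' (cmod (g n x))" by simp
      then show "B' * cmod (g n x) / max B' (cmod (g n x)) \<le> B'"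
        using B' by (subst pos_divide_le_eq) auto
    qed (use bump B' in auto)
    moreover have "cmod (h n x) = bump n x * (B' * cmod (g n x) / max B' (cmod (g n x)))"
      unfolding h_def norm_mult norm_of_real using B'(1) bump by (simp add: abs_mult max_def)
    ultimately show ?thesis by simp
  qed
  have contg: "continuous_on UNIV (\<lambda>x. cmod (g n x))" for n using g(1) by (intro continuous_intros)
  have conth: "continuous_on UNIV (h n)" for n
    unfolding h_def bump_def using B'
    by (intro continuous_intros g(1) contg) (auto simp: max_def)
  have hm[measurable]: "h n \<in> borel_measurable borel" for n
    using conth by (rule borel_measurable_continuous_onI)
  have [measurable]: "f \<in> borel_measurable borel" by fact
  have fL2: "f \<in> L2_torus" by (rule L2_torus_bounded[OF f]) (use B in auto)
  have hL2: "h n \<in> L2_torus" for n by (rule L2_torus_bounded[OF hm, of _ B']) (use hB in auto)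
  have lim1: "(\<lambda>n. max 0 (min 1 (real (Suc n) * y - 1))) \<longlonglongrightarrow> 1" if "y > 0" for y
  proof (rule tendsto_eventually)
    have "filterlim (\<lambda>n. real (Suc n) * y - 1) at_top sequentially"
      using that by real_asymp
    then have "\<forall>\<^sub>F n in sequentially. 1 \<le> real (Suc n) * y - 1"
      by (simp only: filterlim_at_top)
    then show "\<forall>\<^sub>F n in sequentially. max 0 (min 1 (real (Suc n) * y - 1)) = 1"
      by eventually_elim simp
  qed
  show ?thesis
  proof (rule trig_approx_limit[OF hL2 _ fL2, where w = "\<lambda>_. (2 * B')\<^sup>2"])
    fix n
    have n: "1 / (2 + real n) < pi" by (rule order.strict_trans1[of _ 1]) (use pi_gt3 in auto)
    show "trig_approx (h n)"
    proof (rule trig_approx_continuous[OF conth, of "1 / (2 + real n)"])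
      have pos: "y > 0" if "max 0 (min 1 y) \<noteq> 0" for y :: real using that by linarith
      fix x assume "h n x \<noteq> 0"
      then have "real (Suc n) * x - 1 > 0" "real (Suc n) * (2 * pi - x) - 1 > 0"
        using pos[of "real (Suc n) * x - 1"] pos[of "real (Suc n) * (2 * pi - x) - 1"]
        unfolding h_def bump_def by (simp_all only: mult_eq_0_iff of_real_eq_0_iff de_Morgan_disj simp_thms)
      then have "x > 1 / Suc n" "2 * pi - x > 1 / Suc n"
        by (simp_all only: pos_divide_less_eq of_nat_0_less_iff zero_less_Suc mult.commute diff_gt_0_iff_gt)
      moreover have "1 / (2 + real n) \<le> 1 / Suc n" by (intro divide_left_mono) auto
      ultimately show "1 / (2 + real n) \<le> x \<and> x \<le> 2 * pi - 1 / (2 + real n)" by linarith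
    next
      show "0 < 1 / (2 + real n)" by simp
    qed (rule n)
  next
    have key: "(\<lambda>n. h n x) \<longlonglongrightarrow> f x" if lim: "(\<lambda>n. g n x) \<longlonglongrightarrow> f x" and x: "0 < x" "x < 2 * pi" for x
    proof -
      have "(\<lambda>n. max B' (cmod (g n x))) \<longlonglongrightarrow> max B' (cmod (f x))"
        by (intro tendsto_max tendsto_const tendsto_norm lim)
      moreover have "max B' (cmod (f x)) = B'" using B'(2) by (rule max_absorb1)
      ultimately have "(\<lambda>n. B' / max B' (cmod (g n x))) \<longlonglongrightarrow> B' / B'"
        using B'(1) by (intro tendsto_divide) auto
      moreover have "(\<lambda>n. bump n x) \<longlonglongrightarrow> 1 * 1"
        unfolding bump_def using x by (intro tendsto_mult lim1) auto
      ultimately have "(\<lambda>n. h n x) \<longlonglongrightarrow> of_real (1 * 1 * (B' / B')) * f x"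
        unfolding h_def by (intro tendsto_mult tendsto_of_real lim)
      then show ?thesis using B'(1) by simp
    qed
    show "AE x in torus. (\<lambda>n. h n x) \<longlonglongrightarrow> f x"
    proof (rule AE_torusI)
      from g(2) AE_lborel_singleton[of "0::real"]
      show "AE x in lborel. x \<in> {0..<2 * pi} \<longrightarrow> (\<lambda>n. h n x) \<longlonglongrightarrow> f x"
        by eventually_elim (auto intro: key)
    qed
  next
    fix n
    show "AE x in torus. (cmod (f x - h n x))\<^sup>2 \<le> (2 * B')\<^sup>2"
    proof (intro AE_I2 power_mono)
      fix x show "cmod (f x - h n x) \<le> 2 * B'"
        using norm_triangle_ineq4[of "f x" "h n x"] B'(2)[of x] hB[of n x] by linarith
    qed simp
  qed simp
qed

lemma trig_approx_L2:
  assumes f: "f \<in> L2_torus"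
  shows "trig_approx f"
proof -
  have [measurable]: "f \<in> borel_measurable borel" using f by (simp add: L2_torus_iff)
  define h where "h n x = (if cmod (f x) \<le> real n then f x else 0)" for n x
  have hm: "h n \<in> borel_measurable borel" for n unfolding h_def by measurable
  have hB: "cmod (h n x) \<le> real n" for n x by (simp add: h_def)
  show ?thesis
  proof (rule trig_approx_limit[where h = h and w = "\<lambda>x. (cmod (f x))\<^sup>2"])
    show "trig_approx (h n)" for n by (rule trig_approx_bounded[OF hm hB])
    show "h n \<in> L2_torus" for n by (rule L2_torus_bounded[OF hm]) (use hB in auto)
    show "AE x in torus. (\<lambda>n. h n x) \<longlonglongrightarrow> f x"
    proof (intro AE_I2 tendsto_eventually)
      fix x
      show "\<forall>\<^sub>F n in sequentially. h n x = f x"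
        using eventually_ge_at_top[of "nat \<lceil>cmod (f x)\<rceil>"]
      proof eventually_elim
        case (elim n)
        then have "cmod (f x) \<le> real n" by linarith
        then show ?case by (simp add: h_def)
      qed
    qed
  qed (use f in \<open>auto simp: h_def L2_torus_iff\<close>)
qed

text \<open>Among trigonometric polynomials with frequencies in a given range the Fourier sum is
  closest to \<open>f\<close>, so density forces the Fourier sums to converge to \<open>f\<close> in
  L2. Cauchy--Schwarz transfers this to the pairing with \<open>g\<close>.\<close>

theorem Parseval:
  assumes f: "f \<in> L2_torus" and g: "g \<in> L2_torus"
  shows "(\<lambda>K. \<Sum>n\<in>{- int K..int K}. fourier_coeff f n * cnj (fourier_coeff g n)) \<longlonglongrightarrow> L2_inner f g"
proof (rule LIMSEQ_I)
  fix e :: real assume e: "e > 0"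
  \<comment> \<open>The summand 1 covers the case that \<open>g\<close> has norm zero.\<close>
  define e' where "e' = e / (L2_norm g + 1)"
  have e': "e' > 0" using e L2_norm_nonneg[of g] by (simp add: e'_def add_nonneg_pos)
  obtain p where p: "trig_poly p" "L2_norm (\<lambda>x. f x - p x) < e'"
    using trig_approx_L2[OF f] e' unfolding trig_approx_def by blast
  obtain c K0 where c: "\<And>K x. K \<ge> K0 \<Longrightarrow> p x = (\<Sum>n\<in>{- int K..int K}. c n * expi n x)"
    using trig_poly_coeffs[OF p(1)] by blast
  show "\<exists>K0. \<forall>K\<ge>K0. norm ((\<Sum>n\<in>{- int K..int K}. fourier_coeff f n * cnj (fourier_coeff g n)) - L2_inner f g) < e"
  proof (intro exI allI impI)
    fix K assume K: "K \<ge> K0"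
    define A where "A = {- int K..int K}"
    have A: "finite A" by (simp add: A_def)
    define S where "S = (\<lambda>x. \<Sum>n\<in>A. fourier_coeff f n * expi n x)"
    have S: "S \<in> L2_torus" unfolding S_def by (intro L2_torus_sum L2_torus_cmult) simp
    have "p = (\<lambda>x. \<Sum>n\<in>A. c n * expi n x)" using c[OF K] by (simp add: A_def fun_eq_iff)
    \<comment> \<open>By \<open>L2_trig_error\<close> the Fourier coefficients minimise the error
      over all coefficients on \<open>A\<close>.\<close>
    moreover have "(L2_norm (\<lambda>x. f x - S x))\<^sup>2 \<le> (L2_norm (\<lambda>x. f x - (\<Sum>n\<in>A. c n * expi n x)))\<^sup>2"
      unfolding S_def L2_trig_error[OF f A] by (simp add: sum_nonneg)
    ultimately have err: "L2_norm (\<lambda>x. f x - S x) < e'" using p(2) power2_le_imp_le by fastforce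
    have "L2_inner S g = (\<Sum>n\<in>A. fourier_coeff f n * cnj (fourier_coeff g n))"
      unfolding S_def using g
      by (subst L2_inner_sum_left) (auto intro: L2_torus_cmult simp: L2_inner_cmult_left cnj_L2_inner fourier_coeff_eq)
    then have "(\<Sum>n\<in>A. fourier_coeff f n * cnj (fourier_coeff g n)) - L2_inner f g
        = - L2_inner (\<lambda>x. f x - S x) g"
      using f g S by (simp add: L2_inner_diff_left)
    then have "cmod ((\<Sum>n\<in>A. fourier_coeff f n * cnj (fourier_coeff g n)) - L2_inner f g)
        \<le> L2_norm (\<lambda>x. f x - S x) * L2_norm g"
      using L2_Cauchy_Schwarz[OF L2_torus_diff[OF f S] g] by simp
    also have "\<dots> \<le> e' * L2_norm g" using err by (intro mult_right_mono) auto
    also have "\<dots> < e' * (L2_norm g + 1)" using e' by simp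
    also have "\<dots> = e" using L2_norm_nonneg[of g] unfolding e'_def by (intro nonzero_eq_divide_eq[THEN iffD1, OF _ refl]) linarith
    finally show "norm ((\<Sum>n\<in>{- int K..int K}. fourier_coeff f n * cnj (fourier_coeff g n)) - L2_inner f g) < e"
      by (simp add: A_def)
  qed
qed

section \<open>Integration by parts for Lebesgue integrals\<close>

lemma borel_measurable_integral_atMost [measurable]:
  fixes f :: "real \<Rightarrow> complex"
  assumes [measurable]: "f \<in> borel_measurable borel"
  shows "(\<lambda>s. LBINT r:{..s}. f r) \<in> borel_measurable borel"
    and "(\<lambda>s. LBINT r:{s..}. f r) \<in> borel_measurable borel"
proof -
  have eq: "(\<lambda>s. LBINT r:{..s}. f r) = (\<lambda>s. \<integral>r. (if r \<le> s then f r else 0) \<partial>lborel)"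
    "(\<lambda>s. LBINT r:{s..}. f r) = (\<lambda>s. \<integral>r. (if s \<le> r then f r else 0) \<partial>lborel)"
    by (auto simp: set_lebesgue_integral_def fun_eq_iff intro!: Bochner_Integration.integral_cong)
  show "(\<lambda>s. LBINT r:{..s}. f r) \<in> borel_measurable borel"
    "(\<lambda>s. LBINT r:{s..}. f r) \<in> borel_measurable borel"
    unfolding eq by measurable
qed

lemma norm_set_integral_le:
  fixes f :: "real \<Rightarrow> complex"
  assumes "integrable lborel f" "A \<in> sets borel"
  shows "norm (LBINT r:A. f r) \<le> (\<integral>r. norm (f r) \<partial>lborel)"
proof -
  have "norm (LBINT r:A. f r) \<le> (\<integral>r. norm (indicator A r *\<^sub>R f r) \<partial>lborel)"
    unfolding set_lebesgue_integral_def by (rule integral_norm_bound)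
  also have "\<dots> \<le> (\<integral>r. norm (f r) \<partial>lborel)"
  proof (rule integral_mono)
    show "integrable lborel (\<lambda>r. norm (indicator A r *\<^sub>R f r))"
      using assms by (intro integrable_norm integrable_mult_indicator) auto
  qed (use assms in \<open>auto simp: indicator_def\<close>)
  finally show ?thesis .
qed

text \<open>Fubini on the triangle \<open>r \<le> s\<close>. For merely integrable functions this is
  integration by parts of their primitives.\<close>

lemma integral_triangle_swap:
  fixes f g :: "real \<Rightarrow> complex"
  assumes f: "integrable lborel f" and g: "integrable lborel g"
  shows "(LBINT s. f s * (LBINT r:{..s}. g r)) = (LBINT r. g r * (LBINT s:{r..}. f s))"
proof -
  have [measurable]: "f \<in> borel_measurable borel" "g \<in> borel_measurable borel"
    using f g by auto
  define h where "h = (\<lambda>(s, r). if r \<le> s then f s * g r else 0)"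
  have [measurable]: "h \<in> borel_measurable (borel \<Otimes>\<^sub>M borel)" unfolding h_def by measurable
  have int: "integrable (lborel \<Otimes>\<^sub>M lborel) h"
  proof (rule Bochner_Integration.integrable_bound)
    show "integrable (lborel \<Otimes>\<^sub>M lborel) (\<lambda>(s, r). f s * g r)"
    proof (rule lborel_pair.Fubini_integrable)
      show "integrable lborel (\<lambda>s. LBINT r. norm (case (s, r) of (s, r) \<Rightarrow> f s * g r))"
        using f by (simp add: norm_mult)
    qed (use g in auto)
  qed (auto simp: h_def)
  have "(LBINT s. f s * (LBINT r:{..s}. g r)) = (LBINT s. LBINT r. h (s, r))"
    unfolding set_lebesgue_integral_def
    by (intro Bochner_Integration.integral_cong refl, subst integral_mult_right_zero[symmetric])
       (auto intro!: Bochner_Integration.integral_cong simp: h_def)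
  also have "\<dots> = (LBINT r. LBINT s. h (s, r))"
    using lborel_pair.Fubini_integral[of "\<lambda>s r. h (s, r)"] int by simp
  also have "\<dots> = (LBINT r. g r * (LBINT s:{r..}. f s))"
    unfolding set_lebesgue_integral_def
    by (intro Bochner_Integration.integral_cong refl, subst integral_mult_right_zero[symmetric])
       (auto intro!: Bochner_Integration.integral_cong simp: h_def)
  finally show ?thesis .
qed

lemma integral_split_at:
  fixes g :: "real \<Rightarrow> complex"
  assumes "integrable lborel g"
  shows "(LBINT r. g r) = (LBINT r:{..s}. g r) + (LBINT r:{s..}. g r)"
proof -
  have "(LBINT r. g r) = (LBINT r. indicator {..s} r *\<^sub>R g r + indicator {s..} r *\<^sub>R g r)"
    using AE_lborel_singleton[of s]
    by (intro integral_cong_AE) (use assms in \<open>auto simp: indicator_def elim!: eventually_mono\<close>)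
  also have "\<dots> = (LBINT r:{..s}. g r) + (LBINT r:{s..}. g r)"
    unfolding set_lebesgue_integral_def
    by (rule Bochner_Integration.integral_add) (use assms in \<open>auto intro!: integrable_mult_indicator\<close>)
  finally show ?thesis .
qed

lemma integrable_mult_set_integral:
  fixes f g :: "real \<Rightarrow> complex"
  assumes f: "integrable lborel f" and g: "integrable lborel g"
  shows "integrable lborel (\<lambda>s. f s * (LBINT r:{..s}. g r))"
    and "integrable lborel (\<lambda>s. f s * (LBINT r:{s..}. g r))"
proof -
  have [measurable]: "f \<in> borel_measurable borel" "g \<in> borel_measurable borel"
    using f g by auto
  define C where "C = (LBINT r. norm (g r))"
  have C: "integrable lborel (\<lambda>s. norm (f s) * C)" using f by auto
  have "norm (f s * (LBINT r:{..s}. g r)) \<le> norm (norm (f s) * C)"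
    "norm (f s * (LBINT r:{s..}. g r)) \<le> norm (norm (f s) * C)" for s
    unfolding norm_mult C_def
    by (auto intro!: mult_left_mono norm_set_integral_le g order_trans[OF _ abs_ge_self])
  then show "integrable lborel (\<lambda>s. f s * (LBINT r:{..s}. g r))"
    "integrable lborel (\<lambda>s. f s * (LBINT r:{s..}. g r))"
    by (auto intro!: Bochner_Integration.integrable_bound[OF C])
qed

text \<open>The square splits along its diagonal into two triangles. The two forms are the product
  rule for primitives that vanish at the left end and at the right end.\<close>

lemma integral_mult_integral:
  fixes f g :: "real \<Rightarrow> complex"
  assumes f: "integrable lborel f" and g: "integrable lborel g"
  shows "(LBINT s. f s) * (LBINT s. g s)
       = (LBINT s. f s * (LBINT r:{..s}. g r)) + (LBINT s. g s * (LBINT r:{..s}. f r))"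
    and "(LBINT s. f s) * (LBINT s. g s)
       = (LBINT s. f s * (LBINT r:{s..}. g r)) + (LBINT s. g s * (LBINT r:{s..}. f r))"
proof -
  have "(LBINT s. f s) * (LBINT s. g s) = (LBINT s. f s * (LBINT r:{..s}. g r) + f s * (LBINT r:{s..}. g r))"
    unfolding distrib_left[symmetric] integral_split_at[OF g, symmetric] using f by simp
  also have "\<dots> = (LBINT s. f s * (LBINT r:{..s}. g r)) + (LBINT s. f s * (LBINT r:{s..}. g r))"
    by (intro Bochner_Integration.integral_add integrable_mult_set_integral f g)
  finally have *: "(LBINT s. f s) * (LBINT s. g s)
      = (LBINT s. f s * (LBINT r:{..s}. g r)) + (LBINT s. f s * (LBINT r:{s..}. g r))" .
  show "(LBINT s. f s) * (LBINT s. g s)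
       = (LBINT s. f s * (LBINT r:{..s}. g r)) + (LBINT s. g s * (LBINT r:{..s}. f r))"
    unfolding * by (simp add: integral_triangle_swap[OF g f])
  show "(LBINT s. f s) * (LBINT s. g s)
       = (LBINT s. f s * (LBINT r:{s..}. g r)) + (LBINT s. g s * (LBINT r:{s..}. f r))"
    unfolding * by (simp add: integral_triangle_swap[OF f g])
qed

text \<open>The first product rule serves \<open>b\<close>, which vanishes at time 0; the second
  serves \<open>G\<close>, which vanishes at the horizon; the third identity moves a primitive from
  one factor to the other when the two meet.\<close>

lemma set_integral_mult_set_integral:
  fixes f g :: "real \<Rightarrow> complex"
  assumes f: "set_integrable lborel {a..b} f" and g: "set_integrable lborel {a..b} g"
  shows "(LBINT s:{a..b}. f s) * (LBINT s:{a..b}. g s)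
       = (LBINT s:{a..b}. f s * (LBINT r:{a..s}. g r) + g s * (LBINT r:{a..s}. f r))" (is ?th1)
    and "(LBINT s:{a..b}. f s) * (LBINT s:{a..b}. g s)
       = (LBINT s:{a..b}. f s * (LBINT r:{s..b}. g r) + g s * (LBINT r:{s..b}. f r))" (is ?th2)
    and "(LBINT s:{a..b}. f s * (LBINT r:{a..s}. g r)) = (LBINT r:{a..b}. g r * (LBINT s:{r..b}. f s))" (is ?th3)
    and "set_integrable lborel {a..b} (\<lambda>s. f s * (LBINT r:{a..s}. g r))" (is ?th4)
    and "set_integrable lborel {a..b} (\<lambda>s. f s * (LBINT r:{s..b}. g r))" (is ?th5)
proof -
  define F G where "F s = indicator {a..b} s *\<^sub>R f s" and "G s = indicator {a..b} s *\<^sub>R g s" for s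
  have F: "integrable lborel F" and G: "integrable lborel G"
    using f g by (auto simp: F_def[abs_def] G_def[abs_def] set_integrable_def)
  have lower: "indicator {a..b} s *\<^sub>R (h s * (LBINT r:{a..s}. k r))
      = (indicator {a..b} s *\<^sub>R h s) * (LBINT r:{..s}. indicator {a..b} r *\<^sub>R k r)" for h k :: "real \<Rightarrow> complex" and s
  proof (cases "s \<in> {a..b}")
    case True
    then have "(LBINT r:{a..s}. k r) = (LBINT r:{..s}. indicator {a..b} r *\<^sub>R k r)"
      unfolding set_lebesgue_integral_def by (intro Bochner_Integration.integral_cong) (auto simp: indicator_def)
    then show ?thesis by simp
  qed simp
  have upper: "indicator {a..b} s *\<^sub>R (h s * (LBINT r:{s..b}. k r))
      = (indicator {a..b} s *\<^sub>R h s) * (LBINT r:{s..}. indicator {a..b} r *\<^sub>R k r)" for h k :: "real \<Rightarrow> complex" and s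
  proof (cases "s \<in> {a..b}")
    case True
    then have "(LBINT r:{s..b}. k r) = (LBINT r:{s..}. indicator {a..b} r *\<^sub>R k r)"
      unfolding set_lebesgue_integral_def by (intro Bochner_Integration.integral_cong) (auto simp: indicator_def)
    then show ?thesis by simp
  qed simp
  note defs = set_lebesgue_integral_def[of lborel "{a..b}"] set_integrable_def scaleR_add_right lower upper
    F_def[symmetric] G_def[symmetric]
  note I = integrable_mult_set_integral[OF F G] integrable_mult_set_integral[OF G F]
  show ?th1 unfolding defs integral_mult_integral(1)[OF F G] using I by simp
  show ?th2 unfolding defs integral_mult_integral(2)[OF F G] using I by simp
  show ?th3 unfolding defs by (rule integral_triangle_swap[OF F G])
  show ?th4 unfolding defs by (rule I)
  show ?th5 unfolding defs by (rule I)
qed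

section \<open>Square integrability of oscillatory integrals\<close>

text \<open>The integrand is \<open>sqrt (2 * pi) / \<sigma>\<close> times the normal density with
  mean \<open>c\<close> and standard deviation \<open>1 / \<sigma>\<close>.\<close>

lemma nn_integral_exp_neg_square:
  fixes c \<sigma> :: real
  assumes "\<sigma> > 0"
  shows "(\<integral>\<^sup>+y. ennreal (exp (- (\<sigma> * (c - y))\<^sup>2 / 2)) \<partial>lborel) = ennreal (sqrt (2 * pi) / \<sigma>)"
proof -
  define K where "K = sqrt (2 * pi) / \<sigma>"
  have K: "K > 0" using assms by (simp add: K_def)
  have "exp (- (\<sigma> * (c - y))\<^sup>2 / 2) = K * normal_density c (1 / \<sigma>) y" for y
    using assms unfolding normal_density_def K_def
    by (simp add: real_sqrt_mult real_sqrt_divide power_divide power2_commute[of c] power_mult_distrib[of \<sigma>])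
  then have "(\<integral>\<^sup>+y. ennreal (exp (- (\<sigma> * (c - y))\<^sup>2 / 2)) \<partial>lborel)
      = ennreal K * (\<integral>\<^sup>+y. ennreal (normal_density c (1 / \<sigma>) y) \<partial>lborel)"
    using K by (simp add: ennreal_mult nn_integral_cmult)
  also have "(\<integral>\<^sup>+y. ennreal (normal_density c (1 / \<sigma>) y) \<partial>lborel) = 1"
    using prob_space.emeasure_space_1[OF prob_space_normal_density[of "1 / \<sigma>" c]] assms
    by (simp add: emeasure_density)
  finally show ?thesis by (simp add: K_def)
qed

lemma char_std_normal:
  "(\<integral>x. cis (a * x) \<partial>std_normal_distribution) = of_real (exp (- a\<^sup>2 / 2))"
  using char_std_normal_distribution by (simp add: char_def fun_eq_iff cis_conv_exp)

lemma borel_measurable_cis [measurable]: "cis \<in> borel_measurable borel"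
  by (intro borel_measurable_continuous_onI continuous_intros)

text \<open>For increasing \<open>\<phi>\<close> the substitution \<open>y = \<phi> s\<close> makes
  this the Fourier transform, in \<open>y\<close>, of \<open>F\<close> divided by the derivative of
  \<open>\<phi>\<close>.\<close>

definition osc_integral :: "(real \<Rightarrow> real) \<Rightarrow> (real \<Rightarrow> complex) \<Rightarrow> real \<Rightarrow> complex" where
  "osc_integral \<phi> F k = (LBINT s. F s * cis (k * \<phi> s))"

lemma osc_integral_measurable [measurable]:
  assumes [measurable]: "\<phi> \<in> borel_measurable borel" "F \<in> borel_measurable borel"
  shows "osc_integral \<phi> F \<in> borel_measurable borel"
  unfolding osc_integral_def[abs_def] by measurable

lemma cmod_osc_integral_le:
  assumes "integrable lborel F"
  shows "cmod (osc_integral \<phi> F k) \<le> (LBINT s. cmod (F s))"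
  unfolding osc_integral_def by (rule order_trans[OF integral_norm_bound]) (simp add: norm_mult)

text \<open>
  Averaging over a Gaussian in \<open>k\<close> makes the double integral for \<open>|\<integral> F cis(k \<phi>)|\<^sup>2\<close> absolutely convergent
  and its kernel positive.
\<close>

lemma integral_osc_integral_gaussian:
  assumes [measurable]: "\<phi> \<in> borel_measurable borel" and F: "integrable lborel F"
  shows "(\<integral>x. (cmod (osc_integral \<phi> F (\<sigma> * x)))\<^sup>2 \<partial>std_normal_distribution)
       \<le> (LBINT s. LBINT r. cmod (F s) * cmod (F r) * exp (- (\<sigma> * (\<phi> s - \<phi> r))\<^sup>2 / 2))"
proof -
  interpret N: prob_space std_normal_distribution
    by (intro prob_space_normal_density) simp
  interpret NL: pair_sigma_finite std_normal_distribution lborel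
    by (simp add: pair_sigma_finite_def lborel.sigma_finite_measure_axioms N.sigma_finite_measure_axioms)
  have [measurable]: "F \<in> borel_measurable borel" using F by simp
  define C where "C = (LBINT s. cmod (F s))"
  have C: "C \<ge> 0" by (simp add: C_def)
  let ?N = std_normal_distribution
  let ?\<Phi> = "\<lambda>x. osc_integral \<phi> F (\<sigma> * x)"
  have \<Phi>_le: "cmod (?\<Phi> x) \<le> C" for x unfolding C_def by (rule cmod_osc_integral_le[OF F])
  \<comment> \<open>The Gaussian is a probability measure, so a bounded \<open>h\<close> can be
    averaged under the integral of an integrable \<open>G\<close>. It is applied to each of the two
    factors of the squared modulus; what is left is the characteristic function of the normal
    law.\<close>
  have swap: "(\<integral>x. (LBINT s. G s * h x s) \<partial>?N) = (LBINT s. G s * (\<integral>x. h x s \<partial>?N))"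
    if G: "integrable lborel G" and [measurable]: "(\<lambda>(x, s). h x s) \<in> borel_measurable (borel \<Otimes>\<^sub>M borel)"
      and B: "\<And>x s. cmod (h x s) \<le> B" for G :: "real \<Rightarrow> complex" and h B
  proof -
    have [measurable]: "G \<in> borel_measurable borel" using G by simp
    have h': "(\<lambda>s. h x s) \<in> borel_measurable borel" for x by measurable
    have int: "integrable (?N \<Otimes>\<^sub>M lborel) (\<lambda>(x, s). G s * h x s)"
    proof (rule Bochner_Integration.integrable_bound)
      show "integrable (?N \<Otimes>\<^sub>M lborel) (\<lambda>(x, s). G s * of_real B)"
        by (rule NL.Fubini_integrable) (use G in auto)
      show "AE z in ?N \<Otimes>\<^sub>M lborel. norm (case z of (x, s) \<Rightarrow> G s * h x s) \<le> norm (case z of (x, s) \<Rightarrow> G s * of_real B)"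
        by (intro AE_I2) (auto simp: norm_mult intro!: mult_left_mono order_trans[OF B abs_ge_self])
    qed measurable
    have "(\<integral>x. (LBINT s. G s * h x s) \<partial>?N) = (LBINT s. (\<integral>x. G s * h x s \<partial>?N))"
      using NL.Fubini_integral[of "\<lambda>x s. G s * h x s"] int by simp
    then show ?thesis by simp
  qed
  have "complex_of_real (\<integral>x. (cmod (?\<Phi> x))\<^sup>2 \<partial>?N) = (\<integral>x. complex_of_real ((cmod (?\<Phi> x))\<^sup>2) \<partial>?N)"
    by (rule integral_complex_of_real[symmetric])
  also have "\<dots> = (\<integral>x. (LBINT s. F s * (cis (\<sigma> * x * \<phi> s) * cnj (?\<Phi> x))) \<partial>?N)"
  proof (intro Bochner_Integration.integral_cong refl)
    fix x
    have "complex_of_real ((cmod (?\<Phi> x))\<^sup>2) = (LBINT s. F s * cis (\<sigma> * x * \<phi> s)) * cnj (?\<Phi> x)"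
      unfolding complex_norm_square osc_integral_def ..
    then show "complex_of_real ((cmod (?\<Phi> x))\<^sup>2) = (LBINT s. F s * (cis (\<sigma> * x * \<phi> s) * cnj (?\<Phi> x)))"
      by (simp add: mult.assoc[symmetric])
  qed
  also have "\<dots> = (LBINT s. F s * (\<integral>x. cis (\<sigma> * x * \<phi> s) * cnj (?\<Phi> x) \<partial>?N))"
    by (rule swap[OF F, of _ C]) (auto simp: norm_mult \<Phi>_le)
  also have "\<dots> = (LBINT s. F s * (LBINT r. cnj (F r) * of_real (exp (- (\<sigma> * (\<phi> s - \<phi> r))\<^sup>2 / 2))))"
  proof (rule Bochner_Integration.integral_cong[OF refl])
    fix s
    have "(\<integral>x. cis (\<sigma> * x * \<phi> s) * cnj (?\<Phi> x) \<partial>?N) = (\<integral>x. (LBINT r. cnj (F r) * cis (\<sigma> * (\<phi> s - \<phi> r) * x)) \<partial>?N)"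
    proof (intro Bochner_Integration.integral_cong refl)
      fix x
      have "cnj (?\<Phi> x) = (LBINT r. cnj (F r * cis (\<sigma> * x * \<phi> r)))"
        unfolding osc_integral_def by (rule Bochner_Integration.integral_cnj[symmetric])
      then have "cis (\<sigma> * x * \<phi> s) * cnj (?\<Phi> x) = (LBINT r. cis (\<sigma> * x * \<phi> s) * cnj (F r * cis (\<sigma> * x * \<phi> r)))"
        by simp
      also have "\<dots> = (LBINT r. cnj (F r) * cis (\<sigma> * (\<phi> s - \<phi> r) * x))"
        by (intro Bochner_Integration.integral_cong refl)
           (simp add: cis_cnj cis_mult mult.left_commute algebra_simps)
      finally show "cis (\<sigma> * x * \<phi> s) * cnj (?\<Phi> x) = (LBINT r. cnj (F r) * cis (\<sigma> * (\<phi> s - \<phi> r) * x))" .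
    qed
    also have "\<dots> = (LBINT r. cnj (F r) * (\<integral>x. cis (\<sigma> * (\<phi> s - \<phi> r) * x) \<partial>?N))"
      by (rule swap[of _ _ 1]) (use F in auto)
    finally show "F s * (\<integral>x. cis (\<sigma> * x * \<phi> s) * cnj (?\<Phi> x) \<partial>?N)
        = F s * (LBINT r. cnj (F r) * of_real (exp (- (\<sigma> * (\<phi> s - \<phi> r))\<^sup>2 / 2)))"
      by (simp only: char_std_normal)
  qed
  finally have eq: "complex_of_real (\<integral>x. (cmod (?\<Phi> x))\<^sup>2 \<partial>?N)
      = (LBINT s. F s * (LBINT r. cnj (F r) * of_real (exp (- (\<sigma> * (\<phi> s - \<phi> r))\<^sup>2 / 2))))" .
  have intr: "integrable lborel (\<lambda>r. cmod (F r) * exp (- (\<sigma> * (\<phi> s - \<phi> r))\<^sup>2 / 2))" for s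
    by (rule Bochner_Integration.integrable_bound[of _ "\<lambda>r. cmod (F r)"]) (use F in \<open>auto intro!: AE_I2 mult_left_le\<close>)
  have inner_le: "(LBINT r. cmod (F r) * exp (- (\<sigma> * (\<phi> s - \<phi> r))\<^sup>2 / 2)) \<le> C" for s
    unfolding C_def by (rule integral_mono[OF intr]) (use F in \<open>auto intro: mult_left_le\<close>)
  have inner_ge: "0 \<le> (LBINT r. cmod (F r) * exp (- (\<sigma> * (\<phi> s - \<phi> r))\<^sup>2 / 2))" for s
    by (rule integral_nonneg_AE) simp
  have "(\<integral>x. (cmod (?\<Phi> x))\<^sup>2 \<partial>?N) = cmod (complex_of_real (\<integral>x. (cmod (?\<Phi> x))\<^sup>2 \<partial>?N))"
    by (simp only: norm_of_real) simp
  also have "\<dots> \<le> (LBINT s. cmod (F s * (LBINT r. cnj (F r) * of_real (exp (- (\<sigma> * (\<phi> s - \<phi> r))\<^sup>2 / 2)))))"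
    unfolding eq by (rule integral_norm_bound)
  also have "\<dots> \<le> (LBINT s. cmod (F s) * (LBINT r. cmod (F r) * exp (- (\<sigma> * (\<phi> s - \<phi> r))\<^sup>2 / 2)))"
  proof (rule integral_mono')
    show "integrable lborel (\<lambda>s. cmod (F s) * (LBINT r. cmod (F r) * exp (- (\<sigma> * (\<phi> s - \<phi> r))\<^sup>2 / 2)))"
      by (rule Bochner_Integration.integrable_bound[of _ "\<lambda>s. cmod (F s) * C"])
         (use F inner_le inner_ge C in \<open>auto simp: abs_mult intro!: mult_left_mono\<close>)
    fix s
    show "cmod (F s * (LBINT r. cnj (F r) * of_real (exp (- (\<sigma> * (\<phi> s - \<phi> r))\<^sup>2 / 2))))
      \<le> cmod (F s) * (LBINT r. cmod (F r) * exp (- (\<sigma> * (\<phi> s - \<phi> r))\<^sup>2 / 2))"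
      unfolding norm_mult
      by (intro mult_left_mono order_trans[OF integral_norm_bound]) (simp_all add: norm_mult)
    show "0 \<le> cmod (F s) * (LBINT r. cmod (F r) * exp (- (\<sigma> * (\<phi> s - \<phi> r))\<^sup>2 / 2))"
      using inner_ge by simp
  qed
  also have "\<dots> = (LBINT s. LBINT r. cmod (F s) * cmod (F r) * exp (- (\<sigma> * (\<phi> s - \<phi> r))\<^sup>2 / 2))"
    by (simp add: mult.assoc)
  finally show ?thesis .
qed

text \<open>Only an inequality, since the Bochner integral of a non-integrable function is 0 by
  convention.\<close>

lemma ennreal_integral_le_nn_integral:
  fixes f :: "'a \<Rightarrow> real"
  assumes "\<And>x. f x \<ge> 0"
  shows "ennreal (integral\<^sup>L M f) \<le> (\<integral>\<^sup>+x. ennreal (f x) \<partial>M)"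
  by (cases "integrable M f") (use assms in \<open>auto simp: nn_integral_eq_integral not_integrable_integral_eq\<close>)

text \<open>Weighted arithmetic-geometric inequality, from the square of
  \<open>x * q - y * p\<close>. With \<open>p\<close> and \<open>q\<close> the derivatives of the
  phase at \<open>s\<close> and \<open>r\<close>, each term carries the Jacobian of the variable
  that its square does not contain.\<close>

lemma mult_le_weighted_squares:
  fixes x y p q :: real
  assumes "p > 0" "q > 0"
  shows "x * y \<le> x\<^sup>2 / (2 * p) * q + y\<^sup>2 / (2 * q) * p"
proof -
  have "0 \<le> (x * q - y * p)\<^sup>2 / (2 * p * q)" using assms by simp
  also have "\<dots> = x\<^sup>2 / (2 * p) * q + y\<^sup>2 / (2 * q) * p - x * y"
    using assms by (simp add: power2_eq_square field_simps)
  finally show ?thesis by simp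
qed

section \<open>Plancherel's inequality for an increasing phase, by a Schur test\<close>

context
  fixes \<phi> \<phi>' :: "real \<Rightarrow> real" and F :: "real \<Rightarrow> complex" and a b :: real
  assumes ab: "a \<le> b" and [measurable]: "\<phi> \<in> borel_measurable borel" "\<phi>' \<in> borel_measurable borel"
    and deriv: "\<And>x. x \<in> {a..b} \<Longrightarrow> (\<phi> has_real_derivative \<phi>' x) (at x)"
    and cont: "continuous_on {a..b} \<phi>'" and pos: "\<And>x. x \<in> {a..b} \<Longrightarrow> \<phi>' x > 0"
    and F: "integrable lborel F" and F0: "\<And>x. x \<notin> {a..b} \<Longrightarrow> F x = 0"
begin

text \<open>A Schur test. The weighted inequality bounds the double integrand by
  \<open>A s r + A r s\<close>. In \<open>A s r\<close> the factor \<open>\<phi>' r\<close> turns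
  the \<open>r\<close>-integral of the kernel into a Gaussian integral, bounded uniformly in
  \<open>s\<close>; by symmetry of the kernel the two halves contribute equally.\<close>

lemma nn_integral_osc_gaussian_kernel_le:
  assumes s: "\<sigma> > 0"
  shows "(\<integral>\<^sup>+x. ennreal ((cmod (osc_integral \<phi> F (\<sigma> * x)))\<^sup>2) \<partial>std_normal_distribution)
       \<le> ennreal (sqrt (2 * pi) / \<sigma>) * (\<integral>\<^sup>+s. ennreal ((cmod (F s))\<^sup>2 / \<phi>' s) \<partial>lborel)"
proof -
  interpret N: prob_space std_normal_distribution
    by (intro prob_space_normal_density) simp
  have [measurable]: "F \<in> borel_measurable borel" using F by simp
  define K where "K s r = exp (- (\<sigma> * (\<phi> s - \<phi> r))\<^sup>2 / 2)" for s r
  have [measurable]: "(\<lambda>(s, r). K s r) \<in> borel_measurable (borel \<Otimes>\<^sub>M borel)"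
    unfolding K_def by measurable
  have K0: "K s r \<ge> 0" for s r by (simp add: K_def)
  have Ksym: "K s r = K r s" for s r unfolding K_def by (simp add: power_mult_distrib power2_commute)
  define A where "A s r = (cmod (F s))\<^sup>2 / (2 * \<phi>' s) * (indicator {a..b} r * \<phi>' r * K s r)" for s r
  have [measurable]: "(\<lambda>(s, r). A s r) \<in> borel_measurable (borel \<Otimes>\<^sub>M borel)"
    unfolding A_def by measurable
  have F\<phi>: "0 \<le> (cmod (F s))\<^sup>2 / (2 * \<phi>' s)" for s
    using F0[of s] pos[of s] by (cases "s \<in> {a..b}") auto
  have ind0: "0 \<le> indicator {a..b} r * \<phi>' r * K s r" for r s
    using pos[of r] K0 by (auto simp: indicator_def intro!: mult_nonneg_nonneg)
  have A0: "A s r \<ge> 0" for s r unfolding A_def by (intro mult_nonneg_nonneg F\<phi> ind0)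
  have P_le: "cmod (F s) * cmod (F r) * K s r \<le> A s r + A r s" for s r
  proof (cases "s \<in> {a..b} \<and> r \<in> {a..b}")
    case True
    then have "cmod (F s) * cmod (F r) \<le> (cmod (F s))\<^sup>2 / (2 * \<phi>' s) * \<phi>' r + (cmod (F r))\<^sup>2 / (2 * \<phi>' r) * \<phi>' s"
      by (intro mult_le_weighted_squares pos) auto
    then have "cmod (F s) * cmod (F r) * K s r
        \<le> ((cmod (F s))\<^sup>2 / (2 * \<phi>' s) * \<phi>' r + (cmod (F r))\<^sup>2 / (2 * \<phi>' r) * \<phi>' s) * K s r"
      using K0 by (rule mult_right_mono)
    then show ?thesis using True by (simp add: A_def Ksym[of r s] distrib_right mult.assoc)
  next
    case False
    then have "cmod (F s) * cmod (F r) * K s r = 0" using F0 by auto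
    then show ?thesis using A0[of s r] A0[of r s] by linarith
  qed
  \<comment> \<open>Substitution \<open>y = \<phi> r\<close>, followed by extending the range
    \<open>{\<phi> a..\<phi> b}\<close> to the whole line.\<close>
  have inner: "(\<integral>\<^sup>+r. ennreal (indicator {a..b} r * \<phi>' r * K s r) \<partial>lborel) \<le> ennreal (sqrt (2 * pi) / \<sigma>)" for s
  proof -
    have "(\<integral>\<^sup>+r. ennreal (indicator {a..b} r * \<phi>' r * K s r) \<partial>lborel)
        = (\<integral>\<^sup>+r. ennreal (exp (- (\<sigma> * (\<phi> s - \<phi> r))\<^sup>2 / 2) * \<phi>' r * indicator {a..b} r) \<partial>lborel)"
      by (intro nn_integral_cong) (simp add: K_def ac_simps)
    also have "\<dots> = (\<integral>\<^sup>+y. ennreal (exp (- (\<sigma> * (\<phi> s - y))\<^sup>2 / 2) * indicator {\<phi> a..\<phi> b} y) \<partial>lborel)"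
      by (rule nn_integral_substitution[symmetric])
         (use deriv cont pos ab in \<open>auto simp: set_borel_measurable_def less_imp_le\<close>)
    also have "\<dots> \<le> (\<integral>\<^sup>+y. ennreal (exp (- (\<sigma> * (\<phi> s - y))\<^sup>2 / 2)) \<partial>lborel)"
      by (intro nn_integral_mono ennreal_leI) (auto simp: indicator_def)
    finally have "(\<integral>\<^sup>+r. ennreal (indicator {a..b} r * \<phi>' r * K s r) \<partial>lborel)
        \<le> (\<integral>\<^sup>+y. ennreal (exp (- (\<sigma> * (\<phi> s - y))\<^sup>2 / 2)) \<partial>lborel)" .
    then show ?thesis by (simp only: nn_integral_exp_neg_square[OF s])
  qed
  have Y: "(\<integral>\<^sup>+s. \<integral>\<^sup>+r. ennreal (A s r) \<partial>lborel \<partial>lborel)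
      \<le> ennreal (sqrt (2 * pi) / \<sigma>) * (\<integral>\<^sup>+s. ennreal ((cmod (F s))\<^sup>2 / (2 * \<phi>' s)) \<partial>lborel)"
  proof -
    have "(\<integral>\<^sup>+s. \<integral>\<^sup>+r. ennreal (A s r) \<partial>lborel \<partial>lborel)
        = (\<integral>\<^sup>+s. ennreal ((cmod (F s))\<^sup>2 / (2 * \<phi>' s))
             * (\<integral>\<^sup>+r. ennreal (indicator {a..b} r * \<phi>' r * K s r) \<partial>lborel) \<partial>lborel)"
      unfolding A_def by (intro nn_integral_cong) (subst ennreal_mult[OF F\<phi> ind0], rule nn_integral_cmult, measurable)
    also have "\<dots> \<le> (\<integral>\<^sup>+s. ennreal ((cmod (F s))\<^sup>2 / (2 * \<phi>' s)) * ennreal (sqrt (2 * pi) / \<sigma>) \<partial>lborel)"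
      by (intro nn_integral_mono mult_left_mono inner) auto
    also have "\<dots> = ennreal (sqrt (2 * pi) / \<sigma>) * (\<integral>\<^sup>+s. ennreal ((cmod (F s))\<^sup>2 / (2 * \<phi>' s)) \<partial>lborel)"
      by (subst nn_integral_multc) (auto simp: mult.commute)
    finally show ?thesis .
  qed
  have "(\<integral>\<^sup>+x. ennreal ((cmod (osc_integral \<phi> F (\<sigma> * x)))\<^sup>2) \<partial>std_normal_distribution)
      = ennreal (\<integral>x. (cmod (osc_integral \<phi> F (\<sigma> * x)))\<^sup>2 \<partial>std_normal_distribution)"
    by (intro nn_integral_eq_integral N.integrable_const_bound[where B = "(LBINT s. cmod (F s))\<^sup>2"])
       (auto intro!: power_mono cmod_osc_integral_le F)
  also have "\<dots> \<le> ennreal (LBINT s. LBINT r. cmod (F s) * cmod (F r) * K s r)"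
    unfolding K_def by (intro ennreal_leI integral_osc_integral_gaussian F) measurable
  also have "\<dots> \<le> (\<integral>\<^sup>+s. ennreal (LBINT r. cmod (F s) * cmod (F r) * K s r) \<partial>lborel)"
    by (intro ennreal_integral_le_nn_integral integral_nonneg_AE AE_I2 mult_nonneg_nonneg K0 norm_ge_zero)
  also have "\<dots> \<le> (\<integral>\<^sup>+s. \<integral>\<^sup>+r. ennreal (cmod (F s) * cmod (F r) * K s r) \<partial>lborel \<partial>lborel)"
    by (intro nn_integral_mono ennreal_integral_le_nn_integral mult_nonneg_nonneg K0 norm_ge_zero)
  also have "\<dots> \<le> (\<integral>\<^sup>+s. \<integral>\<^sup>+r. ennreal (A s r) + ennreal (A r s) \<partial>lborel \<partial>lborel)"
    by (intro nn_integral_mono) (simp add: A0 P_le flip: ennreal_plus)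
  also have "\<dots> = (\<integral>\<^sup>+s. \<integral>\<^sup>+r. ennreal (A s r) \<partial>lborel \<partial>lborel) + (\<integral>\<^sup>+s. \<integral>\<^sup>+r. ennreal (A r s) \<partial>lborel \<partial>lborel)"
    by (simp add: nn_integral_add)
  also have "(\<integral>\<^sup>+s. \<integral>\<^sup>+r. ennreal (A r s) \<partial>lborel \<partial>lborel) = (\<integral>\<^sup>+s. \<integral>\<^sup>+r. ennreal (A s r) \<partial>lborel \<partial>lborel)"
    by (rule lborel_pair.Fubini') measurable
  also have "(\<integral>\<^sup>+s. \<integral>\<^sup>+r. ennreal (A s r) \<partial>lborel \<partial>lborel) + (\<integral>\<^sup>+s. \<integral>\<^sup>+r. ennreal (A s r) \<partial>lborel \<partial>lborel)
      \<le> ennreal (sqrt (2 * pi) / \<sigma>) * (\<integral>\<^sup>+s. ennreal ((cmod (F s))\<^sup>2 / (2 * \<phi>' s)) \<partial>lborel)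
        + ennreal (sqrt (2 * pi) / \<sigma>) * (\<integral>\<^sup>+s. ennreal ((cmod (F s))\<^sup>2 / (2 * \<phi>' s)) \<partial>lborel)"
    by (intro add_mono Y)
  also have "\<dots> = ennreal (sqrt (2 * pi) / \<sigma>)
      * (\<integral>\<^sup>+s. ennreal ((cmod (F s))\<^sup>2 / (2 * \<phi>' s)) + ennreal ((cmod (F s))\<^sup>2 / (2 * \<phi>' s)) \<partial>lborel)"
    by (simp add: nn_integral_add distrib_left)
  also have "\<dots> = ennreal (sqrt (2 * pi) / \<sigma>) * (\<integral>\<^sup>+s. ennreal ((cmod (F s))\<^sup>2 / \<phi>' s) \<partial>lborel)"
    by (simp add: F\<phi> flip: ennreal_plus)
  finally show ?thesis .
qed

text \<open>Rescaling \<open>k = \<sigma> * x\<close> costs a factor \<open>\<sigma>\<close>, and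
  undoing the normalisation of the normal density costs \<open>sqrt (2 * pi)\<close>. Together with
  the kernel bound the \<open>\<sigma>\<close> cancels, leaving \<open>2 * pi\<close> uniformly in
  \<open>\<sigma>\<close>.\<close>

lemma nn_integral_osc_gaussian_le:
  assumes s: "\<sigma> > 0"
  shows "(\<integral>\<^sup>+k. ennreal ((cmod (osc_integral \<phi> F k))\<^sup>2 * exp (- (k / \<sigma>)\<^sup>2 / 2)) \<partial>lborel)
       \<le> ennreal (2 * pi) * (\<integral>\<^sup>+s. ennreal ((cmod (F s))\<^sup>2 / \<phi>' s) \<partial>lborel)"
proof -
  have [measurable]: "F \<in> borel_measurable borel" using F by simp
  define X where "X = (\<integral>\<^sup>+s. ennreal ((cmod (F s))\<^sup>2 / \<phi>' s) \<partial>lborel)"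
  have "(\<integral>\<^sup>+k. ennreal ((cmod (osc_integral \<phi> F k))\<^sup>2 * exp (- (k / \<sigma>)\<^sup>2 / 2)) \<partial>lborel)
      = ennreal \<sigma> * (\<integral>\<^sup>+x. ennreal ((cmod (osc_integral \<phi> F (\<sigma> * x)))\<^sup>2 * exp (- x\<^sup>2 / 2)) \<partial>lborel)"
    using s nn_integral_real_affine[of "\<lambda>k. ennreal ((cmod (osc_integral \<phi> F k))\<^sup>2 * exp (- (k / \<sigma>)\<^sup>2 / 2))" \<sigma> 0]
    by simp
  also have "(\<integral>\<^sup>+x. ennreal ((cmod (osc_integral \<phi> F (\<sigma> * x)))\<^sup>2 * exp (- x\<^sup>2 / 2)) \<partial>lborel)
      = (\<integral>\<^sup>+x. ennreal (sqrt (2 * pi)) * (ennreal (std_normal_density x) * ennreal ((cmod (osc_integral \<phi> F (\<sigma> * x)))\<^sup>2)) \<partial>lborel)"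
    by (intro nn_integral_cong) (simp add: std_normal_density_def flip: ennreal_mult)
  also have "\<dots> = ennreal (sqrt (2 * pi)) * (\<integral>\<^sup>+x. ennreal ((cmod (osc_integral \<phi> F (\<sigma> * x)))\<^sup>2) \<partial>std_normal_distribution)"
    by (simp add: nn_integral_cmult nn_integral_density)
  also have "ennreal \<sigma> * \<dots> \<le> ennreal \<sigma> * (ennreal (sqrt (2 * pi)) * (ennreal (sqrt (2 * pi) / \<sigma>) * X))"
    unfolding X_def by (intro mult_left_mono nn_integral_osc_gaussian_kernel_le s) auto
  also have "\<dots> = ennreal (\<sigma> * (sqrt (2 * pi) * (sqrt (2 * pi) / \<sigma>))) * X"
  proof -
    have mult: "ennreal (\<sigma> * (p * q)) = ennreal \<sigma> * (ennreal p * ennreal q)" if "0 \<le> p" "0 \<le> q" for p q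
      using s that by (simp add: ennreal_mult)
    have e: "ennreal (\<sigma> * (sqrt (2 * pi) * (sqrt (2 * pi) / \<sigma>)))
        = ennreal \<sigma> * (ennreal (sqrt (2 * pi)) * ennreal (sqrt (2 * pi) / \<sigma>))"
      by (rule mult) (use s in auto)
    show ?thesis unfolding e by (simp only: mult.assoc)
  qed
  also have "\<sigma> * (sqrt (2 * pi) * (sqrt (2 * pi) / \<sigma>)) = 2 * pi" using s by simp
  finally show ?thesis by (simp only: X_def)
qed

text \<open>As the Gaussian widens, the damping factor tends to 1, and Fatou's lemma preserves the
  uniform bound. The right-hand side is the squared L2 norm of \<open>F / \<phi>'\<close> in the
  variable \<open>y = \<phi> s\<close>, which explains the single power of
  \<open>\<phi>'\<close>.\<close>

theorem nn_integral_osc_integral_le: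
  "(\<integral>\<^sup>+k. ennreal ((cmod (osc_integral \<phi> F k))\<^sup>2) \<partial>lborel)
    \<le> ennreal (2 * pi) * (\<integral>\<^sup>+s. ennreal ((cmod (F s))\<^sup>2 / \<phi>' s) \<partial>lborel)"
proof -
  have [measurable]: "F \<in> borel_measurable borel" using F by simp
  define g where "g n k = ennreal ((cmod (osc_integral \<phi> F k))\<^sup>2 * exp (- (k / real (Suc n))\<^sup>2 / 2))" for n k
  have "(\<lambda>n. g n k) \<longlonglongrightarrow> ennreal ((cmod (osc_integral \<phi> F k))\<^sup>2 * exp (- 0\<^sup>2 / 2))" for k
    unfolding g_def
    by (intro tendsto_intros LIMSEQ_Suc[OF lim_const_over_n])  auto
  then have "liminf (\<lambda>n. g n k) = ennreal ((cmod (osc_integral \<phi> F k))\<^sup>2)" for k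
    by (subst lim_imp_Liminf) auto
  then have "(\<integral>\<^sup>+k. ennreal ((cmod (osc_integral \<phi> F k))\<^sup>2) \<partial>lborel) = (\<integral>\<^sup>+k. liminf (\<lambda>n. g n k) \<partial>lborel)"
    by simp
  also have "\<dots> \<le> liminf (\<lambda>n. \<integral>\<^sup>+k. g n k \<partial>lborel)"
    by (rule nn_integral_liminf) (simp add: g_def)
  also have "\<dots> \<le> ennreal (2 * pi) * (\<integral>\<^sup>+s. ennreal ((cmod (F s))\<^sup>2 / \<phi>' s) \<partial>lborel)"
    unfolding g_def
    by (intro Liminf_le always_eventually allI nn_integral_osc_gaussian_le) auto
  finally show ?thesis .
qed

end

section \<open>The free evolution of the potential\<close>

lemma L2_norm_const: "L2_norm (\<lambda>_. c) = cmod c"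
  by (simp add: L2_norm_def torus.prob_space[simplified])

lemma fourier_coeff_one: "fourier_coeff (\<lambda>_. 1) n = (if n = 0 then 1 else 0)"
  using L2_inner_expi[of 0 n] by (simp add: fourier_coeff_eq)

lemma fourier_coeff_zero_eq: "fourier_coeff f 0 = L2_inner f (\<lambda>_. 1)"
  by (simp add: fourier_coeff_eq)

lemma cmod_set_integral_le:
  fixes f :: "real \<Rightarrow> complex" and h :: "real \<Rightarrow> real"
  assumes h: "set_integrable lborel B h" and "A \<subseteq> B" "\<And>s. s \<in> B \<Longrightarrow> 0 \<le> h s"
    and "\<And>s. s \<in> A \<Longrightarrow> cmod (f s) \<le> h s"
  shows "cmod (LBINT s:A. f s) \<le> (LBINT s:B. h s)"
proof -
  have "cmod (LBINT s:A. f s) \<le> (LBINT s. norm (indicator A s *\<^sub>R f s))"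
    unfolding set_lebesgue_integral_def by (rule integral_norm_bound)
  also have "\<dots> \<le> (LBINT s. indicator B s *\<^sub>R h s)"
    by (rule integral_mono') (use assms in \<open>auto simp: set_integrable_def indicator_def\<close>)
  finally show ?thesis by (simp add: set_lebesgue_integral_def)
qed

lemma set_integral_sum:
  fixes f :: "'i \<Rightarrow> 'a \<Rightarrow> 'b::{banach, second_countable_topology}"
  assumes "\<And>i. i \<in> I \<Longrightarrow> set_integrable M A (f i)"
  shows "(LINT x:A|M. \<Sum>i\<in>I. f i x) = (\<Sum>i\<in>I. LINT x:A|M. f i x)"
    and "set_integrable M A (\<lambda>x. \<Sum>i\<in>I. f i x)"
  using assms unfolding set_lebesgue_integral_def set_integrable_def scaleR_sum_right
  by (auto intro!: Bochner_Integration.integral_sum)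

lemma cnj_set_integral: "cnj (LBINT s:A. f s) = (LBINT s:A. cnj (f s))"
  unfolding set_lebesgue_integral_def
  by (simp flip: Bochner_Integration.integral_cnj)

lemma set_integrable_cnj: "set_integrable lborel A f \<Longrightarrow> set_integrable lborel A (\<lambda>s. cnj (f s))"
  unfolding set_integrable_def using integrable_cnj[of lborel "\<lambda>s. indicator A s *\<^sub>R f s"] by simp

lemma set_integral_dominated_convergence:
  fixes f :: "nat \<Rightarrow> real \<Rightarrow> 'b::{banach, second_countable_topology}"
  assumes f: "\<And>n. set_integrable lborel A (f n)" and w: "set_integrable lborel A w"
    and lim: "\<And>s. s \<in> A \<Longrightarrow> (\<lambda>n. f n s) \<longlonglongrightarrow> F s"
    and dom: "\<And>n s. s \<in> A \<Longrightarrow> norm (f n s) \<le> w s"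
  shows "(\<lambda>n. LBINT s:A. f n s) \<longlonglongrightarrow> (LBINT s:A. F s)"
proof -
  have lim': "(\<lambda>n. indicator A s *\<^sub>R f n s) \<longlonglongrightarrow> indicator A s *\<^sub>R F s" for s
    using lim[of s] by (cases "s \<in> A") auto
  have m: "(\<lambda>s. indicator A s *\<^sub>R f n s) \<in> borel_measurable lborel" for n
    using f[of n] by (auto simp: set_integrable_def)
  show ?thesis
    unfolding set_lebesgue_integral_def
  proof (rule integral_dominated_convergence[where w = "\<lambda>s. indicator A s *\<^sub>R w s"])
    show "(\<lambda>s. indicator A s *\<^sub>R F s) \<in> borel_measurable lborel"
      by (rule borel_measurable_LIMSEQ_metric[OF m lim'])
    show "integrable lborel (\<lambda>s. indicator A s *\<^sub>R w s)" using w by (simp add: set_integrable_def)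
    show "AE s in lborel. norm (indicator A s *\<^sub>R f n s) \<le> indicator A s *\<^sub>R w s" for n
      using dom by (intro AE_I2) (auto simp: indicator_def)
  qed (use lim' m in auto)
qed

text \<open>
  \<open>cis (k * phase n s)\<close> is the \<open>n\<close>-th Fourier multiplier of the propagator from time \<open>s\<close> to time
  \<open>\<infinity>\<close>; multiplying by it passes to the interaction picture.
\<close>

definition phase :: "int \<Rightarrow> real \<Rightarrow> real" where
  "phase n s = - (of_int n)\<^sup>2 / (1 + s)"

lemma phase_measurable [measurable]: "phase n \<in> borel_measurable borel"
  unfolding phase_def[abs_def] by measurable

abbreviation modes :: "nat \<Rightarrow> int set" where
  "modes N \<equiv> {- int N..int N}"

text \<open>What the argument uses of \<open>V\<close>: slicewise bounds by one function
  \<open>\<rho>\<close> and time measurability of each Fourier coefficient. The indicator in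
  \<open>V_meas\<close> is there because \<open>V\<close> is arbitrary at negative times. The main
  theorem instantiates \<open>\<rho> s\<close> by
  \<open>\<lambda> (1 + s) powr (- \<gamma>)\<close>.\<close>

locale potential =
  fixes V :: "real \<Rightarrow> real \<Rightarrow> real" and T :: real and \<rho> :: "real \<Rightarrow> real"
  assumes T: "T \<ge> 0"
    and V_L2: "\<And>s. s \<ge> 0 \<Longrightarrow> (\<lambda>x. complex_of_real (V s x)) \<in> L2_torus"
    and V_le: "\<And>s. s \<ge> 0 \<Longrightarrow> AE x in torus. \<bar>V s x\<bar> \<le> \<rho> s"
    and V_mean: "\<And>s. s \<ge> 0 \<Longrightarrow> fourier_coeff (\<lambda>x. complex_of_real (V s x)) 0 = 0"
    and V_meas: "\<And>n. (\<lambda>s. indicator {0..} s * fourier_coeff (\<lambda>x. complex_of_real (V s x)) n) \<in> borel_measurable borel"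
    and \<rho>_cont: "continuous_on {0..} \<rho>"
    and \<rho>_pos: "\<And>s. s \<ge> 0 \<Longrightarrow> \<rho> s > 0"
begin

definition W :: "real \<Rightarrow> real \<Rightarrow> real" where
  "W s x = V s x * indicator {T<..} s"

definition W_coeff :: "int \<Rightarrow> real \<Rightarrow> complex" where
  "W_coeff n s = indicator {T<..} s * fourier_coeff (\<lambda>x. complex_of_real (V s x)) n"

lemma W_coeff_measurable [measurable]: "W_coeff n \<in> borel_measurable borel"
proof -
  have "W_coeff n = (\<lambda>s. indicator {T<..} s * (indicator {0..} s * fourier_coeff (\<lambda>x. complex_of_real (V s x)) n))"
    using T by (auto simp: W_coeff_def fun_eq_iff indicator_def)
  then show ?thesis using V_meas by simp
qed

lemma \<rho>_set_integrable: "0 \<le> a \<Longrightarrow> set_integrable lborel {a..b} \<rho>"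
  by (intro borel_integrable_atLeastAtMost' continuous_on_subset[OF \<rho>_cont]) auto

lemma W_eq: "(\<lambda>x. complex_of_real (W s x)) = (if s > T then (\<lambda>x. complex_of_real (V s x)) else (\<lambda>_. 0))"
  by (auto simp: W_def fun_eq_iff)

lemma W_L2: "s \<ge> 0 \<Longrightarrow> (\<lambda>x. complex_of_real (W s x)) \<in> L2_torus"
  using V_L2 L2_torus_const[of 0] by (simp add: W_eq)

lemma fourier_coeff_W: "fourier_coeff (\<lambda>x. complex_of_real (W s x)) n = W_coeff n s"
  by (simp add: W_eq W_coeff_def fourier_coeff_eq L2_inner_def)

lemma W_coeff_0: "s \<ge> 0 \<Longrightarrow> W_coeff 0 s = 0"
  by (simp add: W_coeff_def V_mean)

lemma L2_norm_W_le:
  assumes "s \<ge> 0"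
  shows "L2_norm (\<lambda>x. complex_of_real (W s x)) \<le> \<rho> s"
proof -
  have "L2_norm (\<lambda>x. complex_of_real (W s x)) \<le> \<rho> s * L2_norm (\<lambda>_. 1)"
  proof (rule L2_norm_le_dominated)
    show "AE x in torus. cmod (complex_of_real (W s x)) \<le> \<rho> s * cmod 1"
      using V_le[OF assms] by eventually_elim (use \<rho>_pos[OF assms] in \<open>auto simp: W_def indicator_def\<close>)
  qed (use \<rho>_pos[OF assms] W_L2[OF assms] in \<open>auto simp: L2_torus_const L2_torus_iff\<close>)
  then show ?thesis by (simp add: L2_norm_const)
qed

lemma L2_set_W_coeff_le: "s \<ge> 0 \<Longrightarrow> finite A \<Longrightarrow> L2_set (\<lambda>n. cmod (W_coeff n s)) A \<le> \<rho> s"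
  using order_trans[OF L2_set_fourier_coeff_le[OF W_L2] L2_norm_W_le] by (simp add: fourier_coeff_W)

text \<open>The truncated potential in the interaction picture: the propagator has become a
  unimodular factor depending on one time only.\<close>

definition v :: "int \<Rightarrow> real \<Rightarrow> real \<Rightarrow> complex" where
  "v n k s = W_coeff n s * cis (k * phase n s)"

lemma v_measurable [measurable]: "v n k \<in> borel_measurable borel"
  unfolding v_def[abs_def] by measurable

lemma cmod_v: "cmod (v n k s) = cmod (W_coeff n s)"
  by (simp add: v_def norm_mult)

lemma cmod_W_coeff_le: "s \<ge> 0 \<Longrightarrow> cmod (W_coeff n s) \<le> \<rho> s"
  using L2_set_W_coeff_le[of s "{n}"] by simp

lemma v_set_integrable: "0 \<le> a \<Longrightarrow> set_integrable lborel {a..b} (v n k)"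
  by (rule set_integrable_bound[OF \<rho>_set_integrable[of a b]])
     (auto simp: cmod_v set_borel_measurable_def intro!: order_trans[OF cmod_W_coeff_le] AE_I2)

text \<open>This is the \<open>n\<close>-th coefficient of the overview's \<open>G(r)\<close> up to
  the unimodular factor \<open>cis (k * phase n r)\<close>, so moduli agree. In
  \<open>G_norm\<close> the same \<open>N\<close> also limits the modes.\<close>

definition G :: "nat \<Rightarrow> int \<Rightarrow> real \<Rightarrow> real \<Rightarrow> complex" where
  "G N n k r = (LBINT s:{r..real N}. v n k s)"

definition G_norm :: "nat \<Rightarrow> real \<Rightarrow> real \<Rightarrow> real" where
  "G_norm N k r = L2_set (\<lambda>n. cmod (G N n k r)) (modes N)"

lemma G_measurable [measurable]: "(\<lambda>(k, r). G N n k r) \<in> borel_measurable (borel \<Otimes>\<^sub>M borel)"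
proof -
  have "(\<lambda>(k, r). G N n k r)
      = (\<lambda>(k, r). LBINT s. if r \<le> s \<and> s \<le> real N then W_coeff n s * cis (k * phase n s) else 0)"
    by (auto simp: G_def v_def set_lebesgue_integral_def fun_eq_iff intro!: Bochner_Integration.integral_cong)
  also have "\<dots> \<in> borel_measurable (borel \<Otimes>\<^sub>M borel)" by measurable
  finally show ?thesis .
qed

lemma G_norm_measurable [measurable]: "(\<lambda>(k, r). G_norm N k r) \<in> borel_measurable (borel \<Otimes>\<^sub>M borel)"
  unfolding G_norm_def L2_set_def by measurable

lemma G_norm_nonneg [simp]: "G_norm N k r \<ge> 0"
  by (simp add: G_norm_def L2_set_nonneg)

text \<open>A crude bound depending on \<open>N\<close>; it serves only to make
  \<open>\<rho> r * G_norm N k r\<close> integrable in \<open>r\<close>.\<close>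

lemma G_norm_bounded:
  assumes "r \<ge> 0"
  shows "G_norm N k r \<le> real (card (modes N)) * (LBINT s:{0..real N}. \<rho> s)"
proof -
  have "cmod (G N n k r) \<le> (LBINT s:{0..real N}. \<rho> s)" for n
    unfolding G_def using assms
    by (intro cmod_set_integral_le \<rho>_set_integrable)
       (auto simp: cmod_v less_imp_le[OF \<rho>_pos] intro!: cmod_W_coeff_le)
  then have "(\<Sum>n\<in>modes N. cmod (G N n k r)) \<le> real (card (modes N)) * (LBINT s:{0..real N}. \<rho> s)"
    using sum_bounded_above[of "modes N" "\<lambda>n. cmod (G N n k r)"] by blast
  moreover have "G_norm N k r \<le> (\<Sum>n\<in>modes N. cmod (G N n k r))"
    unfolding G_norm_def by (rule L2_set_le_sum) simp
  ultimately show ?thesis by linarith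
qed

lemma \<rho>_G_norm_set_integrable: "0 \<le> a \<Longrightarrow> set_integrable lborel {a..b} (\<lambda>r. \<rho> r * G_norm N k r)"
proof -
  assume a: "0 \<le> a"
  define C where "C = real (card (modes N)) * (LBINT s:{0..real N}. \<rho> s)"
  have m: "(\<lambda>s. indicator {a..b} s *\<^sub>R \<rho> s) \<in> borel_measurable borel"
    using \<rho>_set_integrable[OF a, of b] by (auto simp: set_integrable_def)
  have "(\<lambda>s. (indicator {a..b} s *\<^sub>R \<rho> s) * G_norm N k s) \<in> borel_measurable borel"
    using m by measurable
  moreover have "norm (\<rho> s * G_norm N k s) \<le> norm (C * \<rho> s)" if "s \<in> {a..b}" for s
  proof -
    have "\<bar>\<rho> s\<bar> * G_norm N k s \<le> \<bar>\<rho> s\<bar> * \<bar>C\<bar>"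
      using that a unfolding C_def
      by (intro mult_left_mono order_trans[OF G_norm_bounded abs_ge_self]) auto
    then show ?thesis by (simp add: abs_mult mult.commute)
  qed
  ultimately show ?thesis
    by (intro set_integrable_bound[OF set_integrable_mult_right[of C, OF \<rho>_set_integrable[OF a, of b]]])
       (auto simp: set_borel_measurable_def mult.assoc)
qed

definition M :: "nat \<Rightarrow> real \<Rightarrow> real" where
  "M N k = (LBINT r:{T..real N}. \<rho> r * G_norm N k r)"

lemma M_nonneg: "M N k \<ge> 0"
  unfolding M_def set_lebesgue_integral_def using T
  by (intro integral_nonneg_AE AE_I2) (auto simp: indicator_def less_imp_le[OF \<rho>_pos])

lemma cmod_sum_mult_G_le:
  assumes "L2_set (\<lambda>n. cmod (a n)) (modes N) \<le> c"
  shows "cmod (\<Sum>n\<in>modes N. a n * cnj (G N n k r)) \<le> c * G_norm N k r"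
proof -
  have "cmod (\<Sum>n\<in>modes N. a n * cnj (G N n k r)) \<le> L2_set (\<lambda>n. cmod (a n)) (modes N) * G_norm N k r"
    unfolding G_norm_def using cmod_sum_mult_le_L2_set[of a "\<lambda>n. cnj (G N n k r)" "modes N"] by simp
  also have "\<dots> \<le> c * G_norm N k r" using assms by (rule mult_right_mono) simp
  finally show ?thesis .
qed

text \<open>
  The derivative of \<open>\<parallel>G(t)\<parallel>\<^sup>2\<close> is \<open>- 2 Re \<langle>V(t), G(t)\<rangle>\<close> because the propagator is unitary.
\<close>

lemma G_norm_squared_le:
  assumes "T \<le> t"
  shows "(G_norm N k t)\<^sup>2 \<le> 2 * M N k"
proof -
  have t0: "0 \<le> t" using assms T by simp
  note I = v_set_integrable[OF t0, of "real N" _ k]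
  note J = set_integral_mult_set_integral[OF I set_integrable_cnj[OF I]]
  note J' = set_integral_mult_set_integral(5)[OF set_integrable_cnj[OF I] I]
  have "complex_of_real ((G_norm N k t)\<^sup>2) = (\<Sum>n\<in>modes N. G N n k t * cnj (G N n k t))"
    by (simp add: G_norm_def L2_set_def sum_nonneg complex_norm_square flip: of_real_power)
  \<comment> \<open>Product rule from the right: \<open>G N n k\<close> vanishes at the horizon
    \<open>real N\<close>, so there is no boundary term.\<close>
  also have "\<dots> = (\<Sum>n\<in>modes N. LBINT s:{t..real N}. v n k s * cnj (G N n k s) + cnj (v n k s) * G N n k s)"
    unfolding G_def cnj_set_integral by (intro sum.cong refl J(2))
  also have "\<dots> = (LBINT s:{t..real N}. (\<Sum>n\<in>modes N. v n k s * cnj (G N n k s) + cnj (v n k s) * G N n k s))"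
    unfolding G_def cnj_set_integral
    by (intro set_integral_sum(1)[symmetric] set_integral_add J(5) J')
  finally have "(G_norm N k t)\<^sup>2 = cmod (LBINT s:{t..real N}. (\<Sum>n\<in>modes N. v n k s * cnj (G N n k s) + cnj (v n k s) * G N n k s))"
    by (metis abs_of_nonneg norm_of_real zero_le_power2)
  also have "\<dots> \<le> (LBINT s:{T..real N}. 2 * (\<rho> s * G_norm N k s))"
  proof (rule cmod_set_integral_le)
    show "set_integrable lborel {T..real N} (\<lambda>s. 2 * (\<rho> s * G_norm N k s))"
      by (intro set_integrable_mult_right \<rho>_G_norm_set_integrable T)
    fix s
    show "s \<in> {T..real N} \<Longrightarrow> 0 \<le> 2 * (\<rho> s * G_norm N k s)" using T by (simp add: less_imp_le[OF \<rho>_pos])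
    assume "s \<in> {t..real N}"
    then have s: "s \<ge> 0" using t0 by simp
    have v: "L2_set (\<lambda>n. cmod (v n k s)) (modes N) \<le> \<rho> s"
      using L2_set_W_coeff_le[OF s, of "modes N"] by (simp add: cmod_v)
    define z where "z = (\<Sum>n\<in>modes N. v n k s * cnj (G N n k s))"
    have "(\<Sum>n\<in>modes N. v n k s * cnj (G N n k s) + cnj (v n k s) * G N n k s) = z + cnj z"
      by (simp add: z_def sum.distrib)
    also have "cmod \<dots> \<le> cmod z + cmod (cnj z)" by (rule norm_triangle_ineq)
    finally show "cmod (\<Sum>n\<in>modes N. v n k s * cnj (G N n k s) + cnj (v n k s) * G N n k s) \<le> 2 * (\<rho> s * G_norm N k s)"
      using cmod_sum_mult_G_le[OF v, of k s, folded z_def] unfolding complex_mod_cnj by linarith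
  qed (use assms in auto)
  also have "\<dots> = 2 * M N k" by (simp add: M_def)
  finally show ?thesis .
qed

end

section \<open>The solution in terms of its Fourier modes\<close>

text \<open>The exponent is a difference of a term in \<open>s\<close> and a term in
  \<open>t\<close>, so the multiplier splits into one factor for each time. This is what makes the
  interaction picture available.\<close>

lemma exp_phase_difference:
  "exp (- \<i> * of_real ((k / (1 + s) - k / (1 + t)) * (of_int n)\<^sup>2))
    = cis (k * phase n s) * cnj (cis (k * phase n t))"
proof -
  have "exp (- \<i> * of_real a) = cis (- a)" for a
    by (simp add: cis_conv_exp)
  then show ?thesis
    by (simp only: cis_cnj cis_mult) (simp add: phase_def left_diff_distrib)
qed

locale potential_solution = potential +
  fixes k :: real and u :: "real \<Rightarrow> real \<Rightarrow> complex"
  assumes sol: "mild_solution k W (\<lambda>_. 1) u"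
begin

definition w :: "real \<Rightarrow> real \<Rightarrow> complex" where
  "w t x = u t x - 1"

definition h :: "int \<Rightarrow> real \<Rightarrow> complex" where
  "h n s = fourier_coeff (\<lambda>x. of_real (W s x) * u s x) n"

text \<open>\<open>b'\<close> is the time derivative of \<open>b\<close>.\<close>

definition b :: "int \<Rightarrow> real \<Rightarrow> complex" where
  "b n t = cis (k * phase n t) * fourier_coeff (w t) n"

definition b' :: "int \<Rightarrow> real \<Rightarrow> complex" where
  "b' n s = - \<i> * (cis (k * phase n s) * h n s)"

lemma u_L2: "t \<ge> 0 \<Longrightarrow> u t \<in> L2_torus"
  using sol by (simp add: mild_solution_def)

lemma w_L2: "t \<ge> 0 \<Longrightarrow> w t \<in> L2_torus"
  unfolding w_def[abs_def] using L2_torus_diff[OF u_L2 L2_torus_const] .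

lemma L2_norm_u_continuous: "continuous_on {0..} (\<lambda>t. L2_norm (u t))"
proof (subst continuous_on, intro ballI)
  fix t :: real assume "t \<in> {0..}"
  then have t: "t \<ge> 0" by simp
  then have lim: "((\<lambda>s. L2_norm (\<lambda>x. u s x - u t x)) \<longlongrightarrow> 0) (at t within {0..})"
    using sol by (simp add: mild_solution_def)
  have "((\<lambda>s. L2_norm (u s) - L2_norm (u t)) \<longlongrightarrow> 0) (at t within {0..})"
  proof (rule Lim_null_comparison[OF _ lim])
    show "\<forall>\<^sub>F s in at t within {0..}. norm (L2_norm (u s) - L2_norm (u t)) \<le> L2_norm (\<lambda>x. u s x - u t x)"
      using t by (auto simp: eventually_at_filter intro!: always_eventually L2_norm_triangle_diff u_L2)
  qed
  then show "((\<lambda>t. L2_norm (u t)) \<longlongrightarrow> L2_norm (u t)) (at t within {0..})"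
    by (rule Lim_null[THEN iffD2])
qed

text \<open>Continuity on a compact interval. This a priori bound supplies the dominating function
  for \<open>L2_norm_w_squared\<close>, from which the conservation law \<open>L2_norm_u\<close> is
  only afterwards deduced.\<close>

lemma L2_norm_bounded:
  obtains B where "\<And>s. s \<in> {0..t} \<Longrightarrow> L2_norm (u s) \<le> B" "\<And>s. s \<in> {0..t} \<Longrightarrow> L2_norm (w s) \<le> B + 1" "0 \<le> B"
proof -
  have "bounded ((\<lambda>s. L2_norm (u s)) ` {0..t})"
    by (intro compact_imp_bounded compact_continuous_image continuous_on_subset[OF L2_norm_u_continuous]) auto
  then obtain B where B: "\<And>s. s \<in> {0..t} \<Longrightarrow> L2_norm (u s) \<le> B"
    unfolding bounded_iff by (metis abs_le_iff imageI real_norm_def)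
  have "L2_norm (w s) \<le> max B 0 + 1" if "s \<in> {0..t}" for s
    using L2_norm_triangle[of "u s" "\<lambda>_. - 1"] u_L2[of s] B[OF that] that
    by (simp add: L2_torus_const L2_norm_const w_def[abs_def])
  then show ?thesis using B by (intro that[of "max B 0"]) (auto simp: le_max_iff_disj)
qed

text \<open>Read off Duhamel's formula at \<open>s = t\<close>: \<open>schroedinger_group\<close>
  includes that its argument lies in L2.\<close>

lemma Wu_L2: "t \<ge> 0 \<Longrightarrow> (\<lambda>x. of_real (W t x) * u t x) \<in> L2_torus"
  using sol unfolding mild_solution_def free_propagator_def schroedinger_group_def by force

lemma L2_norm_Wu_le:
  assumes "s \<ge> 0"
  shows "L2_norm (\<lambda>x. of_real (W s x) * u s x) \<le> indicator {T<..} s * \<rho> s * L2_norm (u s)"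
proof (rule L2_norm_le_dominated)
  show "AE x in torus. cmod (of_real (W s x) * u s x) \<le> indicator {T<..} s * \<rho> s * cmod (u s x)"
    using V_le[OF assms] by eventually_elim (auto simp: W_def norm_mult indicator_def intro: mult_right_mono)
qed (use assms less_imp_le[OF \<rho>_pos] in \<open>auto simp: L2_torus_measurable Wu_L2 u_L2\<close>)

text \<open>Here the realness of the potential enters: the integrand is \<open>W\<close> times the
  squared modulus of \<open>u\<close>.\<close>

lemma L2_inner_Wu_real: "Im (L2_inner (\<lambda>x. of_real (W s x) * u s x) (u s)) = 0"
proof -
  have "L2_inner (\<lambda>x. of_real (W s x) * u s x) (u s) = (\<integral>x. complex_of_real (W s x * (cmod (u s x))\<^sup>2) \<partial>torus)"
    by (simp add: L2_inner_def complex_norm_square mult.assoc del: of_real_power)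
  then show ?thesis by (simp only: integral_complex_of_real Im_complex_of_real)
qed

lemma L2_inner_Wu_one: "h 0 s = L2_inner (u s) (\<lambda>x. of_real (W s x))"
  by (simp add: h_def fourier_coeff_zero_eq L2_inner_def mult.commute)

lemma fourier_coeff_w: "t \<ge> 0 \<Longrightarrow> fourier_coeff (w t) n = fourier_coeff (u t) n - (if n = 0 then 1 else 0)"
  unfolding w_def[abs_def] fourier_coeff_eq
  using fourier_coeff_one[of n]
  by (subst L2_inner_diff_left) (auto simp: u_L2 L2_torus_const fourier_coeff_eq)

text \<open>Pairing the L2-valued integral with the test function \<open>expi n\<close> makes it a
  scalar integral. Multiplication by \<open>cis (k * phase n t)\<close> then cancels the only
  dependence of the integrand on \<open>t\<close>, so that \<open>b n\<close> is a primitive of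
  \<open>b' n\<close>. The free solution \<open>1\<close> cancels against the \<open>1\<close>
  subtracted in \<open>w\<close>.\<close>

lemma duhamel_modes:
  assumes t: "t \<ge> 0"
  shows "set_integrable lborel {0..t} (b' n)" "b n t = (LBINT s:{0..t}. b' n s)"
proof -
  from sol t obtain f F J where f: "free_propagator k t 0 (\<lambda>_. 1) f"
    and F: "\<And>s. s \<in> {0..t} \<Longrightarrow> free_propagator k t s (\<lambda>x. of_real (W s x) * u s x) (F s)"
    and J: "has_L2_integral F J {0..t}" and u: "AE x in torus. u t x = f x - \<i> * J x"
    unfolding mild_solution_def by blast
  have fL2: "f \<in> L2_torus" and f_coeff: "fourier_coeff f n = (if n = 0 then 1 else 0)"
    using f by (auto simp: free_propagator_def schroedinger_group_def fourier_coeff_one)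
  have F_coeff: "fourier_coeff (F s) n = cis (k * phase n s) * cnj (cis (k * phase n t)) * h n s" if "s \<in> {0..t}" for s
    using F[OF that] unfolding free_propagator_def schroedinger_group_def exp_phase_difference h_def by blast
  have JL2: "J \<in> L2_torus" and Fint: "set_integrable lborel {0..t} (\<lambda>s. fourier_coeff (F s) n)"
    and J_coeff: "fourier_coeff J n = (LBINT s:{0..t}. fourier_coeff (F s) n)"
    using J by (auto simp: has_L2_integral_def fourier_coeff_eq)
  define c where "c = cis (k * phase n t)"
  have c: "c * cnj c = 1" by (simp add: c_def cis_cnj cis_mult)
  have eq: "b' n s = - \<i> * c * fourier_coeff (F s) n" if "s \<in> {0..t}" for s
  proof -
    have "- \<i> * c * fourier_coeff (F s) n = (c * cnj c) * b' n s"
      unfolding F_coeff[OF that] b'_def c_def by (simp only: ac_simps)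
    then show ?thesis using c by simp
  qed
  have "set_integrable lborel {0..t} (\<lambda>s. - \<i> * c * fourier_coeff (F s) n)"
    by (rule set_integrable_mult_right) (rule Fint)
  then show "set_integrable lborel {0..t} (b' n)"
    by (subst set_integrable_cong[OF refl refl eq]) auto
  have "(LBINT s:{0..t}. b' n s) = (LBINT s:{0..t}. - \<i> * c * fourier_coeff (F s) n)"
    using eq by (intro set_lebesgue_integral_cong) auto
  also have "\<dots> = - \<i> * c * fourier_coeff J n"
    by (simp only: set_integral_mult_right J_coeff)
  finally have int: "(LBINT s:{0..t}. b' n s) = - \<i> * c * fourier_coeff J n" .
  have "fourier_coeff (u t) n = L2_inner (\<lambda>x. f x - \<i> * J x) (expi n)"
    unfolding fourier_coeff_eq
    by (rule L2_inner_cong_AE[OF _ _ _ u])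
       (auto simp: L2_torus_measurable u_L2[OF t] intro!: L2_torus_measurable[OF L2_torus_diff[OF fL2 L2_torus_cmult[OF JL2]]])
  also have "\<dots> = fourier_coeff f n - \<i> * fourier_coeff J n"
    by (simp add: L2_inner_diff_left L2_inner_cmult_left fL2 L2_torus_cmult[OF JL2] fourier_coeff_eq)
  finally have "fourier_coeff (w t) n = - \<i> * fourier_coeff J n"
    by (simp add: fourier_coeff_w[OF t] f_coeff)
  then show "b n t = (LBINT s:{0..t}. b' n s)"
    unfolding int b_def c_def by simp
qed

lemma b'_cnj_b: "b' n s * cnj (b n s) = - \<i> * (h n s * cnj (fourier_coeff (w s) n))"
proof -
  have "b' n s * cnj (b n s)
      = (cis (k * phase n s) * cnj (cis (k * phase n s))) * (- \<i> * (h n s * cnj (fourier_coeff (w s) n)))"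
    unfolding b'_def b_def complex_cnj_mult by (simp only: ac_simps)
  then show ?thesis by (simp add: cis_cnj cis_mult)
qed

lemma b_cnj_v: "b n s * cnj (v n k s) = fourier_coeff (w s) n * cnj (W_coeff n s)"
proof -
  have "b n s * cnj (v n k s)
      = (cis (k * phase n s) * cnj (cis (k * phase n s))) * (fourier_coeff (w s) n * cnj (W_coeff n s))"
    unfolding v_def b_def complex_cnj_mult by (simp only: ac_simps)
  then show ?thesis by (simp add: cis_cnj cis_mult)
qed

text \<open>The product rule for each \<open>|b n|^2\<close>, summed by Parseval, gives the integral
  of twice the imaginary part of \<open><W u, w>\<close>. As \<open><W u, u>\<close> is real, only
  \<open>- <W u, 1>\<close> contributes, and \<open><W u, 1>\<close> is \<open>h 0\<close>.\<close>

lemma L2_norm_w_squared: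
  assumes t: "t \<ge> 0"
  shows "(L2_norm (w t))\<^sup>2 = - 2 * Im (LBINT s:{0..t}. h 0 s)"
proof -
  define S where "S N s = (\<Sum>n\<in>modes N. h n s * cnj (fourier_coeff (w s) n))" for N s
  have b'b: "set_integrable lborel {0..t} (\<lambda>s. b' n s * cnj (b n s))"
    and bb: "b n t * cnj (b n t) = (LBINT s:{0..t}. b' n s * cnj (b n s) + cnj (b' n s) * b n s)" for n
  proof -
    note I = duhamel_modes(1)[OF t, of n]
    note J = set_integral_mult_set_integral[OF I set_integrable_cnj[OF I]]
    have eq: "b n s = (LBINT s:{0..s}. b' n s)" if "s \<in> {0..t}" for s
      using that by (intro duhamel_modes) simp
    have "set_integrable lborel {0..t} (\<lambda>s. b' n s * (LBINT r:{0..s}. cnj (b' n r)))" by (rule J(4))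
    then show "set_integrable lborel {0..t} (\<lambda>s. b' n s * cnj (b n s))"
      by (subst set_integrable_cong[OF refl refl]) (auto simp: eq cnj_set_integral)
    have "b n t * cnj (b n t) = (LBINT s:{0..t}. b' n s) * (LBINT s:{0..t}. cnj (b' n s))"
      using t by (simp add: eq cnj_set_integral)
    also have "\<dots> = (LBINT s:{0..t}. b' n s * cnj (b n s) + cnj (b' n s) * b n s)"
      unfolding J(1) by (intro set_lebesgue_integral_cong) (auto simp: eq cnj_set_integral)
    finally show "b n t * cnj (b n t) = (LBINT s:{0..t}. b' n s * cnj (b n s) + cnj (b' n s) * b n s)" .
  qed
  have S_eq: "(\<Sum>n\<in>modes N. b' n s * cnj (b n s) + cnj (b' n s) * b n s) = of_real (2 * Im (S N s))" for N s
  proof -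
    have "(\<Sum>n\<in>modes N. b' n s * cnj (b n s) + cnj (b' n s) * b n s) = - \<i> * S N s + cnj (- \<i> * S N s)"
    proof -
      have "(\<Sum>n\<in>modes N. b' n s * cnj (b n s)) = - \<i> * S N s"
        unfolding b'_cnj_b S_def sum_distrib_left ..
      moreover have "(\<Sum>n\<in>modes N. cnj (b' n s) * b n s) = cnj (\<Sum>n\<in>modes N. b' n s * cnj (b n s))" by simp
      ultimately show ?thesis by (simp only: sum.distrib)
    qed
    then show ?thesis by (simp add: complex_eq_iff)
  qed
  have int2: "set_integrable lborel {0..t} (\<lambda>s. b' n s * cnj (b n s) + cnj (b' n s) * b n s)" for n
    using set_integral_add(1)[OF b'b set_integrable_cnj[OF b'b], of n n] by simp
  have S_int: "set_integrable lborel {0..t} (\<lambda>s. complex_of_real (2 * Im (S N s)))" for N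
    unfolding S_eq[symmetric] by (intro set_integral_sum(2) int2)
  have sum_eq: "(\<Sum>n\<in>modes N. fourier_coeff (w t) n * cnj (fourier_coeff (w t) n))
      = (LBINT s:{0..t}. complex_of_real (2 * Im (S N s)))" for N
  proof -
    have "fourier_coeff (w t) n * cnj (fourier_coeff (w t) n) = b n t * cnj (b n t)" for n
    proof -
      have "b n t * cnj (b n t) = (cis (k * phase n t) * cnj (cis (k * phase n t))) * (fourier_coeff (w t) n * cnj (fourier_coeff (w t) n))"
        unfolding b_def complex_cnj_mult by (simp only: ac_simps)
      then show ?thesis by (simp add: cis_cnj cis_mult)
    qed
    then have "(\<Sum>n\<in>modes N. fourier_coeff (w t) n * cnj (fourier_coeff (w t) n))
        = (\<Sum>n\<in>modes N. LBINT s:{0..t}. b' n s * cnj (b n s) + cnj (b' n s) * b n s)"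
      by (simp only: bb)
    also have "\<dots> = (LBINT s:{0..t}. (\<Sum>n\<in>modes N. b' n s * cnj (b n s) + cnj (b' n s) * b n s))"
      by (intro set_integral_sum(1)[symmetric] int2)
    finally show ?thesis by (simp only: S_eq)
  qed
  obtain B where B: "\<And>s. s \<in> {0..t} \<Longrightarrow> L2_norm (u s) \<le> B" "\<And>s. s \<in> {0..t} \<Longrightarrow> L2_norm (w s) \<le> B + 1" "0 \<le> B"
    using L2_norm_bounded by blast
  have "(\<lambda>N. LBINT s:{0..t}. complex_of_real (2 * Im (S N s))) \<longlonglongrightarrow> (LBINT s:{0..t}. complex_of_real (- 2 * Im (h 0 s)))"
  proof (rule set_integral_dominated_convergence[OF S_int])
    show "set_integrable lborel {0..t} (\<lambda>s. 2 * B * (B + 1) * \<rho> s)"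
      by (intro set_integrable_mult_right \<rho>_set_integrable) simp
  next
    fix s assume s: "s \<in> {0..t}"
    then have s0: "s \<ge> 0" by simp
    have "(\<lambda>N. S N s) \<longlonglongrightarrow> L2_inner (\<lambda>x. of_real (W s x) * u s x) (w s)"
      unfolding S_def h_def by (rule Parseval[OF Wu_L2 w_L2]) (use s0 in auto)
    then have "(\<lambda>N. complex_of_real (2 * Im (S N s)))
        \<longlonglongrightarrow> of_real (2 * Im (L2_inner (\<lambda>x. of_real (W s x) * u s x) (w s)))"
      by (intro tendsto_intros)
    moreover have "L2_inner (\<lambda>x. of_real (W s x) * u s x) (w s)
        = L2_inner (\<lambda>x. of_real (W s x) * u s x) (u s) - h 0 s"
    proof -
      have "L2_inner (w s) g = L2_inner (u s) g - L2_inner (\<lambda>_. 1) g" if "g \<in> L2_torus" for g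
        unfolding w_def[abs_def] by (rule L2_inner_diff_left) (use that s0 u_L2 in \<open>auto simp: L2_torus_const\<close>)
      from arg_cong[OF this[OF Wu_L2[OF s0]], of cnj] show ?thesis
        by (simp add: cnj_L2_inner h_def fourier_coeff_zero_eq)
    qed
    ultimately show "(\<lambda>N. complex_of_real (2 * Im (S N s))) \<longlonglongrightarrow> complex_of_real (- 2 * Im (h 0 s))"
      by (simp add: L2_inner_Wu_real)
    fix N
    have "cmod (S N s) \<le> L2_norm (\<lambda>x. of_real (W s x) * u s x) * L2_norm (w s)"
      unfolding S_def h_def by (intro cmod_sum_fourier_coeff_le Wu_L2 w_L2) (use s0 in auto)
    also have "\<dots> \<le> (\<rho> s * B) * (B + 1)"
    proof (intro mult_mono)
      have "L2_norm (\<lambda>x. of_real (W s x) * u s x) \<le> indicator {T<..} s * \<rho> s * L2_norm (u s)"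
        by (rule L2_norm_Wu_le[OF s0])
      also have "\<dots> \<le> 1 * \<rho> s * B"
        using B(1)[OF s] less_imp_le[OF \<rho>_pos[OF s0]] by (intro mult_mono) (auto simp: indicator_def)
      finally show "L2_norm (\<lambda>x. of_real (W s x) * u s x) \<le> \<rho> s * B" by simp
    qed (use B s less_imp_le[OF \<rho>_pos[OF s0]] in auto)
    finally have "2 * \<bar>Im (S N s)\<bar> \<le> 2 * ((\<rho> s * B) * (B + 1))"
      using abs_Im_le_cmod[of "S N s"] by linarith
    then show "norm (complex_of_real (2 * Im (S N s))) \<le> 2 * B * (B + 1) * \<rho> s"
      by (simp only: norm_of_real abs_mult) (simp add: ac_simps)
  qed
  moreover have "(\<lambda>N. \<Sum>n\<in>modes N. fourier_coeff (w t) n * cnj (fourier_coeff (w t) n)) \<longlonglongrightarrow> L2_inner (w t) (w t)"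
    by (rule Parseval) (use t w_L2 in auto)
  ultimately have "L2_inner (w t) (w t) = (LBINT s:{0..t}. complex_of_real (- 2 * Im (h 0 s)))"
    unfolding sum_eq by (rule LIMSEQ_unique[rotated])
  moreover have "(LBINT s:{0..t}. complex_of_real (- 2 * Im (h 0 s))) = of_real (- 2 * Im (LBINT s:{0..t}. h 0 s))"
  proof -
    \<comment> \<open>\<open>phase 0\<close> vanishes, so \<open>b' 0\<close> is
      \<open>- \<i>\<close> times \<open>h 0\<close>; this yields the integrability needed to take
      \<open>Im\<close> under the integral.\<close>
    have "set_integrable lborel {0..t} (b' 0)" by (rule duhamel_modes[OF t])
    then have "set_integrable lborel {0..t} (\<lambda>s. \<i> * b' 0 s)" by (rule set_integrable_mult_right)
    then have h0: "set_integrable lborel {0..t} (h 0)" by (simp add: b'_def[abs_def] phase_def)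
    then have "Im (LBINT s:{0..t}. h 0 s) = (LBINT s:{0..t}. Im (h 0 s))"
      unfolding set_lebesgue_integral_def set_integrable_def by (simp flip: integral_Im)
    then show ?thesis by (simp only: set_integral_complex_of_real set_integral_mult_right)
  qed
  ultimately show ?thesis
    unfolding L2_inner_self of_real_eq_iff by (metis of_real_eq_iff)
qed

text \<open>The zeroth mode of Duhamel's formula expresses the integral in
  \<open>L2_norm_w_squared\<close> through the mean of \<open>u\<close>. Expanding the squared norm
  of \<open>u - 1\<close> produces the same mean, and it cancels.\<close>

lemma L2_norm_u:
  assumes t: "t \<ge> 0"
  shows "L2_norm (u t) = 1"
proof -
  have "fourier_coeff (w t) 0 = - \<i> * (LBINT s:{0..t}. h 0 s)"
    using duhamel_modes(2)[OF t, of 0] set_integral_mult_right[of lborel "{0..t}" "- \<i>" "h 0"]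
    by (simp add: b'_def b_def phase_def)
  then have "Re (fourier_coeff (w t) 0) = Im (LBINT s:{0..t}. h 0 s)" by simp
  moreover have "(L2_norm (w t))\<^sup>2 = (L2_norm (u t))\<^sup>2 - 2 * Re (fourier_coeff (u t) 0) + 1"
  proof -
    have "L2_inner (u t) (\<lambda>_. - 1) = - fourier_coeff (u t) 0"
      by (simp add: fourier_coeff_zero_eq L2_inner_def)
    then show ?thesis
      using L2_norm_add_squared[OF u_L2[OF t] L2_torus_const[of "- 1"]]
      by (simp add: w_def[abs_def] L2_norm_const)
  qed
  ultimately have "(L2_norm (u t))\<^sup>2 = 1"
    using L2_norm_w_squared[OF t] by (simp add: fourier_coeff_w[OF t])
  then show ?thesis using L2_norm_nonneg[of "u t"] by (simp add: power2_eq_1_iff)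
qed

lemma L2_set_b'_le:
  assumes "s \<ge> 0" "finite A"
  shows "L2_set (\<lambda>n. cmod (b' n s)) A \<le> indicator {T<..} s * \<rho> s"
proof -
  have "L2_set (\<lambda>n. cmod (b' n s)) A = L2_set (\<lambda>n. cmod (h n s)) A"
    by (simp add: b'_def norm_mult)
  also have "\<dots> \<le> L2_norm (\<lambda>x. of_real (W s x) * u s x)"
    unfolding h_def by (intro L2_set_fourier_coeff_le Wu_L2 assms)
  also have "\<dots> \<le> indicator {T<..} s * \<rho> s"
    using L2_norm_Wu_le[OF assms(1)] by (simp add: L2_norm_u[OF assms(1)])
  finally show ?thesis .
qed

text \<open>Integration by parts: \<open>- G N n k\<close> is a primitive of \<open>v n k\<close>,
  and \<open>b n\<close> vanishes at 0. Taking the tail of \<open>v\<close> up to the horizon rather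
  than up to \<open>t\<close> makes \<open>G\<close> independent of \<open>t\<close>, at the price
  of the boundary term.\<close>

lemma integral_b_cnj_v:
  assumes t: "0 \<le> t" "t \<le> real N"
  shows "(LBINT s:{0..t}. b n s * cnj (v n k s))
      = (LBINT r:{0..t}. b' n r * cnj (G N n k r)) - b n t * cnj (G N n k t)"
    and "set_integrable lborel {0..t} (\<lambda>s. b n s * cnj (v n k s))"
    and "set_integrable lborel {0..t} (\<lambda>r. b' n r * cnj (G N n k r))"
proof -
  note I = set_integrable_cnj[OF v_set_integrable[OF order_refl, of t n k]] duhamel_modes(1)[OF t(1), of n]
  note J = set_integral_mult_set_integral[OF I] set_integral_mult_set_integral(5)[OF I(2,1)]
  have beq: "b n s = (LBINT s:{0..s}. b' n s)" if "s \<in> {0..t}" for s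
    using that by (intro duhamel_modes) simp
  have Geq: "(LBINT s:{r..t}. cnj (v n k s)) = cnj (G N n k r) - cnj (G N n k t)" if r: "r \<in> {0..t}" for r
  proof -
    have "integrable lborel (\<lambda>s. indicator {r..real N} s *\<^sub>R v n k s)"
      using v_set_integrable[of r "real N" n k] r by (simp add: set_integrable_def)
    from integral_split_at[OF this, of t]
    have "G N n k r = (LBINT s:{r..t}. v n k s) + G N n k t"
      unfolding G_def set_lebesgue_integral_def scaleR_scaleR indicator_inter_arith[symmetric]
      using r t by (simp add: Int_commute inf_commute)
    then show ?thesis by (simp add: cnj_set_integral[symmetric])
  qed
  have "(LBINT s:{0..t}. b n s * cnj (v n k s)) = (LBINT s:{0..t}. cnj (v n k s) * (LBINT r:{0..s}. b' n r))"
    by (intro set_lebesgue_integral_cong) (auto simp: beq)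
  also have "\<dots> = (LBINT r:{0..t}. b' n r * (LBINT s:{r..t}. cnj (v n k s)))" by (rule J(3))
  finally have eq: "(LBINT s:{0..t}. b n s * cnj (v n k s)) = (LBINT r:{0..t}. b' n r * (LBINT s:{r..t}. cnj (v n k s)))" .
  have "set_integrable lborel {0..t} (\<lambda>r. b' n r * (LBINT s:{r..t}. cnj (v n k s)) + b' n r * cnj (G N n k t))"
    by (intro set_integral_add(1) J(6) set_integrable_mult_left I(2))
  then show 3: "set_integrable lborel {0..t} (\<lambda>r. b' n r * cnj (G N n k r))"
    by (subst set_integrable_cong[OF refl refl]) (auto simp: Geq algebra_simps)
  have "set_integrable lborel {0..t} (\<lambda>s. cnj (v n k s) * (LBINT r:{0..s}. b' n r))" by (rule J(4))
  then show "set_integrable lborel {0..t} (\<lambda>s. b n s * cnj (v n k s))"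
    by (subst set_integrable_cong[OF refl refl]) (auto simp: beq)
  have "(LBINT r:{0..t}. b' n r * (LBINT s:{r..t}. cnj (v n k s)))
      = (LBINT r:{0..t}. b' n r * cnj (G N n k r) - b' n r * cnj (G N n k t))"
    by (intro set_lebesgue_integral_cong) (auto simp: Geq algebra_simps)
  also have "\<dots> = (LBINT r:{0..t}. b' n r * cnj (G N n k r)) - (LBINT r:{0..t}. b' n r * cnj (G N n k t))"
    by (intro set_integral_diff(2) 3 set_integrable_mult_left I(2))
  finally show "(LBINT s:{0..t}. b n s * cnj (v n k s))
      = (LBINT r:{0..t}. b' n r * cnj (G N n k r)) - b n t * cnj (G N n k t)"
    unfolding eq using duhamel_modes(2)[OF t(1)] by simp
qed

text \<open>Norm conservation bounds \<open>b'\<close> by \<open>\<rho>\<close> after time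
  \<open>T\<close> and by 0 before, so Cauchy--Schwarz over the modes bounds the integral term by
  \<open>M\<close>. Bessel's inequality for \<open>w t\<close> handles the boundary term.\<close>

lemma cmod_integral_w_W_le:
  assumes t: "T \<le> t" "t \<le> real N"
  shows "cmod (LBINT s:{0..t}. (\<Sum>n\<in>modes N. fourier_coeff (w s) n * cnj (W_coeff n s)))
      \<le> M N k + L2_norm (w t) * G_norm N k t"
proof -
  have t0: "0 \<le> t" using t T by simp
  note I = integral_b_cnj_v[OF t0 t(2)]
  have "(LBINT s:{0..t}. (\<Sum>n\<in>modes N. fourier_coeff (w s) n * cnj (W_coeff n s)))
      = (\<Sum>n\<in>modes N. LBINT s:{0..t}. b n s * cnj (v n k s))"
    unfolding b_cnj_v[symmetric] by (intro set_integral_sum(1) I)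
  also have "\<dots> = (LBINT s:{0..t}. (\<Sum>n\<in>modes N. b' n s * cnj (G N n k s)))
      - (\<Sum>n\<in>modes N. b n t * cnj (G N n k t))"
    by (simp add: I(1) sum_subtractf set_integral_sum(1) I(3))
  finally have eq: "(LBINT s:{0..t}. (\<Sum>n\<in>modes N. fourier_coeff (w s) n * cnj (W_coeff n s)))
      = (LBINT s:{0..t}. (\<Sum>n\<in>modes N. b' n s * cnj (G N n k s)))
        - (\<Sum>n\<in>modes N. b n t * cnj (G N n k t))" .
  show ?thesis
    unfolding eq
  proof (rule order_trans[OF norm_triangle_ineq4 add_mono])
    have "cmod (LBINT s:{0..t}. (\<Sum>n\<in>modes N. b' n s * cnj (G N n k s)))
        \<le> (LBINT s:{0..real N}. indicator {T..} s * (\<rho> s * G_norm N k s))"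
    proof (rule cmod_set_integral_le)
      have "indicator {0..real N} s * (indicator {T..} s * (\<rho> s * G_norm N k s))
          = indicator {T..real N} s * (\<rho> s * G_norm N k s)" for s
        using T by (auto simp: indicator_def)
      then show "set_integrable lborel {0..real N} (\<lambda>s. indicator {T..} s * (\<rho> s * G_norm N k s))"
        using \<rho>_G_norm_set_integrable[OF T, of "real N" N k] unfolding set_integrable_def real_scaleR_def
        by (simp only:)
      show "s \<in> {0..real N} \<Longrightarrow> 0 \<le> indicator {T..} s * (\<rho> s * G_norm N k s)" for s
        using \<rho>_pos[of s] by simp
      fix s assume "s \<in> {0..t}"
      then have s: "s \<ge> 0" by simp
      have "cmod (\<Sum>n\<in>modes N. b' n s * cnj (G N n k s)) \<le> indicator {T<..} s * \<rho> s * G_norm N k s"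
        by (intro cmod_sum_mult_G_le L2_set_b'_le s) simp
      also have "\<dots> \<le> indicator {T..} s * (\<rho> s * G_norm N k s)"
        unfolding mult.assoc using \<rho>_pos[OF s] by (intro mult_right_mono) (auto simp: indicator_def)
      finally show "cmod (\<Sum>n\<in>modes N. b' n s * cnj (G N n k s)) \<le> indicator {T..} s * (\<rho> s * G_norm N k s)" .
    qed (use t in auto)
    also have "\<dots> = M N k"
      unfolding M_def set_lebesgue_integral_def using T
      by (intro Bochner_Integration.integral_cong) (auto simp: indicator_def)
    finally show "cmod (LBINT s:{0..t}. (\<Sum>n\<in>modes N. b' n s * cnj (G N n k s))) \<le> M N k" .
    have "L2_set (\<lambda>n. cmod (b n t)) (modes N) = L2_set (\<lambda>n. cmod (fourier_coeff (w t) n)) (modes N)"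
      by (simp add: b_def norm_mult)
    also have "\<dots> \<le> L2_norm (w t)" by (intro L2_set_fourier_coeff_le w_L2 t0) simp
    finally show "cmod (\<Sum>n\<in>modes N. b n t * cnj (G N n k t)) \<le> L2_norm (w t) * G_norm N k t"
      by (rule cmod_sum_mult_G_le)
  qed
qed

text \<open>Parseval for \<open><w, W>\<close>, which equals \<open><u, W> - <1, W>\<close>: the
  last term vanishes by the mean zero of \<open>V\<close>, and \<open><u, W>\<close> is
  \<open>h 0\<close> because \<open>W\<close> is real. The non-oscillating mode of
  \<open>W u\<close> is thus rewritten through the modes \<open>n \<noteq> 0\<close> of
  \<open>W\<close>.\<close>

lemma integral_w_W_tendsto:
  assumes t: "t \<ge> 0"
  shows "(\<lambda>N. LBINT s:{0..t}. (\<Sum>n\<in>modes N. fourier_coeff (w s) n * cnj (W_coeff n s)))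
    \<longlonglongrightarrow> (LBINT s:{0..t}. h 0 s)"
proof -
  obtain B where B: "\<And>s. s \<in> {0..t} \<Longrightarrow> L2_norm (w s) \<le> B + 1" "0 \<le> B"
    using L2_norm_bounded by blast
  \<comment> \<open>An auxiliary horizon, unrelated to the mode cutoff \<open>N\<close>; it only
    makes the integrability statement of \<open>integral_b_cnj_v\<close> applicable.\<close>
  obtain N0 where N0: "t \<le> real N0" using real_arch_simple by blast
  show ?thesis
  proof (rule set_integral_dominated_convergence)
    show "set_integrable lborel {0..t} (\<lambda>s. (\<Sum>n\<in>modes N. fourier_coeff (w s) n * cnj (W_coeff n s)))" for N
      unfolding b_cnj_v[symmetric] by (intro set_integral_sum(2) integral_b_cnj_v(2)[OF t N0])
    show "set_integrable lborel {0..t} (\<lambda>s. (B + 1) * \<rho> s)"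
      by (intro set_integrable_mult_right \<rho>_set_integrable) simp
    fix s assume s: "s \<in> {0..t}"
    then have s0: "s \<ge> 0" by simp
    have "L2_inner (w s) (\<lambda>x. of_real (W s x)) = h 0 s - L2_inner (\<lambda>_. 1) (\<lambda>x. of_real (W s x))"
      unfolding w_def[abs_def] L2_inner_Wu_one
      by (rule L2_inner_diff_left) (use s0 in \<open>auto simp: u_L2 W_L2 L2_torus_const\<close>)
    also have "L2_inner (\<lambda>_. 1) (\<lambda>x. of_real (W s x)) = cnj (fourier_coeff (\<lambda>x. of_real (W s x)) 0)"
      by (simp add: fourier_coeff_zero_eq cnj_L2_inner)
    finally have eq: "L2_inner (w s) (\<lambda>x. of_real (W s x)) = h 0 s"
      by (simp add: fourier_coeff_W W_coeff_0[OF s0])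
    show "(\<lambda>N. \<Sum>n\<in>modes N. fourier_coeff (w s) n * cnj (W_coeff n s)) \<longlonglongrightarrow> h 0 s"
      using Parseval[OF w_L2[OF s0] W_L2[OF s0]] by (simp add: fourier_coeff_W eq)
    fix N
    have "cmod (\<Sum>n\<in>modes N. fourier_coeff (w s) n * cnj (W_coeff n s)) \<le> L2_norm (w s) * L2_norm (\<lambda>x. complex_of_real (W s x))"
      unfolding fourier_coeff_W[symmetric] by (intro cmod_sum_fourier_coeff_le w_L2 W_L2 s0) simp
    also have "\<dots> \<le> (B + 1) * \<rho> s"
      using L2_norm_W_le[OF s0] B s by (intro mult_mono) auto
    finally show "cmod (\<Sum>n\<in>modes N. fourier_coeff (w s) n * cnj (W_coeff n s)) \<le> (B + 1) * \<rho> s" .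
  qed
qed

text \<open>The 12 is 4 + 8: after absorbing \<open>4 * (x * g)\<close> into
  \<open>x\<^sup>2 + 4 * g\<^sup>2\<close>, there remain \<open>4 * M\<close> from the integral and
  at most \<open>8 * M\<close> from \<open>4 * g\<^sup>2\<close>. A strict level \<open>c\<close>
  leaves room for the error of truncating the modes. The threshold for \<open>N\<close> depends on
  \<open>t\<close>, but the bound does not.\<close>

theorem eventually_L2_norm_w_squared_less:
  assumes t: "T \<le> t" and c: "c < (L2_norm (w t))\<^sup>2"
  shows "\<forall>\<^sub>F N in sequentially. c < 12 * M N k"
proof -
  define X where "X N = (LBINT s:{0..t}. (\<Sum>n\<in>modes N. fourier_coeff (w s) n * cnj (W_coeff n s)))" for N
  define x where "x = L2_norm (w t)"
  define I where "I = (LBINT s:{0..t}. h 0 s)"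
  have t0: "0 \<le> t" using t T by simp
  have "(\<lambda>N. cmod (X N)) \<longlonglongrightarrow> cmod I"
    unfolding X_def I_def by (intro tendsto_norm integral_w_W_tendsto t0)
  \<comment> \<open>After multiplication by 4 this margin is exactly the gap between
    \<open>x\<^sup>2\<close> and \<open>c\<close>.\<close>
  moreover have "cmod I - (x\<^sup>2 - c) / 4 < cmod I" using c by (simp add: x_def)
  ultimately have "\<forall>\<^sub>F N in sequentially. cmod I - (x\<^sup>2 - c) / 4 < cmod (X N)"
    by (rule order_tendstoD(1))
  moreover have "\<forall>\<^sub>F N in sequentially. t \<le> real N"
    using eventually_ge_at_top[of "nat \<lceil>t\<rceil>"] by eventually_elim linarith
  ultimately show ?thesis
  proof eventually_elim
    case (elim N)
    define g where "g = G_norm N k t"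
    have "x\<^sup>2 \<le> 2 * cmod I"
      using L2_norm_w_squared[OF t0] abs_Im_le_cmod[of I] by (simp add: x_def I_def)
    moreover have "cmod (X N) \<le> M N k + x * g"
      unfolding X_def x_def g_def by (rule cmod_integral_w_W_le) (use t elim in auto)
    moreover have "g\<^sup>2 \<le> 2 * M N k" unfolding g_def by (rule G_norm_squared_le[OF t])
    moreover have "4 * (x * g) \<le> x\<^sup>2 + 4 * g\<^sup>2"
      using zero_le_power2[of "x - 2 * g"] by (simp add: power2_eq_square algebra_simps)
    moreover have "4 * cmod I - (x\<^sup>2 - c) < 4 * cmod (X N)" using elim(1) by (simp add: field_simps)
    ultimately show ?case by linarith
  qed
qed

end

section \<open>Integration over \<open>k\<close>\<close>

locale potential_primitive = potential +
  fixes Q :: "real \<Rightarrow> real \<Rightarrow> real"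
  assumes Q_L2: "\<And>s. s \<ge> 0 \<Longrightarrow> (\<lambda>x. complex_of_real (Q s x)) \<in> L2_torus"
    and Q_le: "\<And>s. s \<ge> 0 \<Longrightarrow> L2_norm (\<lambda>x. complex_of_real (Q s x)) \<le> \<rho> s"
    and V_coeff: "\<And>s n. s \<ge> 0 \<Longrightarrow> (1 + s) * cmod (fourier_coeff (\<lambda>x. complex_of_real (V s x)) n)
      = \<bar>of_int n\<bar> * cmod (fourier_coeff (\<lambda>x. complex_of_real (Q s x)) n)"
    and \<rho>_meas [measurable]: "\<rho> \<in> borel_measurable borel"
begin

text \<open>\<open>phase 0\<close> is constant, so this mode would have no decay in
  \<open>k\<close>; it vanishes because \<open>V\<close> has mean zero.\<close>

lemma G_0: "r \<ge> 0 \<Longrightarrow> G N 0 k r = 0"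
proof -
  assume "r \<ge> 0"
  then have "G N 0 k r = (LBINT s:{r..real N}. 0)"
    unfolding G_def by (intro set_lebesgue_integral_cong) (auto simp: v_def W_coeff_0)
  then show ?thesis by (simp add: set_lebesgue_integral_def)
qed

text \<open>The squared modulus of \<open>W_coeff n s\<close> divided by the derivative of
  \<open>phase n\<close>, that is, the integrand of Plancherel's inequality. For
  \<open>n \<noteq> 0\<close> and \<open>s > T\<close> it is the squared modulus of the coefficient
  of \<open>Q\<close>; for \<open>n = 0\<close> division by zero makes it 0.\<close>

definition q :: "int \<Rightarrow> real \<Rightarrow> real" where
  "q n s = (cmod (W_coeff n s) * (1 + s) / of_int n)\<^sup>2"

lemma q_measurable [measurable]: "q n \<in> borel_measurable borel"
  unfolding q_def[abs_def] by measurable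

lemma q_le: "s \<ge> 0 \<Longrightarrow> q n s \<le> (cmod (fourier_coeff (\<lambda>x. complex_of_real (Q s x)) n))\<^sup>2"
  using V_coeff[of s n]
  by (cases "n = 0"; cases "T < s") (auto simp: q_def W_coeff_def power_mult_distrib power_divide mult.commute)

lemma sum_q_le:
  assumes "s \<ge> 0"
  shows "(\<Sum>n\<in>modes N. q n s) \<le> (\<rho> s)\<^sup>2"
proof -
  have "(\<Sum>n\<in>modes N. q n s) \<le> (\<Sum>n\<in>modes N. (cmod (fourier_coeff (\<lambda>x. complex_of_real (Q s x)) n))\<^sup>2)"
    by (intro sum_mono q_le assms)
  also have "\<dots> \<le> (L2_norm (\<lambda>x. complex_of_real (Q s x)))\<^sup>2"
    by (intro Bessel_inequality Q_L2 assms) simp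
  also have "\<dots> \<le> (\<rho> s)\<^sup>2" by (intro power_mono Q_le assms) simp
  finally show ?thesis .
qed

lemma nn_integral_G_squared_le:
  assumes r: "r \<ge> 0"
  shows "(\<integral>\<^sup>+k. ennreal ((cmod (G N n k r))\<^sup>2) \<partial>lborel)
    \<le> ennreal (2 * pi) * (\<integral>\<^sup>+s. ennreal (indicator {r..real N} s * q n s) \<partial>lborel)"
\<comment> \<open>Plancherel's inequality needs a strictly increasing phase and an interval with
  ordered endpoints; in the excluded cases \<open>G\<close> is zero.\<close>
proof (cases "n = 0 \<or> real N < r")
  case True
  then have "G N n k r = 0" for k using G_0[OF r] by (auto simp: G_def set_lebesgue_integral_def)
  then show ?thesis by simp
next
  case False
  then have n: "n \<noteq> 0" and rN: "r \<le> real N" by auto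
  define F where "F s = indicator {r..real N} s *\<^sub>R W_coeff n s" for s
  define \<phi>' where "\<phi>' s = (of_int n)\<^sup>2 / (1 + s)\<^sup>2" for s :: real
  have [measurable]: "F \<in> borel_measurable borel" unfolding F_def[abs_def] by measurable
  have osc: "osc_integral (phase n) F k = G N n k r" for k
    by (simp add: osc_integral_def G_def v_def F_def set_lebesgue_integral_def)
  have "(\<integral>\<^sup>+k. ennreal ((cmod (osc_integral (phase n) F k))\<^sup>2) \<partial>lborel)
      \<le> ennreal (2 * pi) * (\<integral>\<^sup>+s. ennreal ((cmod (F s))\<^sup>2 / \<phi>' s) \<partial>lborel)"
  proof (rule nn_integral_osc_integral_le[OF rN])
    show "(phase n has_real_derivative \<phi>' x) (at x)" if "x \<in> {r..real N}" for x
      unfolding phase_def[abs_def] \<phi>'_def using that r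
      by (auto intro!: derivative_eq_intros simp: power2_eq_square)
    show "continuous_on {r..real N} \<phi>'"
      unfolding \<phi>'_def[abs_def] using r by (intro continuous_intros) auto
    show "\<phi>' x > 0" if "x \<in> {r..real N}" for x using that r n by (auto simp: \<phi>'_def)
    show "integrable lborel F"
      using v_set_integrable[OF r, of "real N" n 0] by (simp add: F_def[abs_def] set_integrable_def v_def)
    show "\<phi>' \<in> borel_measurable borel" unfolding \<phi>'_def[abs_def] by measurable
  qed (auto simp: F_def)
  also have "(\<integral>\<^sup>+s. ennreal ((cmod (F s))\<^sup>2 / \<phi>' s) \<partial>lborel) = (\<integral>\<^sup>+s. ennreal (indicator {r..real N} s * q n s) \<partial>lborel)"
    by (intro nn_integral_cong) (auto simp: F_def q_def \<phi>'_def indicator_def power_mult_distrib power_divide)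
  finally show ?thesis unfolding osc .
qed

text \<open>The modes are summed under the integral over \<open>s\<close>, where Bessel's inequality
  for \<open>Q s\<close> applies. The bound is free of \<open>N\<close>, as the later limit
  requires.\<close>

lemma nn_integral_G_norm_squared_le:
  assumes r: "r \<ge> 0"
  shows "(\<integral>\<^sup>+k. ennreal ((G_norm N k r)\<^sup>2) \<partial>lborel)
    \<le> ennreal (2 * pi) * (\<integral>\<^sup>+s. ennreal (indicator {r..} s * (\<rho> s)\<^sup>2) \<partial>lborel)"
proof -
  have "(\<integral>\<^sup>+k. ennreal ((G_norm N k r)\<^sup>2) \<partial>lborel) = (\<integral>\<^sup>+k. (\<Sum>n\<in>modes N. ennreal ((cmod (G N n k r))\<^sup>2)) \<partial>lborel)"
    by (simp add: G_norm_def L2_set_def sum_nonneg)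
  also have "\<dots> = (\<Sum>n\<in>modes N. \<integral>\<^sup>+k. ennreal ((cmod (G N n k r))\<^sup>2) \<partial>lborel)"
    by (rule nn_integral_sum) simp
  also have "\<dots> \<le> (\<Sum>n\<in>modes N. ennreal (2 * pi) * (\<integral>\<^sup>+s. ennreal (indicator {r..real N} s * q n s) \<partial>lborel))"
    by (intro sum_mono nn_integral_G_squared_le r)
  also have "\<dots> = ennreal (2 * pi) * (\<integral>\<^sup>+s. (\<Sum>n\<in>modes N. ennreal (indicator {r..real N} s * q n s)) \<partial>lborel)"
    by (subst nn_integral_sum) (auto simp: sum_distrib_left)
  also have "\<dots> \<le> ennreal (2 * pi) * (\<integral>\<^sup>+s. ennreal (indicator {r..} s * (\<rho> s)\<^sup>2) \<partial>lborel)"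
  proof (intro mult_left_mono nn_integral_mono)
    fix s
    have "(\<Sum>n\<in>modes N. indicator {r..real N} s * q n s) \<le> indicator {r..} s * (\<rho> s)\<^sup>2"
      using sum_q_le[of s N] r by (auto simp: indicator_def sum_nonneg q_def)
    then show "(\<Sum>n\<in>modes N. ennreal (indicator {r..real N} s * q n s)) \<le> ennreal (indicator {r..} s * (\<rho> s)\<^sup>2)"
      by (subst sum_ennreal) (auto simp: q_def intro: ennreal_leI)
  qed simp
  finally show ?thesis .
qed

lemma M_measurable [measurable]: "M N \<in> borel_measurable borel"
proof -
  have "M N = (\<lambda>k. LBINT r. indicator {T..real N} r * (\<rho> r * G_norm N k r))"
    by (simp add: M_def fun_eq_iff set_lebesgue_integral_def)
  then show ?thesis by simp
qed

text \<open>
  Cauchy--Schwarz with the weight \<open>\<sigma>\<close>, chosen as the square root of the tail bound, replaces Minkowski's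
  integral inequality.
\<close>

lemma nn_integral_M_squared_le:
  assumes [measurable]: "\<sigma> \<in> borel_measurable borel" and \<sigma>: "\<And>s. s \<ge> 0 \<Longrightarrow> \<sigma> s > 0" and "\<kappa> \<ge> 0"
    and tail: "\<And>r. r \<ge> 0 \<Longrightarrow> (\<integral>\<^sup>+s. ennreal (indicator {r..} s * (\<rho> s)\<^sup>2) \<partial>lborel) \<le> ennreal (\<kappa> * (\<sigma> r)\<^sup>2)"
  shows "(\<integral>\<^sup>+k. ennreal ((M N k)\<^sup>2) \<partial>lborel)
    \<le> ennreal (2 * pi * \<kappa>) * (\<integral>\<^sup>+r. ennreal (indicator {T..} r * (\<rho> r * \<sigma> r)) \<partial>lborel)\<^sup>2"
proof -
  define A where "A = (\<integral>\<^sup>+r. ennreal (indicator {T..} r * (\<rho> r * \<sigma> r)) \<partial>lborel)"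
  define I where "I = {T..real N}"
  have pos: "\<rho> r > 0" "\<sigma> r > 0" if "r \<in> I" for r using that T \<rho>_pos \<sigma> by (auto simp: I_def)
  have [measurable]: "I \<in> sets borel" by (simp add: I_def)
  have M_sq: "ennreal ((M N k)\<^sup>2) \<le> A * (\<integral>\<^sup>+r. ennreal (indicator I r * (\<rho> r / \<sigma> r)) * ennreal ((G_norm N k r)\<^sup>2) \<partial>lborel)" for k
  proof -
    \<comment> \<open>The weight is split so that the integral of \<open>f\<close> squared is at
      most \<open>A\<close>, while in \<open>g\<close> squared the tail bound
      \<open>\<kappa> * (\<sigma> r)\<^sup>2\<close> turns \<open>\<rho> / \<sigma>\<close> back
      into \<open>\<rho> * \<sigma>\<close>. Hence \<open>A\<close> appears twice in the
      result.\<close>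
    define f where "f r = ennreal (indicator I r * sqrt (\<rho> r * \<sigma> r))" for r
    define g where "g r = ennreal (indicator I r * (sqrt (\<rho> r / \<sigma> r) * G_norm N k r))" for r
    have [measurable]: "f \<in> borel_measurable borel" "g \<in> borel_measurable borel"
      unfolding f_def[abs_def] g_def[abs_def] by measurable
    have "ennreal (M N k) = (\<integral>\<^sup>+r. ennreal (indicator I r * (\<rho> r * G_norm N k r)) \<partial>lborel)"
      using \<rho>_G_norm_set_integrable[OF T, of "real N" N k] less_imp_le[OF pos(1)]
      unfolding M_def set_lebesgue_integral_def set_integrable_def I_def real_scaleR_def
      by (intro nn_integral_eq_integral[symmetric] AE_I2) (auto simp: indicator_def)
    also have "\<dots> = (\<integral>\<^sup>+r. f r * g r \<partial>lborel)"
    proof (intro nn_integral_cong)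
      fix r
      show "ennreal (indicator I r * (\<rho> r * G_norm N k r)) = f r * g r"
      proof (cases "r \<in> I")
        case True
        have "sqrt (\<rho> r * \<sigma> r) * sqrt (\<rho> r / \<sigma> r) = \<rho> r"
          using pos[OF True] by (simp flip: real_sqrt_mult)
        then have "\<rho> r * G_norm N k r = sqrt (\<rho> r * \<sigma> r) * (sqrt (\<rho> r / \<sigma> r) * G_norm N k r)"
          by (simp flip: mult.assoc)
        then show ?thesis using True pos[OF True] by (simp add: f_def g_def flip: ennreal_mult)
      qed (simp add: f_def)
    qed
    finally have "ennreal ((M N k)\<^sup>2) = (\<integral>\<^sup>+r. f r * g r \<partial>lborel)\<^sup>2"
      using M_nonneg by (simp flip: ennreal_power)
    also have "\<dots> \<le> (\<integral>\<^sup>+r. f r ^ 2 \<partial>lborel) * (\<integral>\<^sup>+r. g r ^ 2 \<partial>lborel)"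
      by (rule Cauchy_Schwarz_nn_integral) simp_all
    also have "\<dots> \<le> A * (\<integral>\<^sup>+r. ennreal (indicator I r * (\<rho> r / \<sigma> r)) * ennreal ((G_norm N k r)\<^sup>2) \<partial>lborel)"
    proof (intro mult_mono)
      show "(\<integral>\<^sup>+r. f r ^ 2 \<partial>lborel) \<le> A"
        unfolding A_def f_def
      proof (intro nn_integral_mono)
        fix r
        show "(ennreal (indicator I r * sqrt (\<rho> r * \<sigma> r)))\<^sup>2 \<le> ennreal (indicator {T..} r * (\<rho> r * \<sigma> r))"
          using pos[of r] by (cases "r \<in> I") (auto simp: ennreal_power I_def)
      qed
      have "(\<integral>\<^sup>+r. g r ^ 2 \<partial>lborel)
          = (\<integral>\<^sup>+r. ennreal (indicator I r * (\<rho> r / \<sigma> r)) * ennreal ((G_norm N k r)\<^sup>2) \<partial>lborel)"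
        unfolding g_def
      proof (intro nn_integral_cong)
        fix r
        show "(ennreal (indicator I r * (sqrt (\<rho> r / \<sigma> r) * G_norm N k r)))\<^sup>2
            = ennreal (indicator I r * (\<rho> r / \<sigma> r)) * ennreal ((G_norm N k r)\<^sup>2)"
          using pos[of r] by (cases "r \<in> I") (auto simp: ennreal_power power_mult_distrib ennreal_mult)
      qed
      then show "(\<integral>\<^sup>+r. g r ^ 2 \<partial>lborel)
          \<le> (\<integral>\<^sup>+r. ennreal (indicator I r * (\<rho> r / \<sigma> r)) * ennreal ((G_norm N k r)\<^sup>2) \<partial>lborel)" by simp
    qed simp_all
    finally show ?thesis .
  qed
  have "(\<integral>\<^sup>+k. ennreal ((M N k)\<^sup>2) \<partial>lborel)
      \<le> (\<integral>\<^sup>+k. A * (\<integral>\<^sup>+r. ennreal (indicator I r * (\<rho> r / \<sigma> r)) * ennreal ((G_norm N k r)\<^sup>2) \<partial>lborel) \<partial>lborel)"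
    by (intro nn_integral_mono M_sq)
  also have "\<dots> = A * (\<integral>\<^sup>+k. \<integral>\<^sup>+r. ennreal (indicator I r * (\<rho> r / \<sigma> r)) * ennreal ((G_norm N k r)\<^sup>2) \<partial>lborel \<partial>lborel)"
    by (rule nn_integral_cmult) measurable
  also have "(\<integral>\<^sup>+k. \<integral>\<^sup>+r. ennreal (indicator I r * (\<rho> r / \<sigma> r)) * ennreal ((G_norm N k r)\<^sup>2) \<partial>lborel \<partial>lborel)
      = (\<integral>\<^sup>+r. \<integral>\<^sup>+k. ennreal (indicator I r * (\<rho> r / \<sigma> r)) * ennreal ((G_norm N k r)\<^sup>2) \<partial>lborel \<partial>lborel)"
    by (rule lborel_pair.Fubini'[symmetric]) measurable
  also have "\<dots> = (\<integral>\<^sup>+r. ennreal (indicator I r * (\<rho> r / \<sigma> r)) * (\<integral>\<^sup>+k. ennreal ((G_norm N k r)\<^sup>2) \<partial>lborel) \<partial>lborel)"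
    by (intro nn_integral_cong nn_integral_cmult) measurable
  also have "\<dots> \<le> (\<integral>\<^sup>+r. ennreal (2 * pi * \<kappa>) * ennreal (indicator {T..} r * (\<rho> r * \<sigma> r)) \<partial>lborel)"
  proof (intro nn_integral_mono)
    fix r
    show "ennreal (indicator I r * (\<rho> r / \<sigma> r)) * (\<integral>\<^sup>+k. ennreal ((G_norm N k r)\<^sup>2) \<partial>lborel)
        \<le> ennreal (2 * pi * \<kappa>) * ennreal (indicator {T..} r * (\<rho> r * \<sigma> r))"
    proof (cases "r \<in> I")
      case True
      then have r: "r \<ge> 0" using T by (simp add: I_def)
      have "(\<integral>\<^sup>+k. ennreal ((G_norm N k r)\<^sup>2) \<partial>lborel) \<le> ennreal (2 * pi) * ennreal (\<kappa> * (\<sigma> r)\<^sup>2)"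
        by (intro order_trans[OF nn_integral_G_norm_squared_le[OF r]] mult_left_mono tail r) simp
      then have "ennreal (indicator I r * (\<rho> r / \<sigma> r)) * (\<integral>\<^sup>+k. ennreal ((G_norm N k r)\<^sup>2) \<partial>lborel)
          \<le> ennreal (\<rho> r / \<sigma> r) * (ennreal (2 * pi) * ennreal (\<kappa> * (\<sigma> r)\<^sup>2))"
        using True by (intro mult_mono) auto
      also have "\<dots> = ennreal (\<rho> r / \<sigma> r * (2 * pi * (\<kappa> * (\<sigma> r)\<^sup>2)))"
        using pos[OF True] \<open>\<kappa> \<ge> 0\<close> by (subst ennreal_mult[symmetric], simp, simp)+ simp
      also have "\<rho> r / \<sigma> r * (2 * pi * (\<kappa> * (\<sigma> r)\<^sup>2)) = 2 * pi * \<kappa> * (\<rho> r * \<sigma> r)"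
        using pos[OF True] by (simp add: power2_eq_square)
      also have "ennreal \<dots> = ennreal (2 * pi * \<kappa>) * ennreal (\<rho> r * \<sigma> r)"
        using pos[OF True] \<open>\<kappa> \<ge> 0\<close> by (intro ennreal_mult) auto
      finally show ?thesis using True by (simp add: I_def)
    qed simp
  qed
  also have "\<dots> = ennreal (2 * pi * \<kappa>) * A" unfolding A_def by (rule nn_integral_cmult) measurable
  finally show ?thesis unfolding A_def[symmetric]
    by (simp add: mult_left_mono mult.left_commute power2_eq_square)
qed

text \<open>For each \<open>k\<close> the lower limit of \<open>144 * (M N k)\<^sup>2\<close>
  dominates every \<open>t\<close> at once, so the supremum is gone before integrating. Here 144 is
  the square of 12, and 288 is 144 times the 2 of \<open>2 * pi\<close>.\<close>

theorem nn_integral_SUP_L2_norm_le: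
  assumes \<sigma>: "\<sigma> \<in> borel_measurable borel" "\<And>s. s \<ge> 0 \<Longrightarrow> \<sigma> s > 0" "\<kappa> \<ge> 0"
    and tail: "\<And>r. r \<ge> 0 \<Longrightarrow> (\<integral>\<^sup>+s. ennreal (indicator {r..} s * (\<rho> s)\<^sup>2) \<partial>lborel) \<le> ennreal (\<kappa> * (\<sigma> r)\<^sup>2)"
    and sol: "\<And>k. mild_solution k W (\<lambda>_. 1) (u k)"
  shows "(\<integral>\<^sup>+k. (SUP t\<in>{T<..}. ennreal (L2_norm (\<lambda>x. 1 - u k t x) ^ 4)) \<partial>lborel)
    \<le> ennreal (288 * pi * \<kappa>) * (\<integral>\<^sup>+r. ennreal (indicator {T..} r * (\<rho> r * \<sigma> r)) \<partial>lborel)\<^sup>2"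
proof -
  define B where "B = (\<integral>\<^sup>+r. ennreal (indicator {T..} r * (\<rho> r * \<sigma> r)) \<partial>lborel)\<^sup>2"
  have "(SUP t\<in>{T<..}. ennreal (L2_norm (\<lambda>x. 1 - u k t x) ^ 4)) \<le> liminf (\<lambda>N. ennreal (144 * (M N k)\<^sup>2))" for k
  proof (rule SUP_least)
    interpret S: potential_solution V T \<rho> k "u k"
      by unfold_locales (rule sol)
    fix t assume t: "t \<in> {T<..}"
    define x where "x = (L2_norm (S.w t))\<^sup>2"
    have x: "L2_norm (\<lambda>x. 1 - u k t x) ^ 4 = x\<^sup>2"
      by (simp add: x_def S.w_def[abs_def] L2_norm_minus_commute[of "\<lambda>_. 1"] flip: power_mult)
    show "ennreal (L2_norm (\<lambda>x. 1 - u k t x) ^ 4) \<le> liminf (\<lambda>N. ennreal (144 * (M N k)\<^sup>2))"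
      \<comment> \<open>The lower limit is tested with strictly smaller \<open>y\<close>, since the
        bound by \<open>12 * M N k\<close> is available only at levels strictly below the squared
        norm.\<close>
      unfolding x le_Liminf_iff
    proof (intro allI impI)
      fix y assume y: "y < ennreal (x\<^sup>2)"
      then obtain y' where y': "y = ennreal y'" "0 \<le> y'"
        by (cases y) auto
      then have "sqrt y' < x"
        using y by (simp add: ennreal_less_iff x_def real_less_lsqrt)
      then have "\<forall>\<^sub>F N in sequentially. sqrt y' < 12 * M N k"
        using t unfolding x_def by (intro S.eventually_L2_norm_w_squared_less) auto
      then show "\<forall>\<^sub>F N in sequentially. y < ennreal (144 * (M N k)\<^sup>2)"
      proof eventually_elim
        case (elim N)
        then have "(sqrt y')\<^sup>2 < (12 * M N k)\<^sup>2" by (intro power_strict_mono) (auto simp: y')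
        then show ?case using y' by (simp add: ennreal_less_iff power_mult_distrib)
      qed
    qed
  qed
  then have "(\<integral>\<^sup>+k. (SUP t\<in>{T<..}. ennreal (L2_norm (\<lambda>x. 1 - u k t x) ^ 4)) \<partial>lborel)
      \<le> (\<integral>\<^sup>+k. liminf (\<lambda>N. ennreal (144 * (M N k)\<^sup>2)) \<partial>lborel)"
    by (rule nn_integral_mono)
  also have "\<dots> \<le> liminf (\<lambda>N. \<integral>\<^sup>+k. ennreal (144 * (M N k)\<^sup>2) \<partial>lborel)"
    by (rule nn_integral_liminf) measurable
  also have "\<dots> \<le> ennreal 144 * (ennreal (2 * pi * \<kappa>) * B)"
  proof (intro Liminf_le always_eventually allI)
    fix N
    have "(\<integral>\<^sup>+k. ennreal (144 * (M N k)\<^sup>2) \<partial>lborel) = ennreal 144 * (\<integral>\<^sup>+k. ennreal ((M N k)\<^sup>2) \<partial>lborel)"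
      by (subst nn_integral_cmult[symmetric]) (auto simp: ennreal_mult)
    also have "\<dots> \<le> ennreal 144 * (ennreal (2 * pi * \<kappa>) * B)"
      unfolding B_def by (intro mult_left_mono nn_integral_M_squared_le \<sigma> tail) auto
    finally show "(\<integral>\<^sup>+k. ennreal (144 * (M N k)\<^sup>2) \<partial>lborel) \<le> ennreal 144 * (ennreal (2 * pi * \<kappa>) * B)" .
  qed simp
  also have "\<dots> = ennreal (144 * (2 * pi * \<kappa>)) * B"
    using \<sigma>(3) by (subst ennreal_mult) (auto simp: mult.assoc)
  also have "144 * (2 * pi * \<kappa>) = 288 * pi * \<kappa>" by simp
  finally show ?thesis by (simp only: B_def)
qed

end

section \<open>Weak derivatives and the main estimate\<close>

text \<open>General \<open>a\<close> and \<open>b\<close> make the family closed under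
  differentiation, as the induction over the order of the derivative in
  \<open>smooth_periodic_cos_sin\<close> requires.\<close>

lemma has_real_derivative_cos_sin:
  fixes a b c x :: real
  shows "((\<lambda>x. a * cos (c * x) + b * sin (c * x)) has_real_derivative
    (b * c) * cos (c * x) + (- a * c) * sin (c * x)) (at x)"
  by (auto intro!: derivative_eq_intros simp: algebra_simps)

lemma deriv_cos_sin:
  fixes a b c :: real
  shows "deriv (\<lambda>x. a * cos (c * x) + b * sin (c * x)) = (\<lambda>x. (b * c) * cos (c * x) + (- a * c) * sin (c * x))"
  by (rule ext, rule DERIV_imp_deriv, rule has_real_derivative_cos_sin)

lemma smooth_periodic_cos_sin:
  fixes a b :: real and n :: int
  shows "smooth_periodic (\<lambda>x. a * cos (of_int n * x) + b * sin (of_int n * x))"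
  unfolding smooth_periodic_def
proof (intro conjI allI)
  fix x :: real
  have "of_int n * (x + 2 * pi) = of_int n * x + of_int n * (2 * pi)" by (simp add: distrib_left)
  then show "a * cos (of_int n * (x + 2 * pi)) + b * sin (of_int n * (x + 2 * pi))
      = a * cos (of_int n * x) + b * sin (of_int n * x)"
    using cos.plus_of_int[of "of_int n * x" n] sin.plus_of_int[of "of_int n * x" n] by simp
next
  fix m x
  have "\<exists>a' b'. (deriv ^^ m) (\<lambda>x. a * cos (of_int n * x) + b * sin (of_int n * x))
      = (\<lambda>x. a' * cos (of_int n * x) + b' * sin (of_int n * x))"
  proof (induction m)
    case (Suc m)
    then obtain a' b' where "(deriv ^^ m) (\<lambda>x. a * cos (of_int n * x) + b * sin (of_int n * x))
      = (\<lambda>x. a' * cos (of_int n * x) + b' * sin (of_int n * x))" by blast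
    then have "(deriv ^^ Suc m) (\<lambda>x. a * cos (of_int n * x) + b * sin (of_int n * x))
      = (\<lambda>x. (b' * of_int n) * cos (of_int n * x) + (- a' * of_int n) * sin (of_int n * x))"
      by (simp only: funpow.simps comp_def deriv_cos_sin)
    then show ?case by blast
  qed auto
  then obtain a' b' where "(deriv ^^ m) (\<lambda>x. a * cos (of_int n * x) + b * sin (of_int n * x))
      = (\<lambda>x. a' * cos (of_int n * x) + b' * sin (of_int n * x))" by blast
  then show "(deriv ^^ m) (\<lambda>x. a * cos (of_int n * x) + b * sin (of_int n * x)) differentiable at x"
    unfolding real_differentiable_def by (simp only:) (rule exI, rule has_real_derivative_cos_sin)
qed

lemma integrable_torus_mult_bounded:
  fixes q :: "real \<Rightarrow> real"
  assumes q: "integrable torus q" and [measurable]: "g \<in> borel_measurable borel" and g: "\<And>x. \<bar>g x\<bar> \<le> 1"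
  shows "integrable torus (\<lambda>x. q x * g x)"
proof (rule Bochner_Integration.integrable_bound[OF q])
  have [measurable]: "q \<in> borel_measurable borel" using q by (simp add: integrable_iff_bounded)
  show "(\<lambda>x. q x * g x) \<in> borel_measurable torus" by measurable
  show "AE x in torus. norm (q x * g x) \<le> norm (q x)"
    using g by (intro AE_I2) (simp add: abs_mult mult_left_le)
qed

lemma fourier_coeff_of_real:
  fixes q :: "real \<Rightarrow> real"
  assumes "integrable torus q"
  shows "fourier_coeff (\<lambda>x. of_real (q x)) n
    = Complex (\<integral>x. q x * cos (of_int n * x) \<partial>torus) (- (\<integral>x. q x * sin (of_int n * x) \<partial>torus))"
proof -
  have c: "integrable torus (\<lambda>x. q x * cos (of_int n * x))"
    by (intro integrable_torus_mult_bounded assms) auto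
  have s: "integrable torus (\<lambda>x. q x * sin (of_int n * x))"
    by (intro integrable_torus_mult_bounded assms) auto
  have "fourier_coeff (\<lambda>x. of_real (q x)) n
      = (\<integral>x. complex_of_real (q x * cos (of_int n * x)) - \<i> * complex_of_real (q x * sin (of_int n * x)) \<partial>torus)"
    unfolding fourier_coeff_def L2_inner_def
    by (intro Bochner_Integration.integral_cong refl)
       (simp add: complex_eq_iff Re_exp Im_exp)
  also have "\<dots> = complex_of_real (\<integral>x. q x * cos (of_int n * x) \<partial>torus)
      - \<i> * complex_of_real (\<integral>x. q x * sin (of_int n * x) \<partial>torus)"
    using c s by (simp only: Bochner_Integration.integral_diff integral_mult_right_zero integral_complex_of_real
        complex_of_real_integrable_eq integrable_mult_right)
  finally show ?thesis by (simp add: complex_eq_iff)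
qed

text \<open>Test functions are real, so the real and imaginary parts are tested separately with
  \<open>cos\<close> and \<open>sin\<close>. The case \<open>n = 0\<close>, a constant test
  function, says that a weak derivative has mean zero.\<close>

lemma fourier_coeff_weak_deriv:
  assumes "weak_deriv q q'"
  shows "fourier_coeff (\<lambda>x. of_real (q' x)) n = \<i> * of_int n * fourier_coeff (\<lambda>x. of_real (q x)) n"
proof -
  have q: "integrable torus q" "integrable torus q'" using assms by (auto simp: weak_deriv_def)
  have test: "(\<integral>x. q x * deriv \<phi> x \<partial>torus) = - (\<integral>x. q' x * \<phi> x \<partial>torus)" if "smooth_periodic \<phi>" for \<phi>
    using assms that by (auto simp: weak_deriv_def)
  have "(\<integral>x. q' x * cos (of_int n * x) \<partial>torus) = of_int n * (\<integral>x. q x * sin (of_int n * x) \<partial>torus)"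
  proof -
    have "(\<integral>x. q' x * cos (of_int n * x) \<partial>torus) = - (\<integral>x. - of_int n * (q x * sin (of_int n * x)) \<partial>torus)"
      using test[OF smooth_periodic_cos_sin[of 1 n 0], unfolded deriv_cos_sin] by (simp add: ac_simps)
    then show ?thesis by (simp only: integral_mult_right_zero)
  qed
  moreover have "(\<integral>x. q' x * sin (of_int n * x) \<partial>torus) = - of_int n * (\<integral>x. q x * cos (of_int n * x) \<partial>torus)"
  proof -
    have "(\<integral>x. q' x * sin (of_int n * x) \<partial>torus) = - (\<integral>x. of_int n * (q x * cos (of_int n * x)) \<partial>torus)"
      using test[OF smooth_periodic_cos_sin[of 0 n 1], unfolded deriv_cos_sin] by (simp add: ac_simps)
    then show ?thesis by (simp only: integral_mult_right_zero)
  qed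
  ultimately show ?thesis unfolding fourier_coeff_of_real[OF q(1)] fourier_coeff_of_real[OF q(2)]
    by (simp add: complex_eq_iff)
qed

lemma AE_Linf_norm_less:
  assumes "Linf_norm f < ereal c"
  shows "AE x in torus. \<bar>f x\<bar> \<le> c"
  using esssup_AE[of "\<lambda>x. ereal \<bar>f x\<bar>" torus] unfolding Linf_norm_def[symmetric]
proof eventually_elim
  case (elim x)
  then have "ereal \<bar>f x\<bar> < ereal c" using assms by (rule le_less_trans)
  then show ?case by simp
qed

lemma nn_integral_powr_tail:
  fixes a p :: real
  assumes a: "a \<ge> 0" and p: "p > 1"
  shows "(\<integral>\<^sup>+s. ennreal (indicator {a..} s * (1 + s) powr (- p)) \<partial>lborel) = ennreal ((1 + a) powr (1 - p) / (p - 1))"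
proof -
  define F where "F s = - ((1 + s) powr (1 - p) / (p - 1))" for s
  have "(\<integral>\<^sup>+s. ennreal ((1 + s) powr (- p)) * indicator {a..} s \<partial>lborel) = ennreal (0 - F a)"
  proof (rule nn_integral_FTC_atLeast)
    fix x assume x: "a \<le> x"
    have "((\<lambda>s. (1 + s) powr (1 - p)) has_real_derivative (1 - p) * (1 + x) powr (1 - p - 1)) (at x)"
      using x a by (auto intro!: derivative_eq_intros)
    then have "((\<lambda>s. (1 + s) powr (1 - p) * (- 1 / (p - 1))) has_real_derivative
        (1 - p) * (1 + x) powr (1 - p - 1) * (- 1 / (p - 1))) (at x)"
      by (rule DERIV_cmult_right)
    moreover have "(1 - p) * y * (- 1 / (p - 1)) = y" for y
      using p by (simp add: field_simps)
    ultimately show "(F has_real_derivative (1 + x) powr (- p)) (at x)"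
      by (simp add: F_def[abs_def])
  next
    have "((\<lambda>s. (1 + s) powr (1 - p)) \<longlongrightarrow> 0) at_top"
      using p by real_asymp
    then have "((\<lambda>s. - ((1 + s) powr (1 - p) / (p - 1))) \<longlongrightarrow> - (0 / (p - 1))) at_top"
      by (intro tendsto_intros) (use p in auto)
    then show "(F \<longlongrightarrow> 0) at_top" by (simp add: F_def[abs_def])
  qed auto
  moreover have "(\<integral>\<^sup>+s. ennreal (indicator {a..} s * (1 + s) powr (- p)) \<partial>lborel)
      = (\<integral>\<^sup>+s. ennreal ((1 + s) powr (- p)) * indicator {a..} s \<partial>lborel)"
    by (intro nn_integral_cong) (auto simp: indicator_def)
  ultimately show ?thesis by (simp add: F_def)
qed

text \<open>Joint measurability is given for nonnegative times only; the integral over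
  \<open>x\<close> is measurable there and is then extended by zero.\<close>

lemma fourier_coeff_measurable:
  assumes meas: "(\<lambda>(t, x). Qx t x) \<in> borel_measurable (restrict_space lborel {0..} \<Otimes>\<^sub>M torus)"
  shows "(\<lambda>s. indicator {0..} s * fourier_coeff (\<lambda>x. complex_of_real (Qx s x / (s + 1))) n) \<in> borel_measurable borel"
proof -
  have [measurable]: "(\<lambda>t. t) \<in> borel_measurable (restrict_space lborel {0::real..})"
    by (rule measurable_restrict_space1) simp
  note [measurable] = meas
  have "(\<lambda>(s, x). complex_of_real ((case (s, x) of (s, x) \<Rightarrow> Qx s x) / (s + 1)) * cnj (expi n x))
      \<in> borel_measurable (restrict_space lborel {0..} \<Otimes>\<^sub>M torus)"
    by measurable
  then have "(\<lambda>(s, x). complex_of_real (Qx s x / (s + 1)) * cnj (expi n x))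
      \<in> borel_measurable (restrict_space lborel {0..} \<Otimes>\<^sub>M torus)" by simp
  then have "(\<lambda>s. fourier_coeff (\<lambda>x. complex_of_real (Qx s x / (s + 1))) n) \<in> borel_measurable (restrict_space lborel {0..})"
    unfolding fourier_coeff_eq L2_inner_def by (rule torus.borel_measurable_lebesgue_integral)
  then show ?thesis
    by (subst (asm) borel_measurable_restrict_space_iff) (auto simp: scaleR_conv_of_real of_real_indicator)
qed

theorem theorem2p2:
  fixes \<gamma> :: real
  assumes "\<gamma> > 3 / 4"
  shows "\<exists>C::real. \<forall>(lam::real) (Q::real \<Rightarrow> real \<Rightarrow> real) (Qx::real \<Rightarrow> real \<Rightarrow> real)
           (V::real \<Rightarrow> real \<Rightarrow> real) (T::real) (u::real \<Rightarrow> real \<Rightarrow> real \<Rightarrow> complex).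
     lam > 0 \<longrightarrow>
     (\<lambda>(t, x). Q t x) \<in> borel_measurable (restrict_space lborel {0..} \<Otimes>\<^sub>M torus) \<longrightarrow>
     (\<lambda>(t, x). Qx t x) \<in> borel_measurable (restrict_space lborel {0..} \<Otimes>\<^sub>M torus) \<longrightarrow>
     (\<forall>t\<ge>0. weak_deriv (Q t) (Qx t)) \<longrightarrow>
     (\<forall>t\<ge>0. Linf_norm (Q t) < ereal (lam * (t + 1) powr (- \<gamma>))) \<longrightarrow>
     (\<forall>t\<ge>0. Linf_norm (Qx t) < ereal (lam * (t + 1) powr (1 - \<gamma>))) \<longrightarrow>
     (\<forall>t\<ge>0. \<forall>x. V t x = Qx t x / (t + 1)) \<longrightarrow>
     T \<ge> 0 \<longrightarrow>
     (\<forall>k. mild_solution k (\<lambda>t x. V t x * indicator {T<..} t) (\<lambda>x. 1) (u k)) \<longrightarrow>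
     (\<integral>\<^sup>+ k. (SUP t\<in>{T<..}. ennreal (L2_norm (\<lambda>x. 1 - u k t x) ^ 4)) \<partial>lborel)
       \<le> ennreal (C * lam ^ 4 * (T + 1) powr (3 - 4 * \<gamma>))"
\<comment> \<open>The factor \<open>288 * pi\<close> comes from
  \<open>nn_integral_SUP_L2_norm_le\<close>, \<open>2 * \<gamma> - 1\<close> from the tail integral
  of the square of \<open>\<rho>\<close>, and \<open>2 * \<gamma> - 3 / 2\<close> from the integral
  of \<open>\<rho> * \<sigma>\<close>, which enters squared.\<close>
proof (intro exI[of _ "288 * pi / ((2 * \<gamma> - 1) * (2 * \<gamma> - 3 / 2)\<^sup>2)"] allI impI)
  fix lam T :: real and Q Qx V :: "real \<Rightarrow> real \<Rightarrow> real" and u :: "real \<Rightarrow> real \<Rightarrow> real \<Rightarrow> complex"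
  assume lam: "lam > 0"
    and Qx_meas: "(\<lambda>(t, x). Qx t x) \<in> borel_measurable (restrict_space lborel {0..} \<Otimes>\<^sub>M torus)"
    and weak: "\<forall>t\<ge>0. weak_deriv (Q t) (Qx t)"
    and Q_bound: "\<forall>t\<ge>0. Linf_norm (Q t) < ereal (lam * (t + 1) powr (- \<gamma>))"
    and Qx_bound: "\<forall>t\<ge>0. Linf_norm (Qx t) < ereal (lam * (t + 1) powr (1 - \<gamma>))"
    and V: "\<forall>t\<ge>0. \<forall>x. V t x = Qx t x / (t + 1)" and T: "T \<ge> 0"
    and sol: "\<forall>k. mild_solution k (\<lambda>t x. V t x * indicator {T<..} t) (\<lambda>x. 1) (u k)"
  define \<rho> where "\<rho> s = lam * (1 + s) powr (- \<gamma>)" for s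
  \<comment> \<open>With this choice \<open>\<kappa> * (\<sigma> r)\<^sup>2\<close> is exactly the
    integral of the square of \<open>\<rho>\<close> over \<open>{r..}\<close>.\<close>
  define \<sigma> where "\<sigma> s = (1 + s) powr (1 / 2 - \<gamma>)" for s :: real
  define \<kappa> where "\<kappa> = lam\<^sup>2 / (2 * \<gamma> - 1)"
  have Q_AE: "AE x in torus. \<bar>Q s x\<bar> \<le> \<rho> s" if "s \<ge> 0" for s
    using AE_Linf_norm_less[OF Q_bound[rule_format, OF that]] by (simp add: \<rho>_def add.commute)
  have V_eq: "V s = (\<lambda>x. Qx s x / (s + 1))" if "s \<ge> 0" for s using V that by auto
  have V_AE: "AE x in torus. \<bar>V s x\<bar> \<le> \<rho> s" if s: "s \<ge> 0" for s
    using AE_Linf_norm_less[OF Qx_bound[rule_format, OF s]]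
  proof eventually_elim
    case (elim x)
    then have "\<bar>Qx s x\<bar> / (1 + s) \<le> lam * (1 + s) powr (1 - \<gamma>) / (1 + s)"
      using s by (intro divide_right_mono) (auto simp: add.commute)
    \<comment> \<open>The division by \<open>1 + s\<close> lowers the exponent
      \<open>1 - \<gamma>\<close> to \<open>- \<gamma>\<close>, so one \<open>\<rho>\<close> bounds
      both \<open>V\<close> and \<open>Q\<close>.\<close>
    also have "\<dots> = \<rho> s" using s powr_add[of "1 + s" 1 "- \<gamma>"] by (simp add: \<rho>_def)
    finally show ?case using s by (simp add: V_eq[OF s] add.commute)
  qed
  have borel: "Q s \<in> borel_measurable borel" "V s \<in> borel_measurable borel" if s: "s \<ge> 0" for s
  proof -
    have "Q s \<in> borel_measurable torus" "Qx s \<in> borel_measurable torus"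
      using weak s unfolding weak_deriv_def by (blast intro: borel_measurable_integrable)+
    then show "Q s \<in> borel_measurable borel" "V s \<in> borel_measurable borel"
      by (auto simp: V_eq[OF s])
  qed
  have V_coeff: "fourier_coeff (\<lambda>x. complex_of_real (V s x)) n
      = \<i> * of_int n * fourier_coeff (\<lambda>x. complex_of_real (Q s x)) n / of_real (1 + s)" if s: "s \<ge> 0" for s n
  proof -
    have "fourier_coeff (\<lambda>x. complex_of_real (V s x)) n = fourier_coeff (\<lambda>x. complex_of_real (Qx s x)) n / of_real (1 + s)"
      by (simp add: V_eq[OF s] fourier_coeff_eq L2_inner_def add.commute)
    then show ?thesis using fourier_coeff_weak_deriv[OF weak[rule_format, OF s]] by simp
  qed
  have Q_L2: "(\<lambda>x. complex_of_real (Q s x)) \<in> L2_torus" if "s \<ge> 0" for s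
    by (rule L2_torus_bounded[where B = "\<rho> s"]) (use borel[OF that] Q_AE[OF that] in auto)
  interpret potential_primitive V T \<rho> Q
  proof
    show "T \<ge> 0" by (rule T)
    show \<rho>_pos: "\<rho> s > 0" if "s \<ge> 0" for s using that lam by (simp add: \<rho>_def)
    show "continuous_on {0..} \<rho>" unfolding \<rho>_def[abs_def] by (intro continuous_intros) auto
    show "\<rho> \<in> borel_measurable borel" unfolding \<rho>_def[abs_def] by measurable
    show "(\<lambda>s. indicator {0..} s * fourier_coeff (\<lambda>x. complex_of_real (V s x)) n) \<in> borel_measurable borel" for n
    proof -
      have "(\<lambda>s. indicator {0..} s * fourier_coeff (\<lambda>x. complex_of_real (V s x)) n)
          = (\<lambda>s. indicator {0..} s * fourier_coeff (\<lambda>x. complex_of_real (Qx s x / (s + 1))) n)"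
        using V_eq by (auto simp: indicator_def fun_eq_iff)
      then show ?thesis using fourier_coeff_measurable[OF Qx_meas] by simp
    qed
    fix s :: real assume s: "s \<ge> 0"
    show "AE x in torus. \<bar>V s x\<bar> \<le> \<rho> s" by (rule V_AE[OF s])
    show "(\<lambda>x. complex_of_real (V s x)) \<in> L2_torus"
      by (rule L2_torus_bounded[where B = "\<rho> s"]) (use borel[OF s] V_AE[OF s] in auto)
    show "fourier_coeff (\<lambda>x. complex_of_real (V s x)) 0 = 0" by (simp add: V_coeff[OF s])
    show "(\<lambda>x. complex_of_real (Q s x)) \<in> L2_torus" by (rule Q_L2[OF s])
    have "L2_norm (\<lambda>x. complex_of_real (Q s x)) \<le> \<rho> s * L2_norm (\<lambda>_. 1)"
      using Q_AE[OF s] borel[OF s] \<rho>_pos[OF s] by (intro L2_norm_le_dominated) (auto simp: L2_torus_const)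
    then show "L2_norm (\<lambda>x. complex_of_real (Q s x)) \<le> \<rho> s" by (simp add: L2_norm_const)
    show "(1 + s) * cmod (fourier_coeff (\<lambda>x. complex_of_real (V s x)) n)
        = \<bar>of_int n\<bar> * cmod (fourier_coeff (\<lambda>x. complex_of_real (Q s x)) n)" for n
      using s by (simp add: V_coeff[OF s] norm_mult norm_divide del: of_real_add)
  qed
  have W_eq: "W = (\<lambda>t x. V t x * indicator {T<..} t)" by (simp add: W_def fun_eq_iff)
  have \<kappa>: "\<kappa> \<ge> 0" using assms by (simp add: \<kappa>_def)
  have tail: "(\<integral>\<^sup>+s. ennreal (indicator {r..} s * (\<rho> s)\<^sup>2) \<partial>lborel) \<le> ennreal (\<kappa> * (\<sigma> r)\<^sup>2)" if r: "r \<ge> 0" for r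
  proof -
    have sq: "((1 + s) powr p)\<^sup>2 = (1 + s) powr (2 * p)" if "s \<ge> 0" for s p :: real
      using that by (simp add: powr_power mult.commute)
    have "(\<integral>\<^sup>+s. ennreal (indicator {r..} s * (\<rho> s)\<^sup>2) \<partial>lborel)
        = (\<integral>\<^sup>+s. ennreal (lam\<^sup>2) * ennreal (indicator {r..} s * (1 + s) powr (- (2 * \<gamma>))) \<partial>lborel)"
      using r sq[of _ "- \<gamma>"]
      by (intro nn_integral_cong) (auto simp: \<rho>_def indicator_def power_mult_distrib ennreal_mult)
    also have "\<dots> = ennreal (lam\<^sup>2) * ennreal ((1 + r) powr (1 - 2 * \<gamma>) / (2 * \<gamma> - 1))"
      using assms r by (subst nn_integral_cmult) (auto simp: nn_integral_powr_tail)
    also have "\<dots> = ennreal (\<kappa> * (\<sigma> r)\<^sup>2)"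
      using assms sq[OF r, of "1 / 2 - \<gamma>"] by (simp add: \<kappa>_def \<sigma>_def algebra_simps flip: ennreal_mult)
    finally show ?thesis by simp
  qed
  have \<rho>\<sigma>: "(\<integral>\<^sup>+r. ennreal (indicator {T..} r * (\<rho> r * \<sigma> r)) \<partial>lborel)
      = ennreal (lam * ((1 + T) powr (3 / 2 - 2 * \<gamma>) / (2 * \<gamma> - 3 / 2)))"
  proof -
    have "(\<integral>\<^sup>+r. ennreal (indicator {T..} r * (\<rho> r * \<sigma> r)) \<partial>lborel)
        = (\<integral>\<^sup>+r. ennreal lam * ennreal (indicator {T..} r * (1 + r) powr (- (2 * \<gamma> - 1 / 2))) \<partial>lborel)"
      using T lam
      by (intro nn_integral_cong)
         (auto simp: \<rho>_def \<sigma>_def indicator_def simp flip: ennreal_mult powr_add)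
    also have "\<dots> = ennreal lam * ennreal ((1 + T) powr (1 - (2 * \<gamma> - 1 / 2)) / (2 * \<gamma> - 1 / 2 - 1))"
    proof -
      \<comment> \<open>The exponents of \<open>\<rho>\<close> and \<open>\<sigma>\<close> add up to
        \<open>- (2 * \<gamma> - 1 / 2)\<close>; integrability at infinity is exactly the condition
        \<open>\<gamma> > 3 / 4\<close>.\<close>
      have "2 * \<gamma> - 1 / 2 > 1" using assms by simp
      then show ?thesis by (subst nn_integral_cmult) (measurable, simp only: nn_integral_powr_tail[OF T])
    qed
    also have "\<dots> = ennreal (lam * ((1 + T) powr (3 / 2 - 2 * \<gamma>) / (2 * \<gamma> - 3 / 2)))"
      using assms lam by (simp add: algebra_simps flip: ennreal_mult)
    finally show ?thesis .
  qed
  have "(\<integral>\<^sup>+ k. (SUP t\<in>{T<..}. ennreal (L2_norm (\<lambda>x. 1 - u k t x) ^ 4)) \<partial>lborel)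
      \<le> ennreal (288 * pi * \<kappa>) * (ennreal (lam * ((1 + T) powr (3 / 2 - 2 * \<gamma>) / (2 * \<gamma> - 3 / 2))))\<^sup>2"
    unfolding \<rho>\<sigma>[symmetric]
  proof (rule nn_integral_SUP_L2_norm_le)
    show "\<sigma> \<in> borel_measurable borel" unfolding \<sigma>_def[abs_def] by measurable
    show "\<sigma> s > 0" if "s \<ge> 0" for s using that by (simp add: \<sigma>_def)
    show "mild_solution k W (\<lambda>_. 1) (u k)" for k using sol by (simp add: W_eq)
  qed (rule \<kappa> tail, assumption?)+
  also have "\<dots> = ennreal (288 * pi * \<kappa> * (lam * ((1 + T) powr (3 / 2 - 2 * \<gamma>) / (2 * \<gamma> - 3 / 2)))\<^sup>2)"
    using assms lam \<kappa> by (simp add: ennreal_power ennreal_mult)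
  also have "288 * pi * \<kappa> * (lam * ((1 + T) powr (3 / 2 - 2 * \<gamma>) / (2 * \<gamma> - 3 / 2)))\<^sup>2
      = 288 * pi / ((2 * \<gamma> - 1) * (2 * \<gamma> - 3 / 2)\<^sup>2) * lam ^ 4 * ((1 + T) powr (3 / 2 - 2 * \<gamma>))\<^sup>2"
    by (simp add: \<kappa>_def power_mult_distrib power_divide power4_eq_xxxx power2_eq_square)
  also have "((1 + T) powr (3 / 2 - 2 * \<gamma>))\<^sup>2 = (T + 1) powr (3 - 4 * \<gamma>)"
    using T by (simp add: powr_power algebra_simps)
  finally show "(\<integral>\<^sup>+ k. (SUP t\<in>{T<..}. ennreal (L2_norm (\<lambda>x. 1 - u k t x) ^ 4)) \<partial>lborel)
      \<le> ennreal (288 * pi / ((2 * \<gamma> - 1) * (2 * \<gamma> - 3 / 2)\<^sup>2) * lam ^ 4 * (T + 1) powr (3 - 4 * \<gamma>))" .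
qed

end
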